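(* Let $\Gamma$ be a virtually polycyclic group which is strongly scale-invariant. Then $\Gamma$ is virtually nilpotent.
   Context: A group is polycyclic if it has a finite subnormal series with cyclic successive quotients, and virtually polycyclic if it has a polycyclic subgroup of finite index. A group is virtually nilpotent if it has a nilpotent subgroup of finite index. A monomorphism of a group $\Gamma$ is an injective group endomorphism $\varphi:\Gamma\to\Gamma$. A monomorphism $\varphi:\Gamma\to\Gamma$ is called strongly scale-invariant if $\varphi(\Gamma)$ has finite index in $\Gamma$ and $\bigcap_{n>0}\varphi^n(\Gamma)$ is finite. A group $\Gamma$ is called strongly scale-invariant if it admits a strongly scale-invariant monomorphism $\varphi:\Gamma\to\Gamma$. *)

theory Defs
  imports "HOL-Algebra.Algebra"
begin

definition polycyclic_group :: "('a, 'b) monoid_scheme \<Rightarrow> bool" where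
  "polycyclic_group G \<longleftrightarrow>
     (\<exists>(n::nat) H. H 0 = {\<one>\<^bsub>G\<^esub>} \<and> H n = carrier G \<and>
        (\<forall>i\<le>n. subgroup (H i) G) \<and>
        (\<forall>i<n. H i \<lhd> G\<lparr>carrier := H (Suc i)\<rparr> \<and>
               cyclic_group (G\<lparr>carrier := H (Suc i)\<rparr> Mod H i)))"

text \<open>Term \<open>n\<close> is indexed from \<open>0\<close>: term \<open>0\<close> is the whole group, and each next term is
  generated by the commutators of group elements with elements of the current term.\<close>

primrec lower_central_series :: "('a, 'b) monoid_scheme \<Rightarrow> nat \<Rightarrow> 'a set" where
  "lower_central_series G 0 = carrier G"
| "lower_central_series G (Suc n) =
     generate G (\<Union>x\<in>carrier G. \<Union>y\<in>lower_central_series G n.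
       {x \<otimes>\<^bsub>G\<^esub> y \<otimes>\<^bsub>G\<^esub> inv\<^bsub>G\<^esub> x \<otimes>\<^bsub>G\<^esub> inv\<^bsub>G\<^esub> y})"

definition nilpotent_group :: "('a, 'b) monoid_scheme \<Rightarrow> bool" where
  "nilpotent_group G \<longleftrightarrow> (\<exists>n. lower_central_series G n = {\<one>\<^bsub>G\<^esub>})"

definition finite_index_subgroup :: "'a set \<Rightarrow> ('a, 'b) monoid_scheme \<Rightarrow> bool" where
  "finite_index_subgroup H G \<longleftrightarrow> subgroup H G \<and> finite (rcosets\<^bsub>G\<^esub> H)"

definition virtually_polycyclic :: "('a, 'b) monoid_scheme \<Rightarrow> bool" where
  "virtually_polycyclic G \<longleftrightarrow>
     (\<exists>H. finite_index_subgroup H G \<and> polycyclic_group (G\<lparr>carrier := H\<rparr>))"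

definition virtually_nilpotent :: "('a, 'b) monoid_scheme \<Rightarrow> bool" where
  "virtually_nilpotent G \<longleftrightarrow>
     (\<exists>H. finite_index_subgroup H G \<and> nilpotent_group (G\<lparr>carrier := H\<rparr>))"

definition strongly_scale_invariant_mon ::
    "('a, 'b) monoid_scheme \<Rightarrow> ('a \<Rightarrow> 'a) \<Rightarrow> bool" where
  "strongly_scale_invariant_mon G \<phi> \<longleftrightarrow>
     \<phi> \<in> mon G G \<and>
     finite_index_subgroup (\<phi> ` carrier G) G \<and>
     finite (\<Inter>n\<in>{0<..}. (\<phi> ^^ n) ` carrier G)"

definition strongly_scale_invariant :: "('a, 'b) monoid_scheme \<Rightarrow> bool" where
  "strongly_scale_invariant G \<longleftrightarrow> (\<exists>\<phi>. strongly_scale_invariant_mon G \<phi>)"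

end

theory Submission
  imports Defs
begin

text \<open>
  A polycyclic group has a Hirsch length, which makes descending chains of subgroups stabilise up to finite index, and
  a subgroup that contains a positive power of every element has finite index. A strongly scale-invariant
  monomorphism \<open>\<phi>\<close> and all its powers have only finitely many fixed points.

  By induction on the derived length one may assume, after passing to a subgroup of finite index generated by powers,
  that \<open>K\<close> has a \<open>\<phi>\<close>-invariant nilpotent normal subgroup \<open>N\<close> with \<open>K / N\<close> abelian. Counting along the lower central
  series of \<open>N\<close> shows that \<open>\<phi>\<^sup>k\<close> has finitely many fixed points on \<open>K / N\<close> as well, hence that the displacements
  \<open>g\<inverse> \<phi>\<^sup>k(g)\<close> fill \<open>K / N\<close> up to finite index.

  The lower central factors of \<open>N\<close> refine to sections that are finite or torsion-free and rationally irreducible for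
  \<open>K\<close>. On one of the latter kind the elements of \<open>K\<close> act through an integral domain, and for fixed \<open>g\<close> all
  \<open>\<phi>\<^sup>n(g)\<close> are roots of the same integer polynomials, so that they take finitely many values. Hence for some
  \<open>n < n'\<close> the maps \<open>\<phi>\<^sup>n\<close> and \<open>\<phi>\<close> to the power \<open>n'\<close> induce the same action of \<open>K\<close>, up to finite index, on all
  sections. Displacements therefore act trivially on all sections, and the elements acting trivially form a nilpotent
  subgroup of finite index.
\<close>

section \<open>Subgroups containing powers, and finite covers by cosets\<close>

text \<open>Subgroups are compared by asking for positive powers rather than by index, because the
  arguments are rational in nature: polynomials, displacements and generators control elements only
  up to a power. This relation composes and passes to images, and it is turned back into finite
  index only where cosets have to be counted.

  The obstacle is that the irreducible sections are invariant under K but not under \<phi>, so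
  \<phi> does not act on them. It does act on the full lower central factors, where it intertwines g
  with \<phi>(g), so that an integer polynomial found for g serves every \<phi>^n(g). Restricting it
  to a section costs only powers, which torsion-freeness forgives.

  The operators commute because N acts trivially on its own lower central factors, so that K acts
  through the abelian group K / N.

  Subgroups of finite index obtained by counting need not be \<phi>-invariant. Subgroups generated
  by all e-th powers are preserved by \<phi> and by conjugations alike and take their place.\<close>

context group
begin

lemma inv_mult_cancel: "\<lbrakk>x \<in> carrier G; y \<in> carrier G\<rbrakk> \<Longrightarrow> inv x \<otimes> (x \<otimes> y) = y"
  by (simp flip: m_assoc)

lemma mult_inv_cancel: "\<lbrakk>x \<in> carrier G; y \<in> carrier G\<rbrakk> \<Longrightarrow> x \<otimes> (inv x \<otimes> y) = y"
  by (simp flip: m_assoc)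

lemmas group_word_simps = m_assoc inv_mult_group inv_mult_cancel mult_inv_cancel

text \<open>A stand-in for finite index that composes without counting. For a subgroup
  \<open>L\<close> of a group \<open>K\<close>, both inside a set satisfying
  \<open>power_covered_on\<close>, it is equivalent to finite index.\<close>

definition powers_in :: "'a set \<Rightarrow> 'a set \<Rightarrow> bool" where
  "powers_in K L \<longleftrightarrow> (\<forall>x\<in>K. \<exists>e::nat. e > 0 \<and> x [^] e \<in> L)"

text \<open>For a subgroup \<open>L\<close> of a group \<open>K\<close> this is finite index.
  \<open>L\<close> may reach outside \<open>K\<close>: in the induction along a cyclic series,
  \<open>K \<inter> B\<close> is covered by cosets of an \<open>L\<close> that need not lie in
  \<open>B\<close>.\<close>

definition finite_cover :: "'a set \<Rightarrow> 'a set \<Rightarrow> bool" where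
  "finite_cover K L \<longleftrightarrow> (\<exists>T. finite T \<and> T \<subseteq> carrier G \<and> K \<subseteq> (\<Union>t\<in>T. L #> t))"

lemma powers_inD:
  assumes "powers_in K L" "x \<in> K"
  obtains e :: nat where "e > 0" "x [^] e \<in> L"
  using assms unfolding powers_in_def by blast

lemma subgroup_nat_pow_closed: "\<lbrakk>subgroup H G; x \<in> H\<rbrakk> \<Longrightarrow> x [^] (e::nat) \<in> H"
  by (metis int_pow_int group.subgroup_int_pow_closed is_group)

lemma powers_in_trans:
  assumes "powers_in K M" "powers_in M L" "K \<subseteq> carrier G"
  shows "powers_in K L"
  unfolding powers_in_def
proof
  fix x assume x: "x \<in> K"
  obtain e where e: "e > 0" "x [^] (e::nat) \<in> M" using assms(1) x by (rule powers_inD)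
  obtain d where d: "d > 0" "(x [^] e) [^] (d::nat) \<in> L" using assms(2) e(2) by (rule powers_inD)
  then show "\<exists>e::nat. e > 0 \<and> x [^] e \<in> L"
    using x assms(3) e by (intro exI[of _ "e * d"]) (auto simp: nat_pow_pow)
qed

lemma powers_in_mono: "\<lbrakk>powers_in K L; K' \<subseteq> K; L \<subseteq> L'\<rbrakk> \<Longrightarrow> powers_in K' L'"
  unfolding powers_in_def by blast

lemma mem_r_coset_iff:
  assumes "subgroup L G" "x \<in> carrier G" "t \<in> carrier G"
  shows "x \<in> L #> t \<longleftrightarrow> x \<otimes> inv t \<in> L"
  by (metis assms group.coset_join1 group_l_invI is_group l_inv_ex r_coset_subset_G
      subgroup.rcos_module subgroup.subset)

text \<open>\<open>m\<close> is fixed before the sequence is chosen. This uniformity later turns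
  exponents that depend on an element into the single exponent \<open>fact m\<close>.\<close>

lemma finite_cover_pigeonhole:
  assumes L: "subgroup L G" and cov: "finite_cover K L"
  shows "\<exists>m. \<forall>f::nat \<Rightarrow> 'a. (\<forall>i. f i \<in> K \<inter> carrier G) \<longrightarrow> (\<exists>i j. i < j \<and> j \<le> m \<and> f j \<otimes> inv (f i) \<in> L)"
proof -
  obtain T where T: "finite T" "T \<subseteq> carrier G" "K \<subseteq> (\<Union>t\<in>T. L #> t)"
    using cov unfolding finite_cover_def by (elim exE conjE)
  have *: "\<exists>i j. i < j \<and> j \<le> Suc (card T) \<and> f j \<otimes> inv (f i) \<in> L"
    if f: "\<forall>i. f i \<in> K \<inter> carrier G" for f :: "nat \<Rightarrow> 'a"
  proof -
    have "\<forall>i. \<exists>t\<in>T. f i \<otimes> inv t \<in> L"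
      using f T mem_r_coset_iff[OF L] by (metis IntD1 IntD2 UN_E subset_iff)
    then obtain c where c: "\<And>i. c i \<in> T" "\<And>i. f i \<otimes> inv (c i) \<in> L" by metis
    have "\<not> inj_on c {..Suc (card T)}"
    proof
      assume "inj_on c {..Suc (card T)}"
      then have "card {..Suc (card T)} \<le> card T"
        by (rule card_inj_on_le) (use c T in auto)
      then show False by simp
    qed
    then obtain i j where ij: "i < j" "j \<le> Suc (card T)" "c i = c j"
      unfolding inj_on_def by (metis atMost_iff linorder_neqE_nat)
    have "(f j \<otimes> inv (c j)) \<otimes> inv (f i \<otimes> inv (c i)) \<in> L"
      using c L by (simp add: subgroupE(3,4))
    moreover have "(f j \<otimes> inv (c j)) \<otimes> inv (f i \<otimes> inv (c i)) = f j \<otimes> inv (f i)"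
      using f ij c(1) T(2) by (auto simp: group_word_simps subset_iff)
    ultimately show ?thesis using ij by auto
  qed
  then show ?thesis by blast
qed

text \<open>Two of the powers of \<open>x\<close> with exponents up to \<open>m\<close> share a
  coset of \<open>L\<close>, so \<open>x [^] (j - i)\<close> lies in \<open>L\<close> for some
  \<open>0 < j - i \<le> m\<close>. The difference varies with \<open>x\<close>, but it always
  divides \<open>fact m\<close>.\<close>

lemma finite_cover_uniform_exponent:
  assumes L: "subgroup L G" and K: "subgroup K G" and cov: "finite_cover K L"
  obtains e :: nat where "e > 0" "\<And>x. x \<in> K \<Longrightarrow> x [^] e \<in> L"
proof -
  obtain m where m: "\<forall>f::nat \<Rightarrow> 'a. (\<forall>i. f i \<in> K \<inter> carrier G) \<longrightarrow>
      (\<exists>i j. i < j \<and> j \<le> m \<and> f j \<otimes> inv (f i) \<in> L)"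
    using finite_cover_pigeonhole[OF L cov] by (rule exE)
  have "x [^] (fact m :: nat) \<in> L" if x: "x \<in> K" for x
  proof -
    have xc: "x \<in> carrier G" by (rule subgroup.mem_carrier[OF K x])
    obtain i j where ij: "i < j" "j \<le> m" "x [^] j \<otimes> inv (x [^] i) \<in> L"
    proof -
      have "\<forall>i::nat. x [^] i \<in> K \<inter> carrier G" using subgroup_nat_pow_closed[OF K x] xc by simp
      with m[rule_format, of "\<lambda>i. x [^] i"] show ?thesis using that by blast
    qed
    have "x [^] j = x [^] (j - i) \<otimes> x [^] i" using ij xc by (simp add: nat_pow_mult)
    then have "x [^] (j - i) \<in> L" using ij xc by (simp add: m_assoc)
    moreover have "(j - i) dvd fact m" using ij by (intro dvd_fact) auto
    then obtain k where k: "fact m = (j - i) * k" by (rule dvdE)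
    ultimately show ?thesis
      using subgroup_nat_pow_closed[OF L, of "x [^] (j - i)" k] xc by (simp add: nat_pow_pow)
  qed
  then show ?thesis by (intro that[of "fact m"]) auto
qed

lemma finite_cover_imp_powers_in:
  "\<lbrakk>subgroup L G; subgroup K G; finite_cover K L\<rbrakk> \<Longrightarrow> powers_in K L"
  unfolding powers_in_def by (rule finite_cover_uniform_exponent) blast+

lemma finite_coverI:
  assumes "finite T" "T \<subseteq> carrier G" "\<And>x. x \<in> K \<Longrightarrow> \<exists>t\<in>T. x \<otimes> inv t \<in> L" "K \<subseteq> carrier G" "subgroup L G"
  shows "finite_cover K L"
proof -
  have "x \<in> (\<Union>t\<in>T. L #> t)" if x: "x \<in> K" for x
  proof -
    obtain t where t: "t \<in> T" "x \<otimes> inv t \<in> L" using assms(3)[OF x] by blast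
    then have "x \<in> L #> t" using mem_r_coset_iff[OF assms(5), of x t] assms(2,4) x by auto
    then show ?thesis using t(1) by blast
  qed
  then show ?thesis unfolding finite_cover_def using assms(1,2) by blast
qed

lemma finite_coverE:
  assumes "finite_cover K L" "K \<subseteq> carrier G" "subgroup L G"
  obtains T where "finite T" "T \<subseteq> carrier G" "\<And>x. x \<in> K \<Longrightarrow> \<exists>t\<in>T. x \<otimes> inv t \<in> L"
proof -
  obtain T where T: "finite T" "T \<subseteq> carrier G" "K \<subseteq> (\<Union>t\<in>T. L #> t)"
    using assms(1) unfolding finite_cover_def by auto
  have "\<exists>t\<in>T. x \<otimes> inv t \<in> L" if xK: "x \<in> K" for x
  proof -
    obtain t where t: "t \<in> T" "x \<in> L #> t" using subsetD[OF T(3) xK] by (rule UN_E)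
    then have "x \<otimes> inv t \<in> L" 
      using mem_r_coset_iff[OF assms(3), of x t] assms(2) T(2) xK by auto
    then show ?thesis using t(1) by blast
  qed
  then show ?thesis using that T by blast
qed

lemma finite_cover_trans:
  assumes cov1: "finite_cover K M" and cov2: "finite_cover M L" and K: "K \<subseteq> carrier G"
    and M: "subgroup M G" and L: "subgroup L G"
  shows "finite_cover K L"
proof -
  obtain T where T: "finite T" "T \<subseteq> carrier G" "\<And>x. x \<in> K \<Longrightarrow> \<exists>t\<in>T. x \<otimes> inv t \<in> M"
    using finite_coverE[OF cov1 K M] by blast
  obtain S where S: "finite S" "S \<subseteq> carrier G" "\<And>x. x \<in> M \<Longrightarrow> \<exists>t\<in>S. x \<otimes> inv t \<in> L"
    using finite_coverE[OF cov2 subgroup.subset[OF M] L] by blast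
  show ?thesis
  proof (rule finite_coverI[of "(\<lambda>(s,t). s \<otimes> t) ` (S \<times> T)"])
    fix x assume x: "x \<in> K"
    then obtain t where t: "t \<in> T" "x \<otimes> inv t \<in> M" using T by blast
    then obtain s where s: "s \<in> S" "x \<otimes> inv t \<otimes> inv s \<in> L" using S by blast
    have "x \<otimes> inv t \<otimes> inv s = x \<otimes> inv (s \<otimes> t)"
      using x K t s S T by (simp add: group_word_simps subset_iff)
    then show "\<exists>r\<in>(\<lambda>(s,t). s \<otimes> t) ` (S \<times> T). x \<otimes> inv r \<in> L" using s t by force
  qed (use T S K L in auto)
qed

lemma finite_cover_mono: "\<lbrakk>finite_cover K L; K' \<subseteq> K; L \<subseteq> L'\<rbrakk> \<Longrightarrow> finite_cover K' L'"
proof -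
  assume asm: "finite_cover K L" "K' \<subseteq> K" "L \<subseteq> L'"
  then obtain T where T: "finite T" "T \<subseteq> carrier G" "K \<subseteq> (\<Union>t\<in>T. L #> t)"
    unfolding finite_cover_def by blast
  have "L #> t \<subseteq> L' #> t" for t using asm(3) unfolding r_coset_def by blast
  then have "K' \<subseteq> (\<Union>t\<in>T. L' #> t)"
    by (intro subset_trans[OF asm(2) subset_trans[OF T(3)]] UN_mono order_refl)
  with T(1,2) show "finite_cover K' L'" unfolding finite_cover_def by (intro exI[of _ T] conjI)
qed

lemma finite_cover_carrier_iff:
  assumes L: "subgroup L G"
  shows "finite_cover (carrier G) L \<longleftrightarrow> finite (rcosets L)"
proof
  assume "finite_cover (carrier G) L"
  then obtain T where T: "finite T" "T \<subseteq> carrier G" "carrier G \<subseteq> (\<Union>t\<in>T. L #> t)"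
    unfolding finite_cover_def by (elim exE conjE)
  have "rcosets L \<subseteq> (\<lambda>t. L #> t) ` T"
  proof (rule subsetI)
    fix U assume "U \<in> rcosets L"
    then obtain x where x: "x \<in> carrier G" "U = L #> x" unfolding RCOSETS_def by (elim UN_E singletonE)
    then have "x \<in> (\<Union>t\<in>T. L #> t)" using T(3) by (rule_tac subsetD)
    then obtain t where t: "t \<in> T" "x \<in> L #> t" by (rule UN_E)
    have "L #> t = L #> x" by (rule repr_independence[OF t(2) subsetD[OF T(2) t(1)] L])
    then show "U \<in> (\<lambda>t. L #> t) ` T" unfolding x(2) by (metis imageI t(1))
  qed
  then show "finite (rcosets L)" by (rule finite_subset) (simp add: T(1))
next
  assume fin: "finite (rcosets L)"
  define c where "c U = (SOME x. x \<in> U \<inter> carrier G)" for U :: "'a set"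
  have c: "c (L #> x) \<in> (L #> x) \<inter> carrier G" if "x \<in> carrier G" for x
    unfolding c_def by (rule someI[of _ x]) (use that rcos_self[OF that L] in auto)
  have "carrier G \<subseteq> (\<Union>t\<in>c ` (rcosets L). L #> t)"
  proof (rule subsetI)
    fix x assume x: "x \<in> carrier G"
    have "L #> x = L #> c (L #> x)" using repr_independence[OF _ x L] c[OF x] by blast
    then have "x \<in> L #> c (L #> x)" using rcos_self[OF x L] by simp
    then show "x \<in> (\<Union>t\<in>c ` (rcosets L). L #> t)"
      using rcosetsI[OF subgroup.subset[OF L] x] by blast
  qed
  moreover have "c ` (rcosets L) \<subseteq> carrier G"
  proof (rule subsetI)
    fix y assume "y \<in> c ` (rcosets L)"
    then obtain x where "x \<in> carrier G" "y = c (L #> x)" unfolding RCOSETS_def by blast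
    then show "y \<in> carrier G" using c[of x] by simp
  qed
  ultimately show "finite_cover (carrier G) L" unfolding finite_cover_def using fin by blast
qed

end

section \<open>Polycyclic groups\<close>

locale cyclic_section = group G for G (structure) +
  fixes A B :: "'a set" and y :: 'a
  assumes A: "subgroup A G" and B: "subgroup B G" and BA: "B \<subseteq> A"
    and normal: "\<And>x z. \<lbrakk>x \<in> A; z \<in> B\<rbrakk> \<Longrightarrow> x \<otimes> z \<otimes> inv x \<in> B"
    and y: "y \<in> A" and gen: "\<And>x. x \<in> A \<Longrightarrow> \<exists>a::int. x \<otimes> inv (y [^] a) \<in> B"
begin

text \<open>A discrete logarithm to base \<open>y\<close> modulo \<open>B\<close>, kept as a
  relation: when \<open>A / B\<close> is finite an element has infinitely many exponents.\<close>

definition has_exponent :: "'a \<Rightarrow> int \<Rightarrow> bool" where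
  "has_exponent x a \<longleftrightarrow> x \<in> A \<and> x \<otimes> inv (y [^] a) \<in> B"

lemma Ac: "x \<in> A \<Longrightarrow> x \<in> carrier G"
  by (rule subgroup.mem_carrier[OF A])

lemma yc [simp]: "y \<in> carrier G" using y Ac by simp

lemma has_exponent_ex: "x \<in> A \<Longrightarrow> \<exists>a. has_exponent x a"
  using gen unfolding has_exponent_def by simp

lemma has_exponent_mult:
  assumes "has_exponent x a" "has_exponent x' b" shows "has_exponent (x \<otimes> x') (a + b)"
proof -
  have x: "x \<in> A" "x' \<in> A" "x \<in> carrier G" "x' \<in> carrier G"
    using assms Ac unfolding has_exponent_def by auto
  have yb: "y [^] (a + b) = y [^] a \<otimes> y [^] b" by (simp add: int_pow_mult)
  have "(x \<otimes> (x' \<otimes> inv (y [^] b)) \<otimes> inv x) \<otimes> (x \<otimes> inv (y [^] a)) \<in> B"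
    using assms unfolding has_exponent_def by (simp add: normal subgroup.m_closed[OF B])
  moreover have "(x \<otimes> (x' \<otimes> inv (y [^] b)) \<otimes> inv x) \<otimes> (x \<otimes> inv (y [^] a)) = x \<otimes> x' \<otimes> inv (y [^] (a + b))"
    using x by (simp add: yb group_word_simps)
  ultimately show ?thesis
    unfolding has_exponent_def using x subgroup.m_closed[OF A] by simp
qed

lemma has_exponent_inv:
  assumes "has_exponent x a" shows "has_exponent (inv x) (- a)"
proof -
  have x: "x \<in> A" "x \<in> carrier G" using assms Ac unfolding has_exponent_def by auto
  have "inv x \<otimes> inv (x \<otimes> inv (y [^] a)) \<otimes> inv (inv x) \<in> B"
    using assms x unfolding has_exponent_def
    by (intro normal) (simp_all add: subgroup.m_inv_closed[OF A] subgroup.m_inv_closed[OF B])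
  moreover have "inv x \<otimes> inv (x \<otimes> inv (y [^] a)) \<otimes> inv (inv x) = inv x \<otimes> inv (y [^] (- a))"
    using x by (simp add: group_word_simps int_pow_neg)
  ultimately show ?thesis unfolding has_exponent_def using x by (simp add: subgroup.m_inv_closed[OF A])
qed

lemma has_exponent_zero: "has_exponent x 0 \<longleftrightarrow> x \<in> B"
  using BA Ac unfolding has_exponent_def by auto

lemma has_exponent_nat_pow: "has_exponent x a \<Longrightarrow> has_exponent (x [^] (k::nat)) (int k * a)"
proof (induction k)
  case 0 show ?case by (simp add: has_exponent_zero subgroup.one_closed[OF B])
next
  case (Suc k)
  show ?case using has_exponent_mult[OF Suc.IH Suc.prems] Suc.prems by (simp add: algebra_simps)
qed

lemma has_exponent_int_pow: "has_exponent x a \<Longrightarrow> has_exponent (x [^] (k::int)) (k * a)"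
proof (cases k)
  case (nonneg n) then show "has_exponent x a \<Longrightarrow> ?thesis" using has_exponent_nat_pow by (simp add: int_pow_int)
next
  case (neg n)
  assume h: "has_exponent x a"
  then have "x \<in> carrier G" using Ac unfolding has_exponent_def by simp
  then have "x [^] k = inv (x [^] Suc n)" unfolding neg(1) by (rule int_pow_neg_int)
  moreover have "- (int (Suc n) * a) = k * a" unfolding neg(1) by (simp add: algebra_simps)
  ultimately show ?thesis using has_exponent_inv[OF has_exponent_nat_pow[OF h, of "Suc n"]] by (simp only:)
qed

text \<open>If some element of \<open>K \<inter> A\<close> has a nonzero exponent, a power
  \<open>w\<close> of it lies in \<open>L\<close> and has exponent \<open>m \<noteq> 0\<close>.
  Multiplying by powers of \<open>w\<close> changes exponents by multiples of \<open>m\<close>, so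
  up to \<open>L\<close> and finitely many representatives of residues every element of
  \<open>K \<inter> A\<close> falls into \<open>K \<inter> B\<close>, which is covered
  already.\<close>

lemma finite_cover_step:
  assumes K: "subgroup K G" and L: "subgroup L G" and LK: "L \<subseteq> K"
    and cov: "finite_cover (K \<inter> B) L" and pow: "powers_in (K \<inter> A) L"
  shows "finite_cover (K \<inter> A) L"
proof (cases "\<exists>x\<in>K \<inter> A. \<exists>a. a \<noteq> 0 \<and> has_exponent x a")
  case False
  have "K \<inter> A \<subseteq> K \<inter> B"
  proof (rule subsetI)
    fix x assume x: "x \<in> K \<inter> A"
    then obtain a where a: "has_exponent x a" using has_exponent_ex[of x] by auto
    then have "a = 0" using False x by auto
    then show "x \<in> K \<inter> B" using a x by (simp add: has_exponent_zero)
  qed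
  then show ?thesis by (rule finite_cover_mono[OF cov _ order_refl])
next
  case True
  then obtain x0 a where x0: "x0 \<in> K \<inter> A" "a \<noteq> 0" "has_exponent x0 a" by (elim bexE exE conjE)
  obtain e :: nat where e: "e > 0" "x0 [^] e \<in> L" by (rule powers_inD[OF pow x0(1)])
  define w where "w = x0 [^] e"
  define m where "m = int e * a"
  have w: "w \<in> L" "has_exponent w m" using e has_exponent_nat_pow[OF x0(3)] by (simp_all add: w_def m_def)
  have wc: "w \<in> carrier G" using w L subgroup.mem_carrier by metis
  have m0: "m \<noteq> 0" using e x0 by (simp add: m_def)
  have Kc: "x \<in> carrier G" if "x \<in> K" for x using K that subgroup.mem_carrier by metis
  obtain T where T: "finite T" "T \<subseteq> carrier G" "\<And>x. x \<in> K \<inter> B \<Longrightarrow> \<exists>t\<in>T. x \<otimes> inv t \<in> L"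
  proof (rule finite_coverE[OF cov _ L])
    show "K \<inter> B \<subseteq> carrier G" using Kc by auto
  qed blast
  \<comment> \<open>Only residues attained on \<open>K \<inter> A\<close> are listed, so that
    representatives can be chosen inside \<open>K\<close>. The interval is symmetric because
    \<open>m\<close> may be negative and \<open>mod\<close> takes the sign of the divisor.\<close>
  define R where "R = {r \<in> {- \<bar>m\<bar> .. \<bar>m\<bar>}. \<exists>k\<in>K \<inter> A. \<exists>b. has_exponent k b \<and> b mod m = r}"
  have finR: "finite R" unfolding R_def by (rule finite_subset[of _ "{- \<bar>m\<bar> .. \<bar>m\<bar>}"]) auto
  have "\<exists>k. \<forall>r\<in>R. k r \<in> K \<inter> A \<and> (\<exists>b. has_exponent (k r) b \<and> b mod m = r)"
    by (rule bchoice) (auto simp: R_def)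
  then obtain k where k0: "\<forall>r\<in>R. k r \<in> K \<inter> A \<and> (\<exists>b. has_exponent (k r) b \<and> b mod m = r)" by (rule exE)
  have k: "k r \<in> K \<inter> A" "\<exists>b. has_exponent (k r) b \<and> b mod m = r" if "r \<in> R" for r
    using bspec[OF k0 that] by simp_all
  show ?thesis
  proof (rule finite_coverI[of "(\<lambda>(t,r). t \<otimes> k r) ` (T \<times> R)"])
    fix x assume x: "x \<in> K \<inter> A"
    then obtain b where b: "has_exponent x b" using has_exponent_ex[of x] by auto
    have "\<bar>b mod m\<bar> \<le> \<bar>m\<bar>" using m0 abs_mod_less[of m b] by simp
    then have rR: "b mod m \<in> R" unfolding R_def using x b by (auto simp: abs_le_iff)
    then obtain c where c: "has_exponent (k (b mod m)) c" "c mod m = b mod m" using k(2)[OF rR] by (elim exE conjE)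
    then obtain s where s: "b - c = m * s" by (metis mod_eq_dvd_iff dvdE)
    let ?k = "k (b mod m)" and ?u = "w [^] (- s)"
    have kk: "?k \<in> K" "?k \<in> A" using k(1)[OF rR] by auto
    have uL: "?u \<in> L" by (rule subgroup_int_pow_closed[OF L w(1)])
    have "has_exponent (?u \<otimes> (x \<otimes> inv ?k)) (- s * m + (b + - c))"
      by (intro has_exponent_mult has_exponent_int_pow has_exponent_inv w b c)
    moreover have "- s * m + (b + - c) = 0" using s by simp
    ultimately have "?u \<otimes> (x \<otimes> inv ?k) \<in> B" using has_exponent_zero by metis
    moreover have "?u \<otimes> (x \<otimes> inv ?k) \<in> K"
      using uL LK x kk by (auto intro!: subgroup.m_closed[OF K] subgroup.m_inv_closed[OF K])
    ultimately obtain t where t: "t \<in> T" "?u \<otimes> (x \<otimes> inv ?k) \<otimes> inv t \<in> L" using T(3) by blast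
    have cl: "?u \<in> carrier G" "x \<in> carrier G" "?k \<in> carrier G" "t \<in> carrier G"
      using wc Kc x kk t T by auto
    have "inv ?u \<otimes> (?u \<otimes> (x \<otimes> inv ?k) \<otimes> inv t) \<in> L"
      by (rule subgroup.m_closed[OF L subgroup.m_inv_closed[OF L uL] t(2)])
    moreover have "inv ?u \<otimes> (?u \<otimes> (x \<otimes> inv ?k) \<otimes> inv t) = x \<otimes> inv (t \<otimes> ?k)"
      using cl by (simp add: group_word_simps del: int_pow_neg)
    ultimately show "\<exists>z\<in>(\<lambda>(t,r). t \<otimes> k r) ` (T \<times> R). x \<otimes> inv z \<in> L" using t rR by force
  next
    show "(\<lambda>(t,r). t \<otimes> k r) ` (T \<times> R) \<subseteq> carrier G" using T k Kc by auto
  qed (use T finR Kc L in auto)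
qed

text \<open>If no positive power of \<open>x\<close> lies in \<open>B\<close>, then
  \<open>rk\<close> supplies an \<open>l\<close> in \<open>L \<inter> A\<close> with exponent
  \<open>b \<noteq> 0\<close>. Some power \<open>u\<close> of \<open>x\<close> has the same exponent
  as \<open>l [^] c\<close>, so \<open>u [^] s\<close> corrected by a power of \<open>l\<close> lies
  in \<open>K \<inter> B\<close> for every \<open>s\<close>. Two of these elements share a coset of
  \<open>L\<close>, and since \<open>l\<close> is in \<open>L\<close> this puts a power of
  \<open>u\<close> into \<open>L\<close>.\<close>

lemma rank_step:
  assumes K: "subgroup K G" and L: "subgroup L G" and LK: "L \<subseteq> K"
    and cov: "finite_cover (K \<inter> B) L" and pow: "powers_in (K \<inter> B) L"
    and rk: "(\<exists>x\<in>K \<inter> A. \<forall>e::nat. e > 0 \<longrightarrow> x [^] e \<notin> B) \<Longrightarrow> (\<exists>x\<in>L \<inter> A. \<forall>e::nat. e > 0 \<longrightarrow> x [^] e \<notin> B)"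
  shows "powers_in (K \<inter> A) L"
  unfolding powers_in_def
proof
  fix x assume x: "x \<in> K \<inter> A"
  have Kc: "x \<in> carrier G" if "x \<in> K" for x using K that subgroup.mem_carrier by metis
  show "\<exists>e::nat. e > 0 \<and> x [^] e \<in> L"
  proof (cases "\<exists>e::nat. e > 0 \<and> x [^] e \<in> B")
    case True
    then obtain e :: nat where e: "e > 0" "x [^] e \<in> B" by blast
    then have "x [^] e \<in> K \<inter> B" using x subgroup_nat_pow_closed[OF K] by blast
    then obtain d :: nat where "d > 0" "(x [^] e) [^] d \<in> L" using powers_inD[OF pow] by blast
    then show ?thesis using e x Kc by (intro exI[of _ "e * d"]) (auto simp: nat_pow_pow)
  next
    case False
    then obtain l where l: "l \<in> L \<inter> A" "\<And>e::nat. e > 0 \<Longrightarrow> l [^] e \<notin> B" using rk x by blast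
    obtain a b where a: "has_exponent x a" and b: "has_exponent l b" using has_exponent_ex x l by blast
    have b0: "b \<noteq> 0"
    proof
      assume "b = 0" then have "l \<in> B" using b has_exponent_zero by simp
      then show False using l(2)[of 1] Ac l(1) by simp
    qed
    define c where "c = a * sgn b"
    define N where "N = nat \<bar>b\<bar>"
    define u where "u = x [^] N"
    have N0: "N > 0" using b0 by (simp add: N_def)
    have "int N * a = c * b" by (cases "b > 0") (auto simp: N_def c_def sgn_if)
    then have hu: "has_exponent u (c * b)" unfolding u_def using has_exponent_nat_pow[OF a, of N] by simp
    have cl: "x \<in> carrier G" "u \<in> carrier G" "l \<in> carrier G" using x Kc l LK by (auto simp: u_def)
    have uK: "u \<in> K" unfolding u_def using x subgroup_nat_pow_closed[OF K] by blast
    define f where "f s = l [^] (- (int s * c)) \<otimes> u [^] s" for s :: nat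
    have fB: "f s \<in> B" for s
    proof -
      have "has_exponent (f s) (- (int s * c) * b + int s * (c * b))"
        unfolding f_def by (intro has_exponent_mult has_exponent_int_pow has_exponent_nat_pow b hu)
      then show ?thesis using has_exponent_zero by (simp add: algebra_simps)
    qed
    have fK: "f s \<in> K" for s
      unfolding f_def using l LK by (intro subgroup.m_closed[OF K] subgroup_nat_pow_closed[OF K uK] subgroup_int_pow_closed[OF K]) auto
    have "\<forall>i. f i \<in> K \<inter> B \<inter> carrier G" using fB fK Kc by blast
    then obtain i j where ij: "i < j" "f j \<otimes> inv (f i) \<in> L" using finite_cover_pigeonhole[OF L cov] by blast
    have uj: "u [^] j = u [^] (j - i) \<otimes> u [^] i" using ij cl by (simp add: nat_pow_mult)
    have "f j \<otimes> inv (f i) = l [^] (- (int j * c)) \<otimes> u [^] (j - i) \<otimes> inv (l [^] (- (int i * c)))"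
      unfolding f_def uj using cl by (simp add: group_word_simps del: int_pow_neg)
    then have "u [^] (j - i) = inv (l [^] (- (int j * c))) \<otimes> (f j \<otimes> inv (f i)) \<otimes> l [^] (- (int i * c))"
      using cl by (simp add: group_word_simps del: int_pow_neg)
    also have "\<dots> \<in> L"
      using l by (intro subgroup.m_closed[OF L] subgroup.m_inv_closed[OF L, of "_ [^] _"] subgroup_int_pow_closed[OF L] ij(2)) auto
    finally have "x [^] (N * (j - i)) \<in> L" unfolding u_def using cl by (simp add: nat_pow_pow)
    then show ?thesis using N0 ij by (intro exI[of _ "N * (j - i)"]) simp
  qed
qed

lemma commutator_mem:
  assumes "x \<in> A" "x' \<in> A" shows "x \<otimes> x' \<otimes> inv x \<otimes> inv x' \<in> B"
proof -
  obtain a b where "has_exponent x a" "has_exponent x' b"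
    using has_exponent_ex[OF assms(1)] has_exponent_ex[OF assms(2)] by (elim exE)
  then have "has_exponent (x \<otimes> x' \<otimes> inv x \<otimes> inv x') (a + b + - a + - b)"
    by (intro has_exponent_mult has_exponent_inv)
  then show ?thesis using has_exponent_zero by simp
qed

end

section \<open>Hirsch length, solvability and finite index in polycyclic groups\<close>

context group
begin

text \<open>The two properties of the Hirsch length on which everything rests: monotonicity, and a
  strict drop unless the subgroup contains powers of all elements. In this abstract form they carry
  over to overgroups of finite index and to quotients \<open>M / L\<close>.\<close>

definition power_rank_on :: "'a set \<Rightarrow> ('a set \<Rightarrow> nat) \<Rightarrow> bool" where
  "power_rank_on P h \<longleftrightarrow> (\<forall>K L. subgroup K G \<longrightarrow> subgroup L G \<longrightarrow> L \<subseteq> K \<longrightarrow> K \<subseteq> P \<longrightarrow>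
     h L \<le> h K \<and> (h L = h K \<longrightarrow> powers_in K L))"

text \<open>This fails for infinite torsion groups, where the trivial subgroup contains a positive
  power of every element. In polycyclic groups it comes from
  \<open>finite_cover_step\<close>.\<close>

definition power_covered_on :: "'a set \<Rightarrow> bool" where
  "power_covered_on P \<longleftrightarrow> (\<forall>K L. subgroup K G \<longrightarrow> subgroup L G \<longrightarrow> L \<subseteq> K \<longrightarrow> K \<subseteq> P \<longrightarrow>
     powers_in K L \<longrightarrow> finite_cover K L)"

lemma polycyclic_series:
  assumes P: "subgroup P G" and poly: "polycyclic_group (G\<lparr>carrier := P\<rparr>)"
  obtains n :: nat and H y where "H 0 = {\<one>}" "H n = P" "\<And>i. i < n \<Longrightarrow> cyclic_section G (H (Suc i)) (H i) (y i)"
proof -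
  obtain n :: nat and H where H: "H 0 = {\<one>}" "H n = P"
    "\<And>i. i \<le> n \<Longrightarrow> subgroup (H i) (G\<lparr>carrier := P\<rparr>)"
    "\<And>i. i < n \<Longrightarrow> H i \<lhd> G\<lparr>carrier := H (Suc i)\<rparr>"
    "\<And>i. i < n \<Longrightarrow> cyclic_group (G\<lparr>carrier := H (Suc i)\<rparr> Mod H i)"
    using poly unfolding polycyclic_group_def by auto
  have sub: "subgroup (H i) G" if "i \<le> n" for i using incl_subgroup[OF P H(3)[OF that]] .
  have "\<exists>y. cyclic_section G (H (Suc i)) (H i) y" if i: "i < n" for i
  proof -
    let ?A = "G\<lparr>carrier := H (Suc i)\<rparr>"
    have A: "subgroup (H (Suc i)) G" and B: "subgroup (H i) G" using sub i by auto
    interpret A: group ?A by (rule subgroup_imp_group[OF A])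
    interpret N: normal "H i" ?A by (rule H(4)[OF i])
    interpret Q: group "?A Mod H i" by (rule N.factorgroup_is_group)
    obtain U where U: "U \<in> carrier (?A Mod H i)" "carrier (?A Mod H i) = range (\<lambda>n::int. U [^]\<^bsub>?A Mod H i\<^esub> n)"
      using H(5)[OF i] unfolding Q.cyclic_group by (elim bexE)
    obtain y where y: "y \<in> H (Suc i)" "U = H i #> y"
      using U(1) unfolding carrier_FactGroup by auto
    have "cyclic_section G (H (Suc i)) (H i) y"
    proof (intro cyclic_section.intro cyclic_section_axioms.intro is_group)
      show "subgroup (H (Suc i)) G" "subgroup (H i) G" "y \<in> H (Suc i)" by fact+
      show "H i \<subseteq> H (Suc i)" using N.subset by simp
      show "x \<otimes> z \<otimes> inv x \<in> H i" if "x \<in> H (Suc i)" "z \<in> H i" for x z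
        using N.inv_op_closed2[of x z] that m_inv_consistent[OF A] by simp
      show "\<exists>a::int. x \<otimes> inv (y [^] a) \<in> H i" if x: "x \<in> H (Suc i)" for x
      proof -
        have "H i #> x \<in> carrier (?A Mod H i)" using x unfolding carrier_FactGroup by auto
        then obtain a :: int where a: "H i #> x = U [^]\<^bsub>?A Mod H i\<^esub> a" using U(2) by auto
        have "U [^]\<^bsub>?A Mod H i\<^esub> a = H i #> (y [^] a)"
          using N.FactGroup_int_pow[of y a] y int_pow_consistent[OF A, of y a] by simp
        then have "x \<in> H i #> (y [^] a)" using a rcos_self[OF subgroup.mem_carrier[OF A x] B] by simp
        then show ?thesis
          using mem_r_coset_iff[OF B, of x "y [^] a"] subgroup.mem_carrier[OF A] x y by auto
      qed
    qed
    then show ?thesis by (rule exI)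
  qed
  then obtain y where "\<forall>i\<in>{..<n}. cyclic_section G (H (Suc i)) (H i) (y i)"
    using bchoice[of "{..<n}" "\<lambda>i y. cyclic_section G (H (Suc i)) (H i) y"] by auto
  then show ?thesis using that[of H n y] H(1,2) by simp
qed

lemma polycyclic_solvable:
  assumes P: "subgroup P G" and poly: "polycyclic_group (G\<lparr>carrier := P\<rparr>)"
  obtains n :: nat where "(derived G ^^ n) P \<subseteq> {\<one>}"
proof -
  obtain n :: nat and H y where H: "H 0 = {\<one>}" "H n = P"
    and sec: "\<And>i. i < n \<Longrightarrow> cyclic_section G (H (Suc i)) (H i) (y i)"
    by (rule polycyclic_series[OF P poly]) blast
  have "(derived G ^^ k) P \<subseteq> H (n - k)" if "k \<le> n" for k
    using that
  proof (induction k)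
    case 0 then show ?case using H by simp
  next
    case (Suc k)
    interpret cyclic_section G "H (Suc (n - Suc k))" "H (n - Suc k)" "y (n - Suc k)"
      using Suc.prems by (intro sec) simp
    have *: "Suc (n - Suc k) = n - k" using Suc.prems by simp
    have "derived G (H (n - k)) \<subseteq> H (n - Suc k)"
      unfolding derived_def using commutator_mem *
      by (intro generate_subgroup_incl[OF _ B]) auto
    then show ?case using mono_derived[OF Suc.IH] Suc.prems by simp
  qed
  from this[of n] show ?thesis using that[of n] H by simp
qed

lemma polycyclic_power_covered:
  assumes P: "subgroup P G" and poly: "polycyclic_group (G\<lparr>carrier := P\<rparr>)"
  shows "power_covered_on P" and "\<exists>h. power_rank_on P h"
proof -
  obtain n :: nat and H y where H: "H 0 = {\<one>}" "H n = P"
    and sec: "\<And>i. i < n \<Longrightarrow> cyclic_section G (H (Suc i)) (H i) (y i)"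
    by (rule polycyclic_series[OF P poly]) blast
  have HP: "K \<inter> H n = K" if "K \<subseteq> P" for K using that H(2) by auto
  have cover: "finite_cover (K \<inter> H i) L"
    if "subgroup K G" "subgroup L G" "L \<subseteq> K" "i \<le> n" "powers_in (K \<inter> H i) L" for K L i
    using that(4,5)
  proof (induction i)
    case 0
    show ?case
      by (rule finite_coverI[of "{\<one>}"]) (use H(1) that in \<open>auto simp: subgroup.one_closed\<close>)
  next
    case (Suc i)
    interpret cyclic_section G "H (Suc i)" "H i" "y i" using Suc.prems by (intro sec) simp
    have "powers_in (K \<inter> H i) L" by (rule powers_in_mono[OF Suc.prems(2)]) (use BA in auto)
    then show ?case using finite_cover_step[OF that(1-3) Suc.IH] Suc.prems by simp
  qed
  show "power_covered_on P"
    unfolding power_covered_on_def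
  proof (intro allI impI)
    fix K L assume "subgroup K G" "subgroup L G" "L \<subseteq> K" "K \<subseteq> P" "powers_in K L"
    then show "finite_cover K L" using cover[of K L n] HP[of K] by simp
  qed
  \<comment> \<open>These are the indices of the factors in which \<open>K\<close> has infinite
    image, so \<open>card (J K)\<close> is the Hirsch length of \<open>K\<close>. As
    \<open>J\<close> is monotone, equal cardinalities force equal index sets, which is what the
    hypothesis \<open>rk\<close> of \<open>rank_step\<close> asks for.\<close>
  define J where "J K = {i. i < n \<and> (\<exists>x\<in>K \<inter> H (Suc i). \<forall>e::nat. e > 0 \<longrightarrow> x [^] e \<notin> H i)}" for K
  have finJ: "finite (J K)" for K unfolding J_def by simp
  have monoJ: "J L \<subseteq> J K" if "L \<subseteq> K" for K L unfolding J_def using that by blast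
  have pow: "powers_in (K \<inter> H i) L"
    if "subgroup K G" "subgroup L G" "L \<subseteq> K" "i \<le> n" "J K = J L" for K L i
    using that(4)
  proof (induction i)
    case 0 show ?case unfolding powers_in_def using H(1) that by (auto simp: subgroup.one_closed)
  next
    case (Suc i)
    interpret cyclic_section G "H (Suc i)" "H i" "y i" using Suc.prems by (intro sec) simp
    have *: "i \<in> J K \<Longrightarrow> i \<in> J L" using that(5) by simp
    show ?case
      by (rule rank_step[OF that(1-3) cover[OF that(1-3)]])
         (use Suc * in \<open>auto simp: J_def\<close>)
  qed
  have "power_rank_on P (\<lambda>K. card (J K))"
    unfolding power_rank_on_def
  proof (intro allI impI conjI)
    fix K L assume *: "subgroup K G" "subgroup L G" "L \<subseteq> K" "K \<subseteq> P"
    show "card (J L) \<le> card (J K)" by (rule card_mono[OF finJ monoJ[OF *(3)]])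
    assume "card (J L) = card (J K)"
    then have "J L = J K" by (rule card_subset_eq[OF finJ monoJ[OF *(3)]])
    then show "powers_in K L" using pow[OF *(1-3), of n] HP[OF *(4)] by simp
  qed
  then show "\<exists>h. power_rank_on P h" by (intro exI)
qed

section \<open>Passing to overgroups of finite index\<close>

lemma finite_cover_inter:
  assumes P: "subgroup P G" and cov: "finite_cover (carrier G) P" and K: "subgroup K G"
  shows "finite_cover K (K \<inter> P)"
proof -
  obtain T where T: "finite T" "T \<subseteq> carrier G" "\<And>x. x \<in> carrier G \<Longrightarrow> \<exists>t\<in>T. x \<otimes> inv t \<in> P"
    by (rule finite_coverE[OF cov order_refl P]) blast
  \<comment> \<open>Cosets of \<open>P\<close> that miss \<open>K\<close> are dropped; each
    remaining one gets a representative \<open>c t\<close> in \<open>K\<close>, which keeps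
    \<open>x \<otimes> inv (c t)\<close> inside \<open>K\<close>.\<close>
  define R where "R = {t \<in> T. \<exists>k\<in>K. k \<otimes> inv t \<in> P}"
  have "\<exists>c. \<forall>t\<in>R. c t \<in> K \<and> c t \<otimes> inv t \<in> P" by (rule bchoice) (auto simp: R_def)
  then obtain c where c: "\<forall>t\<in>R. c t \<in> K \<and> c t \<otimes> inv t \<in> P" by (rule exE)
  have Kc: "x \<in> carrier G" if "x \<in> K" for x by (rule subgroup.mem_carrier[OF K that])
  show ?thesis
  proof (rule finite_coverI[of "c ` R"])
    show "finite (c ` R)" using T unfolding R_def by simp
    show "c ` R \<subseteq> carrier G" using c Kc by auto
    show "K \<subseteq> carrier G" using Kc by auto
    show "subgroup (K \<inter> P) G" by (rule subgroups_Inter_pair[OF K P])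
    fix x assume x: "x \<in> K"
    then obtain t where t: "t \<in> T" "x \<otimes> inv t \<in> P" using T(3)[OF Kc[OF x]] by auto
    then have tR: "t \<in> R" unfolding R_def using x by auto
    have ct: "c t \<in> K" "c t \<otimes> inv t \<in> P" using c tR by auto
    have "(x \<otimes> inv t) \<otimes> inv (c t \<otimes> inv t) \<in> P"
      by (rule subgroup.m_closed[OF P t(2) subgroup.m_inv_closed[OF P ct(2)]])
    moreover have "(x \<otimes> inv t) \<otimes> inv (c t \<otimes> inv t) = x \<otimes> inv (c t)"
      using x ct t(1) T(2) Kc by (simp add: group_word_simps subset_iff)
    moreover have "x \<otimes> inv (c t) \<in> K" by (rule subgroup.m_closed[OF K x subgroup.m_inv_closed[OF K ct(1)]])
    ultimately show "\<exists>z\<in>c ` R. x \<otimes> inv z \<in> K \<inter> P" using tR by (intro bexI[of _ "c t"]) auto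
  qed
qed

text \<open>Every \<open>K\<close> contains \<open>K \<inter> P\<close> with finite index, so both
  properties can be tested on intersections with \<open>P\<close>.\<close>

lemma virtually_power_covered:
  assumes P: "subgroup P G" and cov: "finite_cover (carrier G) P"
    and covered: "power_covered_on P" and rank: "power_rank_on P h"
  shows "power_covered_on (carrier G)" and "power_rank_on (carrier G) (\<lambda>K. h (K \<inter> P))"
proof -
  show "power_covered_on (carrier G)"
    unfolding power_covered_on_def
  proof (intro allI impI)
    fix K L assume K: "subgroup K G" and L: "subgroup L G" and LK: "L \<subseteq> K" "powers_in K L"
    have KP: "subgroup (K \<inter> P) G" and LP: "subgroup (L \<inter> P) G" by (simp_all add: subgroups_Inter_pair K L P)
    have "powers_in (K \<inter> P) (L \<inter> P)"
      using LK(2) subgroup_nat_pow_closed[OF P] unfolding powers_in_def by blast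
    then have "finite_cover (K \<inter> P) (L \<inter> P)"
      using covered KP LP LK unfolding power_covered_on_def by blast
    then have "finite_cover (K \<inter> P) L" by (rule finite_cover_mono) auto
    then show "finite_cover K L"
      by (rule finite_cover_trans[OF finite_cover_inter[OF P cov K] _ subgroup.subset[OF K] KP L])
  qed
  show "power_rank_on (carrier G) (\<lambda>K. h (K \<inter> P))"
    unfolding power_rank_on_def
  proof (intro allI impI)
    fix K L assume K: "subgroup K G" and L: "subgroup L G" and LK: "L \<subseteq> K"
    have KP: "subgroup (K \<inter> P) G" and LP: "subgroup (L \<inter> P) G" by (simp_all add: subgroups_Inter_pair K L P)
    have h: "h (L \<inter> P) \<le> h (K \<inter> P) \<and> (h (L \<inter> P) = h (K \<inter> P) \<longrightarrow> powers_in (K \<inter> P) (L \<inter> P))"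
      using rank KP LP LK unfolding power_rank_on_def by auto
    have "powers_in K L" if "powers_in (K \<inter> P) (L \<inter> P)"
    proof (rule powers_in_trans)
      show "powers_in K (K \<inter> P)"
        by (rule finite_cover_imp_powers_in[OF KP K finite_cover_inter[OF P cov K]])
      show "powers_in (K \<inter> P) L" by (rule powers_in_mono[OF that]) auto
    qed (rule subgroup.subset[OF K])
    with h show "h (L \<inter> P) \<le> h (K \<inter> P) \<and> (h (L \<inter> P) = h (K \<inter> P) \<longrightarrow> powers_in K L)" by blast
  qed
qed

end

section \<open>Groups with a power rank\<close>

context group
begin

lemma hom_funpow:
  assumes "f \<in> hom G G" shows "(f ^^ n) \<in> hom G G"
proof (induction n)
  case 0 show ?case by (simp add: hom_def)
next
  case (Suc n)
  then show ?case using Group.hom_compose[OF Suc.IH assms] by (simp only: funpow.simps)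
qed

lemma subgroup_hom_image:
  assumes "f \<in> hom G G" "subgroup K G" shows "subgroup (f ` K) G"
proof -
  interpret f: group_hom G G f by unfold_locales (rule assms(1))
  show ?thesis by (rule f.subgroup_img_is_subgroup[OF assms(2)])
qed

lemma powers_in_descending_chain:
  fixes S :: "nat \<Rightarrow> 'a set"
  assumes h: "power_rank_on (carrier G) h" and S: "\<And>i. subgroup (S i) G" "\<And>i. S (Suc i) \<subseteq> S i"
  shows "\<exists>i. powers_in (S i) (S (Suc i))"
proof (rule ccontr)
  assume no: "\<not> (\<exists>i. powers_in (S i) (S (Suc i)))"
  have less: "h (S (Suc i)) < h (S i)" for i
  proof -
    have "h (S (Suc i)) \<le> h (S i)" "h (S (Suc i)) = h (S i) \<longrightarrow> powers_in (S i) (S (Suc i))"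
      using h S subgroup.subset[OF S(1)] unfolding power_rank_on_def by simp_all
    then show ?thesis using no by (cases "h (S (Suc i)) = h (S i)") auto
  qed
  have "h (S i) + i \<le> h (S 0)" for i
  proof (induction i)
    case (Suc i) then show ?case using less[of i] by simp
  qed simp
  from this[of "Suc (h (S 0))"] show False by simp
qed

lemma powers_in_ascending_chain:
  fixes S :: "nat \<Rightarrow> 'a set"
  assumes h: "power_rank_on (carrier G) h" and S: "\<And>i. subgroup (S i) G" "\<And>i. S i \<subseteq> S (Suc i)"
  shows "\<exists>i. powers_in (S (Suc i)) (S i)"
proof (rule ccontr)
  assume no: "\<not> (\<exists>i. powers_in (S (Suc i)) (S i))"
  have less: "h (S i) < h (S (Suc i))" for i
  proof -
    have "h (S i) \<le> h (S (Suc i))" "h (S i) = h (S (Suc i)) \<longrightarrow> powers_in (S (Suc i)) (S i)"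
      using h S subgroup.subset[OF S(1)] unfolding power_rank_on_def by simp_all
    then show ?thesis using no by (cases "h (S i) = h (S (Suc i))") auto
  qed
  have le: "i \<le> h (S i)" for i
  proof (induction i)
    case (Suc i) then show ?case using less[of i] by simp
  qed simp
  have "h (S i) \<le> h (carrier G)" for i
    using h S(1) subgroup.subset[OF S(1)] subgroup_self unfolding power_rank_on_def by simp
  then show False using le[of "Suc (h (carrier G))"] by (meson not_less_eq_eq le_trans)
qed

text \<open>Among the finite subsets of \<open>K\<close> take one whose generated subgroup has the
  largest rank. Adjoining any \<open>x\<close> of \<open>K\<close> then leaves the rank unchanged,
  so a power of \<open>x\<close> is already generated. This takes the place of finite
  generation.\<close>

lemma powers_in_generate_finite:
  assumes h: "power_rank_on (carrier G) h" and K: "subgroup K G"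
  obtains Y where "finite Y" "Y \<subseteq> K" "powers_in K (generate G Y)"
proof -
  define P where "P n \<longleftrightarrow> (\<exists>Y. finite Y \<and> Y \<subseteq> K \<and> h (generate G Y) = n)" for n
  have sg: "subgroup (generate G Y) G" "generate G Y \<subseteq> K" if "Y \<subseteq> K" for Y
    using that subgroup.subset[OF K] generate_is_subgroup generate_subgroup_incl[OF that K] by auto
  have "P (h (generate G {}))" unfolding P_def by (intro exI[of _ "{}"]) simp
  moreover have "\<forall>n. P n \<longrightarrow> n \<le> h K"
    unfolding P_def using h sg K subgroup.subset[OF K] unfolding power_rank_on_def by blast
  ultimately obtain n where n: "P n" "\<And>m. P m \<Longrightarrow> m \<le> n" using GreatestI_nat[of P _ "h K"] Greatest_le_nat[of P _ "h K"] by blast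
  then obtain Y where Y: "finite Y" "Y \<subseteq> K" "h (generate G Y) = n" unfolding P_def by (elim exE conjE)
  have "\<exists>e::nat. e > 0 \<and> x [^] e \<in> generate G Y" if x: "x \<in> K" for x
  proof -
    have xY: "insert x Y \<subseteq> K" using x Y by simp
    have le: "generate G Y \<subseteq> generate G (insert x Y)" by (rule mono_generate) auto
    have "P (h (generate G (insert x Y)))" unfolding P_def using Y xY by (intro exI[of _ "insert x Y"]) simp
    then have "h (generate G (insert x Y)) \<le> h (generate G Y)" using n Y by simp
    moreover have "h (generate G Y) \<le> h (generate G (insert x Y)) \<and>
        (h (generate G Y) = h (generate G (insert x Y)) \<longrightarrow> powers_in (generate G (insert x Y)) (generate G Y))"
      using h sg(1)[OF xY] sg(1)[OF Y(2)] le subgroup.subset[OF sg(1)[OF xY]]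
      unfolding power_rank_on_def by simp
    ultimately have "powers_in (generate G (insert x Y)) (generate G Y)" by simp
    moreover have "x \<in> generate G (insert x Y)" by (rule generate.incl) simp
    ultimately show ?thesis unfolding powers_in_def by simp
  qed
  then have "powers_in K (generate G Y)" unfolding powers_in_def by simp
  with Y(1,2) show ?thesis by (rule that)
qed

text \<open>The images of \<open>K\<close> under the powers of \<open>f\<close> form a descending
  chain. The equation stays under \<open>f ^^ i\<close> because \<open>f\<close> may have a kernel;
  \<open>powers_in_injective_image\<close> cancels \<open>f ^^ i\<close> exactly,
  \<open>powers_in_image_torsion_kernel\<close> up to torsion.\<close>

lemma endo_stable_image:
  assumes h: "power_rank_on (carrier G) h" and f: "f \<in> hom G G" and K: "subgroup K G"
    and fK: "f ` K \<subseteq> K"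
  shows "\<exists>i. \<forall>a\<in>K. \<exists>e::nat. e > 0 \<and> (\<exists>b\<in>K. (f ^^ i) (a [^] e) = (f ^^ i) (f b))"
proof -
  define S where "S i = (f ^^ i) ` K" for i
  have sub: "subgroup (S i) G" for i unfolding S_def by (rule subgroup_hom_image[OF hom_funpow[OF f] K])
  have dec: "S (Suc i) \<subseteq> S i" for i
    unfolding S_def funpow_Suc_right image_comp[symmetric] by (rule image_mono[OF fK])
  obtain i where i: "powers_in (S i) (S (Suc i))" using powers_in_descending_chain[of h S, OF h sub dec] by (rule exE)
  have "\<exists>e::nat. e > 0 \<and> (\<exists>b\<in>K. (f ^^ i) (a [^] e) = (f ^^ i) (f b))" if a: "a \<in> K" for a
  proof -
    have "(f ^^ i) a \<in> S i" using a unfolding S_def by simp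
    then obtain e :: nat where e: "e > 0" "(f ^^ i) a [^] e \<in> S (Suc i)" by (rule powers_inD[OF i])
    have "(f ^^ i) a [^] e = (f ^^ i) (a [^] e)"
      using hom_nat_pow[OF hom_funpow[OF f] _ is_group is_group] subgroup.mem_carrier[OF K a] by simp
    then show ?thesis using e unfolding S_def funpow_Suc_right by auto
  qed
  then show ?thesis by auto
qed

lemma powers_in_injective_image:
  assumes h: "power_rank_on (carrier G) h" and f: "f \<in> hom G G" and K: "subgroup K G"
    and fK: "f ` K \<subseteq> K" and inj: "inj_on f (carrier G)"
  shows "powers_in K (f ` K)"
  unfolding powers_in_def
proof
  fix a assume a: "a \<in> K"
  obtain i where i: "\<forall>a\<in>K. \<exists>e::nat. e > 0 \<and> (\<exists>b\<in>K. (f ^^ i) (a [^] e) = (f ^^ i) (f b))"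
    using endo_stable_image[OF h f K fK] by (rule exE)
  obtain e :: nat and b where e: "e > 0" "b \<in> K" "(f ^^ i) (a [^] e) = (f ^^ i) (f b)" using i a by blast
  have fc: "f ` carrier G \<subseteq> carrier G" by (rule hom_carrier[OF f])
  have "inj_on (f ^^ n) (carrier G) \<and> (f ^^ n) ` carrier G \<subseteq> carrier G" for n
  proof (induction n)
    case (Suc n)
    then have 1: "inj_on (f ^^ n) (carrier G)" and 2: "(f ^^ n) ` carrier G \<subseteq> carrier G" by auto
    have "inj_on (f \<circ> f ^^ n) (carrier G)" by (rule comp_inj_on[OF 1 inj_on_subset[OF inj 2]])
    moreover have "(f \<circ> f ^^ n) ` carrier G \<subseteq> carrier G"
      unfolding image_comp[symmetric] by (rule subset_trans[OF image_mono[OF 2] fc])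
    ultimately show ?case by (simp only: funpow.simps)
  qed simp
  then have "inj_on (f ^^ i) (carrier G)" by simp
  moreover have "a [^] e \<in> carrier G" "f b \<in> carrier G"
    using subgroup.mem_carrier[OF K] a e fK by auto
  ultimately have "a [^] e = f b" using e(3) unfolding inj_on_def by simp
  then show "\<exists>e::nat. e > 0 \<and> a [^] e \<in> f ` K" using e by auto
qed

end

text \<open>A rational form of rank-nullity. If the kernel of \<open>f\<close> is torsion, so is
  that of every \<open>f ^^ i\<close>; hence \<open>a [^] e\<close> and \<open>f b\<close> differ by
  a torsion element, and commutativity lets one further power remove it.\<close>

lemma (in comm_group) powers_in_image_torsion_kernel:
  assumes h: "power_rank_on (carrier G) h" and f: "f \<in> hom G G"
    and ker: "\<And>x. \<lbrakk>x \<in> carrier G; f x = \<one>\<rbrakk> \<Longrightarrow> \<exists>e::nat. e > 0 \<and> x [^] e = \<one>"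
  shows "powers_in (carrier G) (f ` carrier G)"
  unfolding powers_in_def
proof
  fix a assume a: "a \<in> carrier G"
  have fc: "f x \<in> carrier G" if "x \<in> carrier G" for x using f that by (rule hom_in_carrier)
  have ker_i: "\<exists>e::nat. e > 0 \<and> x [^] e = \<one>" if "x \<in> carrier G" "(f ^^ i) x = \<one>" for i x
    using that
  proof (induction i arbitrary: x)
    case 0 then show ?case by (intro exI[of _ 1]) simp
  next
    case (Suc i)
    then obtain e :: nat where e: "e > 0" "f x [^] e = \<one>"
      using Suc.IH[of "f x"] fc by (auto simp: funpow_swap1)
    then have "f (x [^] e) = \<one>" using hom_nat_pow[OF f Suc.prems(1) is_group is_group] by simp
    then obtain d :: nat where "d > 0" "(x [^] e) [^] d = \<one>" using ker[of "x [^] e"] Suc.prems by auto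
    then show ?case using e Suc.prems by (intro exI[of _ "e * d"]) (simp add: nat_pow_pow)
  qed
  have "f ` carrier G \<subseteq> carrier G" using fc by auto
  from endo_stable_image[OF h f subgroup_self this]
  obtain i where i: "\<forall>a\<in>carrier G. \<exists>e::nat. e > 0 \<and> (\<exists>b\<in>carrier G. (f ^^ i) (a [^] e) = (f ^^ i) (f b))"
    by (rule exE)
  obtain e :: nat and b where e: "e > 0" "b \<in> carrier G" "(f ^^ i) (a [^] e) = (f ^^ i) (f b)"
    using i a by blast
  interpret fi: group_hom G G "f ^^ i" by unfold_locales (rule hom_funpow[OF f])
  have "(f ^^ i) (a [^] e \<otimes> inv (f b)) = \<one>"
    using a e fc by simp
  then obtain d :: nat where d: "d > 0" "(a [^] e \<otimes> inv (f b)) [^] d = \<one>"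
    using ker_i[of "a [^] e \<otimes> inv (f b)" i] a e fc by auto
  have "(a [^] e \<otimes> inv (f b)) [^] d = a [^] (e * d) \<otimes> inv (f (b [^] d))"
    using a e fc by (simp add: pow_mult_distrib m_comm nat_pow_inv nat_pow_pow hom_nat_pow[OF f _ is_group is_group])
  then have "a [^] (e * d) \<otimes> inv (f (b [^] d)) = \<one>" using d(2) by simp
  moreover have "a [^] (e * d) \<otimes> inv (f (b [^] d)) \<otimes> f (b [^] d) = a [^] (e * d)"
    using a e(2) fc by (simp add: m_assoc)
  ultimately have "a [^] (e * d) = f (b [^] d)" using a e(2) fc by simp
  then show "\<exists>e::nat. e > 0 \<and> a [^] e \<in> f ` carrier G"
    using d(1) e(1,2) by (intro exI[of _ "e * d"]) auto
qed

section \<open>Integer polynomials in an endomorphism\<close>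

primrec poly_act :: "('a, 'b) monoid_scheme \<Rightarrow> int list \<Rightarrow> ('a \<Rightarrow> 'a) \<Rightarrow> 'a \<Rightarrow> 'a" where
  "poly_act Q [] r x = \<one>\<^bsub>Q\<^esub>"
| "poly_act Q (a # p) r x = (r ^^ length p) (x [^]\<^bsub>Q\<^esub> a) \<otimes>\<^bsub>Q\<^esub> poly_act Q p r x"

text \<open>The value of the product of the polynomials in \<open>P\<close>, left as a list of
  factors: nothing has to be multiplied out, and in an integral domain a zero of the product is a
  zero of some factor.\<close>

definition polys_act :: "('a, 'b) monoid_scheme \<Rightarrow> int list list \<Rightarrow> ('a \<Rightarrow> 'a) \<Rightarrow> 'a \<Rightarrow> 'a" where
  "polys_act Q P r = foldr (\<lambda>p. poly_act Q p r) P"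

lemma polys_act_Nil [simp]: "polys_act Q [] r x = x"
  and polys_act_Cons [simp]: "polys_act Q (p # P) r x = poly_act Q p r (polys_act Q P r x)"
  by (simp_all add: polys_act_def)

text \<open>Neither group need be abelian and \<open>r\<close> need not be a homomorphism, so the
  same lemma serves for the projection of a section onto its quotient and for
  \<open>\<phi> ^^ n\<close> on \<open>G\<close> itself, with a conjugation as
  \<open>r\<close>.\<close>

lemma poly_act_natural:
  assumes Q: "group Q" and Q': "group Q'" and K: "subgroup K Q"
    and \<theta>: "\<theta> \<in> hom (Q\<lparr>carrier := K\<rparr>) Q'" and r: "\<And>x. x \<in> K \<Longrightarrow> r x \<in> K"
    and r': "\<And>x. x \<in> K \<Longrightarrow> \<theta> (r x) = r' (\<theta> x)" and x: "x \<in> K"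
  shows "poly_act Q p r x \<in> K \<and> \<theta> (poly_act Q p r x) = poly_act Q' p r' (\<theta> x)"
proof (induction p)
  interpret Q: group Q by fact
  have KQ: "group (Q\<lparr>carrier := K\<rparr>)" by (rule Q.subgroup_imp_group[OF K])
  {
    case Nil
    show ?case using subgroup.one_closed[OF K] hom_one[OF \<theta> KQ Q'] by simp
  next
    case (Cons a p)
    have xa: "x [^]\<^bsub>Q\<^esub> a \<in> K" "\<theta> (x [^]\<^bsub>Q\<^esub> a) = \<theta> x [^]\<^bsub>Q'\<^esub> a"
      using Q.subgroup_int_pow_closed[OF K x] hom_int_pow[OF \<theta> _ KQ Q', of x a]
        Q.int_pow_consistent[OF K x] x by simp_all
    have it: "(r ^^ n) z \<in> K \<and> \<theta> ((r ^^ n) z) = (r' ^^ n) (\<theta> z)" if "z \<in> K" for n z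
      using that by (induction n) (auto simp: r r')
    show ?case
      using Cons.IH it[OF xa(1), of "length p"] xa \<theta> subgroup.m_closed[OF K]
      by (auto simp: hom_def)
  }
qed

lemma polys_act_natural:
  assumes Q: "group Q" and Q': "group Q'" and K: "subgroup K Q"
    and \<theta>: "\<theta> \<in> hom (Q\<lparr>carrier := K\<rparr>) Q'" and r: "\<And>x. x \<in> K \<Longrightarrow> r x \<in> K"
    and r': "\<And>x. x \<in> K \<Longrightarrow> \<theta> (r x) = r' (\<theta> x)" and x: "x \<in> K"
  shows "polys_act Q P r x \<in> K \<and> \<theta> (polys_act Q P r x) = polys_act Q' P r' (\<theta> x)"
proof (induction P)
  case (Cons p P)
  then show ?case using poly_act_natural[of Q Q' K \<theta> r r' "polys_act Q P r x" p, OF Q Q' K \<theta> r r'] by simp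
qed (use x in simp)

context comm_group
begin

lemma poly_act_hom:
  assumes r: "r \<in> hom G G" shows "poly_act G p r \<in> hom G G"
proof (rule homI)
  have rc: "(r ^^ n) x \<in> carrier G" if "x \<in> carrier G" for n x
    by (rule hom_in_carrier[OF hom_funpow[OF r] that])
  show cl: "poly_act G p r x \<in> carrier G" if "x \<in> carrier G" for x
    using that rc by (induction p) auto
  show "poly_act G p r (x \<otimes> y) = poly_act G p r x \<otimes> poly_act G p r y"
    if x: "x \<in> carrier G" "y \<in> carrier G" for x y
  proof (induction p)
    case (Cons a p)
    have cl': "poly_act G p r z \<in> carrier G" if "z \<in> carrier G" for z
      using that rc by (induction p) auto
    show ?case using x Cons rc[of "x [^] a"] rc[of "y [^] a"] cl'
      by (simp add: int_pow_distrib hom_mult[OF hom_funpow[OF r]] m_ac)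
  qed simp
qed

lemma polys_act_hom:
  assumes r: "r \<in> hom G G" shows "polys_act G P r \<in> hom G G"
proof (induction P)
  case Nil show ?case by (simp add: hom_def)
next
  case (Cons p P)
  then show ?case using Group.hom_compose[OF Cons.IH poly_act_hom[OF r, of p]]
    by (simp only: polys_act_def foldr_Cons)
qed

lemma poly_act_map2_add:
  assumes r: "r \<in> hom G G" and x: "x \<in> carrier G" and "length p = length q"
  shows "poly_act G (map2 (+) p q) r x = poly_act G p r x \<otimes> poly_act G q r x"
  using assms(3)
proof (induction p q rule: list_induct2)
  case (Cons a p b q)
  have cl: "(r ^^ n) (x [^] c) \<in> carrier G" for n and c :: int
    by (rule hom_in_carrier[OF hom_funpow[OF r]]) (simp add: x)
  show ?case
    using Cons cl hom_in_carrier[OF poly_act_hom[OF r] x]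
    by (simp add: int_pow_mult[OF x] hom_mult[OF hom_funpow[OF r]] x m_ac)
qed simp

lemma poly_act_map_uminus:
  assumes r: "r \<in> hom G G" and x: "x \<in> carrier G"
  shows "poly_act G (map uminus p) r x = inv (poly_act G p r x)"
proof (induction p)
  case (Cons a p)
  interpret rn: group_hom G G "r ^^ length p" by unfold_locales (rule hom_funpow[OF r])
  show ?case
    using Cons hom_in_carrier[OF poly_act_hom[OF r] x] x
    by (simp add: int_pow_neg inv_mult)
qed simp

lemma poly_act_replicate_zero:
  assumes r: "r \<in> hom G G" and x: "x \<in> carrier G"
  shows "poly_act G (replicate n 0 @ p) r x = poly_act G p r x" "poly_act G (replicate n 0) r x = \<one>"
proof -
  have one: "(r ^^ n) \<one> = \<one>" for n by (rule hom_one[OF hom_funpow[OF r] is_group is_group])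
  show "poly_act G (replicate n 0 @ p) r x = poly_act G p r x" "poly_act G (replicate n 0) r x = \<one>"
    using hom_in_carrier[OF poly_act_hom[OF r] x] by (induction n) (simp_all add: one)
qed

text \<open>The subgroups generated by \<open>x, r x, \<dots>, r\<^sup>k x\<close> stabilise up to powers, which gives a relation with nonzero
  leading coefficient.\<close>

lemma poly_act_annihilates_element:
  assumes h: "power_rank_on (carrier G) h" and r: "r \<in> hom G G" and x: "x \<in> carrier G"
  shows "\<exists>a p. a \<noteq> 0 \<and> poly_act G (a # p) r x = \<one>"
proof -
  define S where "S k = {poly_act G p r x | p. length p = k}" for k
  have cl: "poly_act G p r x \<in> carrier G" for p by (rule hom_in_carrier[OF poly_act_hom[OF r] x])
  have sub: "subgroup (S k) G" for k
  proof (rule subgroupI)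
    show "S k \<subseteq> carrier G" unfolding S_def using cl by auto
    have "poly_act G (replicate k 0) r x \<in> S k" unfolding S_def by (intro CollectI exI[of _ "replicate k 0"]) simp
    then show "S k \<noteq> {}" by auto
    show "inv a \<in> S k" if "a \<in> S k" for a
    proof -
      obtain p where p: "a = poly_act G p r x" "length p = k" using \<open>a \<in> S k\<close> unfolding S_def by auto
      then have "inv a = poly_act G (map uminus p) r x" by (simp add: poly_act_map_uminus[OF r x])
      then show ?thesis unfolding S_def using p by (intro CollectI exI[of _ "map uminus p"]) simp
    qed
    show "a \<otimes> b \<in> S k" if "a \<in> S k" "b \<in> S k" for a b
    proof -
      obtain p where p: "a = poly_act G p r x" "length p = k" using \<open>a \<in> S k\<close> unfolding S_def by auto
      obtain q where q: "b = poly_act G q r x" "length q = k" using \<open>b \<in> S k\<close> unfolding S_def by auto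
      have "a \<otimes> b = poly_act G (map2 (+) p q) r x" using p q by (simp add: poly_act_map2_add[OF r x])
      then show ?thesis unfolding S_def using p q by (intro CollectI exI[of _ "map2 (+) p q"]) simp
    qed
  qed
  have inc: "S k \<subseteq> S (Suc k)" for k
  proof (rule subsetI)
    fix a assume "a \<in> S k"
    then obtain p where p: "a = poly_act G p r x" "length p = k" unfolding S_def by auto
    then have "a = poly_act G (0 # p) r x" using poly_act_replicate_zero(1)[OF r x, of 1 p] by simp
    then show "a \<in> S (Suc k)" unfolding S_def using p by (intro CollectI exI[of _ "0 # p"]) simp
  qed
  obtain k where k: "powers_in (S (Suc k)) (S k)"
    using powers_in_ascending_chain[of h S, OF h sub inc] by (rule exE)
  have rk: "(r ^^ k) z \<in> carrier G" if "z \<in> carrier G" for z by (rule hom_in_carrier[OF hom_funpow[OF r] that])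
  have top: "poly_act G (c # replicate k 0) r x = (r ^^ k) (x [^] c)" for c
    using poly_act_replicate_zero(2)[OF r x, of k] rk x by simp
  have "(r ^^ k) x \<in> S (Suc k)" unfolding S_def
    using top[of 1] x by (intro CollectI exI[of _ "1 # replicate k 0"]) simp
  then obtain e :: nat where e: "e > 0" "(r ^^ k) x [^] e \<in> S k" by (rule powers_inD[OF k])
  then obtain q where q: "(r ^^ k) x [^] e = poly_act G q r x" "length q = k" unfolding S_def by auto
  have "(r ^^ k) (x [^] int e) = (r ^^ k) x [^] e"
    using hom_nat_pow[OF hom_funpow[OF r] x is_group is_group] by (simp add: int_pow_int)
  then have "poly_act G (int e # map uminus q) r x = \<one>"
    using q cl by (simp add: poly_act_map_uminus[OF r x])
  then show ?thesis using e(1) by (intro exI[of _ "int e"] exI[of _ "map uminus q"]) simp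
qed

text \<open>Take a finite set \<open>Y\<close> generating the group up to powers. Each
  \<open>y\<close> in turn gets a polynomial annihilating what the factors chosen so far leave of
  it. The composite kills \<open>Y\<close> and the subgroup it generates, which contains a power of
  every element. The nonzero leading coefficients later ensure that there are finitely many
  roots.\<close>

lemma polys_act_torsion:
  assumes h: "power_rank_on (carrier G) h" and r: "r \<in> hom G G"
  obtains P where "\<And>p. p \<in> set P \<Longrightarrow> p \<noteq> [] \<and> hd p \<noteq> 0"
    "\<And>x. x \<in> carrier G \<Longrightarrow> \<exists>e::nat. e > 0 \<and> polys_act G P r x [^] e = \<one>"
proof -
  obtain Y where Y: "finite Y" "Y \<subseteq> carrier G" "powers_in (carrier G) (generate G Y)"
    by (rule powers_in_generate_finite[OF h subgroup_self])
  have "\<exists>P. (\<forall>p\<in>set P. p \<noteq> [] \<and> hd p \<noteq> 0) \<and> (\<forall>y\<in>Y. polys_act G P r y = \<one>)"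
    using Y(1,2)
  proof (induction Y rule: finite_induct)
    case empty show ?case by (intro exI[of _ "[]"]) simp
  next
    case (insert y Y)
    then obtain P where P: "\<forall>p\<in>set P. p \<noteq> [] \<and> hd p \<noteq> 0" "\<forall>y\<in>Y. polys_act G P r y = \<one>" by auto
    have "polys_act G P r y \<in> carrier G" using insert by (intro hom_in_carrier[OF polys_act_hom[OF r]]) simp
    from poly_act_annihilates_element[OF h r this]
    obtain a p where p: "a \<noteq> 0" "poly_act G (a # p) r (polys_act G P r y) = \<one>" by (elim exE conjE)
    have "polys_act G ((a # p) # P) r z = \<one>" if "z \<in> insert y Y" for z
      using that p(2) P(2) hom_one[OF poly_act_hom[OF r, of "a # p"] is_group is_group]
      by (cases "z = y") (simp_all only: polys_act_Cons insert_iff, simp_all)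
    then show ?case using p P by (intro exI[of _ "(a # p) # P"]) simp
  qed
  then obtain P where P: "\<forall>p\<in>set P. p \<noteq> [] \<and> hd p \<noteq> 0" "\<forall>y\<in>Y. polys_act G P r y = \<one>"
    by (elim exE conjE)
  interpret f: group_hom G G "polys_act G P r" by unfold_locales (rule polys_act_hom[OF r])
  have ker: "generate G Y \<subseteq> kernel G G (polys_act G P r)"
    by (rule generate_subgroup_incl[OF _ f.subgroup_kernel]) (use Y P in \<open>auto simp: kernel_def\<close>)
  have "\<exists>e::nat. e > 0 \<and> polys_act G P r x [^] e = \<one>" if x: "x \<in> carrier G" for x
  proof -
    obtain e :: nat where e: "e > 0" "x [^] e \<in> generate G Y" using x by (rule powers_inD[OF Y(3)])
    then have "polys_act G P r (x [^] e) = \<one>" using ker unfolding kernel_def by auto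
    then show ?thesis using e(1) x by (intro exI[of _ e]) (simp add: f.hom_nat_pow)
  qed
  with P(1) show ?thesis by (intro that[of P]) auto
qed

end

section \<open>Commuting endomorphisms acting irreducibly\<close>

definition centralizing_homs :: "('a, 'b) monoid_scheme \<Rightarrow> ('a \<Rightarrow> 'a) set \<Rightarrow> ('a \<Rightarrow> 'a) set" where
  "centralizing_homs G S = {g \<in> hom G G. \<forall>s\<in>S. \<forall>x\<in>carrier G. g (s x) = s (g x)}"

text \<open>A ring containing the restrictions of \<open>S\<close> and of all power maps, obtained
  without generating a subring. If the members of \<open>S\<close> commute with each other,
  \<open>S\<close> lies in its own centralizer, so the double centralizer lies in the centralizer
  and is commutative. Functions are extensional so that equality in the ring is equality on the
  group.\<close>

definition bicommutant :: "('a, 'b) monoid_scheme \<Rightarrow> ('a \<Rightarrow> 'a) set \<Rightarrow> ('a \<Rightarrow> 'a) ring" where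
  "bicommutant G S =
     \<lparr>carrier = centralizing_homs G (centralizing_homs G S) \<inter> extensional (carrier G),
      monoid.mult = (\<lambda>f g. \<lambda>x\<in>carrier G. f (g x)), one = (\<lambda>x\<in>carrier G. x),
      ring.zero = (\<lambda>x\<in>carrier G. \<one>\<^bsub>G\<^esub>), add = (\<lambda>f g. \<lambda>x\<in>carrier G. f x \<otimes>\<^bsub>G\<^esub> g x)\<rparr>"

locale irreducible_action = comm_group G for G (structure) +
  fixes S :: "('a \<Rightarrow> 'a) set"
  assumes S_hom: "s \<in> S \<Longrightarrow> s \<in> hom G G"
    and S_comm: "\<lbrakk>s \<in> S; t \<in> S; x \<in> carrier G\<rbrakk> \<Longrightarrow> s (t x) = t (s x)"
    and torsion_free: "\<lbrakk>x \<in> carrier G; e > 0; x [^] (e::nat) = \<one>\<rbrakk> \<Longrightarrow> x = \<one>"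
    and irreducible: "\<lbrakk>subgroup B G; \<And>s. s \<in> S \<Longrightarrow> s ` B \<subseteq> B\<rbrakk> \<Longrightarrow> B = {\<one>} \<or> powers_in (carrier G) B"
    and nontrivial: "\<exists>x\<in>carrier G. x \<noteq> \<one>"
begin

abbreviation "R \<equiv> bicommutant G S"

lemma bicommutant_memD:
  assumes "f \<in> carrier R"
  shows "f \<in> hom G G" "f \<in> extensional (carrier G)" "x \<in> carrier G \<Longrightarrow> f x \<in> carrier G"
    "g \<in> centralizing_homs G S \<Longrightarrow> x \<in> carrier G \<Longrightarrow> f (g x) = g (f x)"
  using assms hom_in_carrier[of f G G x] unfolding bicommutant_def centralizing_homs_def by auto

lemma bicommutant_memI:
  assumes "f \<in> hom G G" "f \<in> extensional (carrier G)"
    "\<And>g x. \<lbrakk>g \<in> centralizing_homs G S; x \<in> carrier G\<rbrakk> \<Longrightarrow> f (g x) = g (f x)"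
  shows "f \<in> carrier R"
  using assms unfolding bicommutant_def centralizing_homs_def[of G "centralizing_homs G S"] by auto

lemma S_centralizing: "s \<in> S \<Longrightarrow> s \<in> centralizing_homs G S"
  unfolding centralizing_homs_def using S_hom S_comm by auto

lemma centralizing_hom: "g \<in> centralizing_homs G S \<Longrightarrow> g \<in> hom G G"
  unfolding centralizing_homs_def by auto

lemma bicommutant_comm:
  assumes "f \<in> carrier R" "g \<in> carrier R" "x \<in> carrier G" shows "f (g x) = g (f x)"
proof -
  have "g \<in> centralizing_homs G S"
    using bicommutant_memD[OF assms(2)] S_centralizing unfolding centralizing_homs_def[of G S] by auto
  then show ?thesis using bicommutant_memD(4)[OF assms(1)] assms(3) by blast
qed

lemma bicommutant_simps:
  "f \<otimes>\<^bsub>R\<^esub> g = (\<lambda>x\<in>carrier G. f (g x))" "f \<oplus>\<^bsub>R\<^esub> g = (\<lambda>x\<in>carrier G. f x \<otimes> g x)"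
  "\<one>\<^bsub>R\<^esub> = (\<lambda>x\<in>carrier G. x)" "\<zero>\<^bsub>R\<^esub> = (\<lambda>x\<in>carrier G. \<one>)"
  by (simp_all add: bicommutant_def)

lemma bicommutant_eqI:
  assumes "f \<in> carrier R" "g \<in> carrier R" "\<And>x. x \<in> carrier G \<Longrightarrow> f x = g x" shows "f = g"
  by (rule extensionalityI[OF bicommutant_memD(2)[OF assms(1)] bicommutant_memD(2)[OF assms(2)] assms(3)])

lemma restrict_bicommutantI:
  assumes "f \<in> hom G G" "\<And>g x. \<lbrakk>g \<in> centralizing_homs G S; x \<in> carrier G\<rbrakk> \<Longrightarrow> f (g x) = g (f x)"
  shows "restrict f (carrier G) \<in> carrier R"
proof (rule bicommutant_memI)
  show "restrict f (carrier G) \<in> hom G G" using assms(1) unfolding hom_def by auto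
  fix g x assume g: "g \<in> centralizing_homs G S" "x \<in> carrier G"
  then have "g x \<in> carrier G" using hom_in_carrier[OF centralizing_hom] by simp
  then show "restrict f (carrier G) (g x) = g (restrict f (carrier G) x)" using assms(2)[OF g] g by simp
qed simp

lemma cent_facts:
  assumes "g \<in> centralizing_homs G S"
  shows "x \<in> carrier G \<Longrightarrow> g x \<in> carrier G" "\<lbrakk>x \<in> carrier G; y \<in> carrier G\<rbrakk> \<Longrightarrow> g (x \<otimes> y) = g x \<otimes> g y"
    "g \<one> = \<one>" "x \<in> carrier G \<Longrightarrow> g (inv x) = inv (g x)" "x \<in> carrier G \<Longrightarrow> g (x [^] (a::int)) = g x [^] a"
proof -
  interpret g: group_hom G G g by unfold_locales (rule centralizing_hom[OF assms])
  show "x \<in> carrier G \<Longrightarrow> g x \<in> carrier G" "\<lbrakk>x \<in> carrier G; y \<in> carrier G\<rbrakk> \<Longrightarrow> g (x \<otimes> y) = g x \<otimes> g y"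
    "g \<one> = \<one>" "x \<in> carrier G \<Longrightarrow> g (inv x) = inv (g x)" "x \<in> carrier G \<Longrightarrow> g (x [^] (a::int)) = g x [^] a"
    by (simp_all add: g.hom_int_pow)
qed

lemma bicommutant_closed:
  shows "\<lbrakk>f \<in> carrier R; g \<in> carrier R\<rbrakk> \<Longrightarrow> f \<otimes>\<^bsub>R\<^esub> g \<in> carrier R"
    and "\<lbrakk>f \<in> carrier R; g \<in> carrier R\<rbrakk> \<Longrightarrow> f \<oplus>\<^bsub>R\<^esub> g \<in> carrier R"
    and "\<one>\<^bsub>R\<^esub> \<in> carrier R" and "\<zero>\<^bsub>R\<^esub> \<in> carrier R"
    and "f \<in> carrier R \<Longrightarrow> (\<lambda>x\<in>carrier G. inv (f x)) \<in> carrier R"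
    and "(\<lambda>x\<in>carrier G. x [^] (a::int)) \<in> carrier R"
proof -
  show "\<lbrakk>f \<in> carrier R; g \<in> carrier R\<rbrakk> \<Longrightarrow> f \<otimes>\<^bsub>R\<^esub> g \<in> carrier R"
    unfolding bicommutant_simps
    by (rule restrict_bicommutantI)
       (auto intro!: homI simp: bicommutant_memD hom_mult[OF bicommutant_memD(1)] cent_facts)
  show "\<lbrakk>f \<in> carrier R; g \<in> carrier R\<rbrakk> \<Longrightarrow> f \<oplus>\<^bsub>R\<^esub> g \<in> carrier R"
    unfolding bicommutant_simps
    by (rule restrict_bicommutantI)
       (auto intro!: homI simp: bicommutant_memD hom_mult[OF bicommutant_memD(1)] cent_facts m_ac)
  show "\<one>\<^bsub>R\<^esub> \<in> carrier R" "\<zero>\<^bsub>R\<^esub> \<in> carrier R"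
    unfolding bicommutant_simps
    by (rule restrict_bicommutantI; auto intro!: homI simp: cent_facts)+
  show "f \<in> carrier R \<Longrightarrow> (\<lambda>x\<in>carrier G. inv (f x)) \<in> carrier R"
    by (rule restrict_bicommutantI)
       (auto intro!: homI simp: bicommutant_memD hom_mult[OF bicommutant_memD(1)] cent_facts inv_mult)
  show "(\<lambda>x\<in>carrier G. x [^] (a::int)) \<in> carrier R"
    by (rule restrict_bicommutantI) (auto intro!: homI simp: cent_facts int_pow_distrib)
qed

lemma bicommutant_cring: "cring R"
proof (rule cringI)
  note [simp] = bicommutant_memD(3)
  show "abelian_group R"
  proof (rule abelian_groupI)
    fix f g k assume f: "f \<in> carrier R" and g: "g \<in> carrier R"
    show "f \<oplus>\<^bsub>R\<^esub> g \<in> carrier R" by (rule bicommutant_closed(2)[OF f g])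
    show "f \<oplus>\<^bsub>R\<^esub> g = g \<oplus>\<^bsub>R\<^esub> f"
      unfolding bicommutant_simps by (rule restrict_ext) (simp add: f g m_comm)
    assume k: "k \<in> carrier R"
    show "f \<oplus>\<^bsub>R\<^esub> g \<oplus>\<^bsub>R\<^esub> k = f \<oplus>\<^bsub>R\<^esub> (g \<oplus>\<^bsub>R\<^esub> k)"
      unfolding bicommutant_simps by (rule restrict_ext) (simp add: f g k m_assoc)
  next
    show "\<zero>\<^bsub>R\<^esub> \<in> carrier R" by (rule bicommutant_closed(4))
  next
    fix f assume f: "f \<in> carrier R"
    show "\<zero>\<^bsub>R\<^esub> \<oplus>\<^bsub>R\<^esub> f = f"
      by (rule bicommutant_eqI[OF bicommutant_closed(2)[OF bicommutant_closed(4) f] f])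
         (simp add: bicommutant_simps f)
    show "\<exists>g\<in>carrier R. g \<oplus>\<^bsub>R\<^esub> f = \<zero>\<^bsub>R\<^esub>"
    proof (rule bexI[OF _ bicommutant_closed(5)[OF f]])
      show "(\<lambda>x\<in>carrier G. inv (f x)) \<oplus>\<^bsub>R\<^esub> f = \<zero>\<^bsub>R\<^esub>"
        unfolding bicommutant_simps by (rule restrict_ext) (simp add: f)
    qed
  qed
  show "comm_monoid R"
  proof (rule comm_monoidI)
    fix f g k assume f: "f \<in> carrier R" and g: "g \<in> carrier R"
    show "f \<otimes>\<^bsub>R\<^esub> g \<in> carrier R" by (rule bicommutant_closed(1)[OF f g])
    show "f \<otimes>\<^bsub>R\<^esub> g = g \<otimes>\<^bsub>R\<^esub> f"
      unfolding bicommutant_simps by (rule restrict_ext) (simp add: bicommutant_comm f g)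
    assume k: "k \<in> carrier R"
    show "f \<otimes>\<^bsub>R\<^esub> g \<otimes>\<^bsub>R\<^esub> k = f \<otimes>\<^bsub>R\<^esub> (g \<otimes>\<^bsub>R\<^esub> k)"
      unfolding bicommutant_simps by (rule restrict_ext) (simp add: f g k)
  next
    show "\<one>\<^bsub>R\<^esub> \<in> carrier R" by (rule bicommutant_closed(3))
  next
    fix f assume f: "f \<in> carrier R"
    show "\<one>\<^bsub>R\<^esub> \<otimes>\<^bsub>R\<^esub> f = f"
      by (rule bicommutant_eqI[OF bicommutant_closed(1)[OF bicommutant_closed(3) f] f])
         (simp add: bicommutant_simps f)
  qed
  fix f g k assume f: "f \<in> carrier R" and g: "g \<in> carrier R" and k: "k \<in> carrier R"
  show "(f \<oplus>\<^bsub>R\<^esub> g) \<otimes>\<^bsub>R\<^esub> k = f \<otimes>\<^bsub>R\<^esub> k \<oplus>\<^bsub>R\<^esub> g \<otimes>\<^bsub>R\<^esub> k"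
    unfolding bicommutant_simps by (rule restrict_ext) (simp add: f g k)
qed

text \<open>Schur's lemma. The kernel of \<open>f\<close> is \<open>S\<close>-invariant, and if it
  had full rank, all values of \<open>f\<close> would be torsion, hence trivial. Only injectivity
  comes out, not surjectivity, so the ring becomes an integral domain rather than a field.\<close>

lemma bicommutant_injective:
  assumes f: "f \<in> carrier R" "f \<noteq> \<zero>\<^bsub>R\<^esub>" and x: "x \<in> carrier G" "f x = \<one>"
  shows "x = \<one>"
proof -
  interpret f: group_hom G G f by unfold_locales (rule bicommutant_memD(1)[OF f(1)])
  have "s ` kernel G G f \<subseteq> kernel G G f" if s: "s \<in> S" for s
  proof (rule image_subsetI)
    fix y assume "y \<in> kernel G G f"
    then have y: "y \<in> carrier G" "f y = \<one>" unfolding kernel_def by auto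
    have "f (s y) = s (f y)" by (rule bicommutant_memD(4)[OF f(1) S_centralizing[OF s] y(1)])
    then have "f (s y) = \<one>" using y cent_facts(3)[OF S_centralizing[OF s]] by simp
    then show "s y \<in> kernel G G f" unfolding kernel_def using hom_in_carrier[OF S_hom[OF s] y(1)] by simp
  qed
  from irreducible[OF f.subgroup_kernel this]
  show ?thesis
  proof
    assume "kernel G G f = {\<one>}"
    then show ?thesis using x unfolding kernel_def by auto
  next
    assume pow: "powers_in (carrier G) (kernel G G f)"
    have "f y = \<one>" if y: "y \<in> carrier G" for y
    proof -
      obtain e :: nat where e: "e > 0" "y [^] e \<in> kernel G G f" using y by (rule powers_inD[OF pow])
      then have "f y [^] e = \<one>" using f.hom_nat_pow[OF y] unfolding kernel_def by simp
      then show ?thesis using torsion_free[OF _ e(1)] y by simp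
    qed
    then have "f = \<zero>\<^bsub>R\<^esub>"
      by (intro bicommutant_eqI[OF f(1) bicommutant_closed(4)]) (simp add: bicommutant_simps)
    then show ?thesis using f(2) by simp
  qed
qed

lemma bicommutant_domain: "domain R"
proof (intro domain.intro bicommutant_cring domain_axioms.intro)
  obtain x where x: "x \<in> carrier G" "x \<noteq> \<one>" using nontrivial by (elim bexE)
  show "\<one>\<^bsub>R\<^esub> \<noteq> \<zero>\<^bsub>R\<^esub>"
  proof
    assume "\<one>\<^bsub>R\<^esub> = \<zero>\<^bsub>R\<^esub>"
    from fun_cong[OF this, of x] show False using x by (simp add: bicommutant_simps)
  qed
  fix f g assume fg: "f \<otimes>\<^bsub>R\<^esub> g = \<zero>\<^bsub>R\<^esub>" and f: "f \<in> carrier R" and g: "g \<in> carrier R"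
  show "f = \<zero>\<^bsub>R\<^esub> \<or> g = \<zero>\<^bsub>R\<^esub>"
  proof (rule ccontr)
    assume no: "\<not> (f = \<zero>\<^bsub>R\<^esub> \<or> g = \<zero>\<^bsub>R\<^esub>)"
    have "f (g x) = \<one>" using fun_cong[OF fg, of x] x by (simp add: bicommutant_simps)
    then have "g x = \<one>" using no bicommutant_injective[OF f] bicommutant_memD(3)[OF g x(1)] by simp
    then show False using no bicommutant_injective[OF g _ x(1)] x(2) by simp
  qed
qed

text \<open>\<open>poly_act\<close> lists the leading coefficient first, as the polynomials of
  \<open>HOL-Algebra\<close> do, so evaluation in the ring and action on the group agree term by
  term. Integers enter as power maps.\<close>

lemma eval_eq_poly_act:
  assumes r: "r \<in> carrier R" and x: "x \<in> carrier G"
  shows "ring.eval R (map (\<lambda>a. \<lambda>x\<in>carrier G. x [^] (a::int)) p) r x = poly_act G p r x"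
proof -
  interpret R: domain R by (rule bicommutant_domain)
  have pow: "(r [^]\<^bsub>R\<^esub> n) y = (r ^^ n) y" if "y \<in> carrier G" for n y
    using that
  proof (induction n arbitrary: y)
    case 0 then show ?case by (simp add: bicommutant_simps)
  next
    case (Suc n)
    then show ?case using bicommutant_memD(3)[OF r] by (simp add: bicommutant_simps(1) funpow_swap1)
  qed
  have rx: "(r [^]\<^bsub>R\<^esub> n) y \<in> carrier G" if "y \<in> carrier G" for n :: nat and y
    by (rule bicommutant_memD(3)[OF R.nat_pow_closed[OF r] that])
  have comm: "(r [^]\<^bsub>R\<^esub> n) x [^] (a::int) = (r ^^ n) (x [^] a)" for n a
  proof -
    have "(r [^]\<^bsub>R\<^esub> n) (x [^] a) = (r [^]\<^bsub>R\<^esub> n) x [^] a"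
      by (rule hom_int_pow[OF bicommutant_memD(1)[OF R.nat_pow_closed[OF r]] x is_group is_group])
    then show ?thesis using pow[OF int_pow_closed[OF x]] by (simp only:)
  qed
  show ?thesis
    by (induction p) (use x rx in \<open>simp_all add: bicommutant_simps comm\<close>)
qed

text \<open>If no polynomial of \<open>P\<close> vanished at \<open>s\<close>, each would act
  injectively by Schur's lemma, and so would the composite, although it kills a nontrivial element.
  Thus every such \<open>s\<close> is a root of some \<open>p\<close>, and a nonzero polynomial over
  a domain has finitely many roots. Leading coefficients stay nonzero in the ring because the group
  is torsion-free and nontrivial.\<close>

lemma finite_algebraic_elements:
  assumes P: "\<And>p. p \<in> set P \<Longrightarrow> p \<noteq> [] \<and> hd p \<noteq> 0"
  shows "finite {restrict s (carrier G) | s. s \<in> S \<and> (\<forall>x\<in>carrier G. polys_act G P s x = \<one>)}"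
proof -
  interpret R: domain R by (rule bicommutant_domain)
  define sc where "sc = (\<lambda>a::int. \<lambda>x\<in>carrier G. x [^] a)"
  obtain x0 where x0: "x0 \<in> carrier G" "x0 \<noteq> \<one>" using nontrivial by (elim bexE)
  have sc0: "sc a \<noteq> \<zero>\<^bsub>R\<^esub>" if "a \<noteq> 0" for a
  proof
    assume "sc a = \<zero>\<^bsub>R\<^esub>"
    from fun_cong[OF this, of x0] have "x0 [^] a = \<one>" using x0 by (simp add: bicommutant_simps sc_def)
    then have "x0 [^] nat \<bar>a\<bar> = \<one>"
      using x0 by (cases a) (simp_all add: int_pow_int int_pow_neg_int del: nat_pow_Suc int_pow_neg of_nat_Suc)
    then show False using torsion_free[OF x0(1), of "nat \<bar>a\<bar>"] x0 that by simp
  qed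
  have scR: "sc a \<in> carrier R" for a unfolding sc_def by (rule bicommutant_closed(6))
  have poly: "map sc p \<in> carrier (poly_ring R)" if "p \<in> set P" for p
  proof -
    have "p \<noteq> []" "hd p \<noteq> 0" using P[OF that] by auto
    then show ?thesis using sc0 scR by (auto simp: univ_poly_carrier[symmetric] polynomial_def hd_map)
  qed
  have "{restrict s (carrier G) | s. s \<in> S \<and> (\<forall>x\<in>carrier G. polys_act G P s x = \<one>)}
      \<subseteq> (\<Union>p\<in>set P. {r. R.is_root (map sc p) r})"
  proof (rule subsetI)
    fix r assume "r \<in> {restrict s (carrier G) | s. s \<in> S \<and> (\<forall>x\<in>carrier G. polys_act G P s x = \<one>)}"
    then obtain s where s: "s \<in> S" "\<forall>x\<in>carrier G. polys_act G P s x = \<one>" "r = restrict s (carrier G)" by auto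
    have rR: "r \<in> carrier R" unfolding s(3)
      by (rule restrict_bicommutantI[OF S_hom[OF s(1)]]) (use s(1) in \<open>auto simp: centralizing_homs_def\<close>)
    have sG: "s x \<in> carrier G" if "x \<in> carrier G" for x by (rule hom_in_carrier[OF S_hom[OF s(1)] that])
    have pa: "poly_act G p r x = poly_act G p s x" if "x \<in> carrier G" for p x
    proof -
      have it: "(r ^^ n) y = (s ^^ n) y \<and> (s ^^ n) y \<in> carrier G" if "y \<in> carrier G" for n y
        using that by (induction n) (auto simp: s(3) sG)
      show ?thesis by (induction p) (simp_all add: it[THEN conjunct1] that)
    qed
    have "\<exists>p\<in>set P. R.eval (map sc p) r = \<zero>\<^bsub>R\<^esub>"
    proof (rule ccontr)
      assume no: "\<not> (\<exists>p\<in>set P. R.eval (map sc p) r = \<zero>\<^bsub>R\<^esub>)"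
      have inj: "x = \<one>" if "p \<in> set P" "x \<in> carrier G" "poly_act G p s x = \<one>" for p x
      proof (rule bicommutant_injective[of "R.eval (map sc p) r"])
        show "R.eval (map sc p) r \<in> carrier R" using scR by (intro R.eval_in_carrier rR) auto
        show "R.eval (map sc p) r \<noteq> \<zero>\<^bsub>R\<^esub>" using no that by auto
        show "R.eval (map sc p) r x = \<one>" using that pa eval_eq_poly_act[OF rR that(2), of p] by (simp add: sc_def)
      qed (rule that(2))
      have "polys_act G L s x0 \<noteq> \<one>" if "set L \<subseteq> set P" for L
        using that
      proof (induction L)
        case (Cons p L)
        then show ?case
          using inj[of p "polys_act G L s x0"] hom_in_carrier[OF polys_act_hom[OF S_hom[OF s(1)]] x0(1)] by auto
      qed (simp add: x0)
      then show False using s(2) x0(1) by auto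
    qed
    then obtain p where p: "p \<in> set P" "R.eval (map sc p) r = \<zero>\<^bsub>R\<^esub>" by (elim bexE)
    then have "R.is_root (map sc p) r" unfolding R.is_root_def using rR P[OF p(1)] by simp
    then show "r \<in> (\<Union>p\<in>set P. {r. R.is_root (map sc p) r})" using p(1) by auto
  qed
  moreover have "finite (\<Union>p\<in>set P. {r. R.is_root (map sc p) r})"
    using R.finite_number_of_roots[OF poly] by (intro finite_UN_I) auto
  ultimately show ?thesis by (rule finite_subset)
qed

end

section \<open>Abelian sections and finiteness of fixed points\<close>

definition (in group) normalizes :: "'a set \<Rightarrow> 'a set \<Rightarrow> bool" where
  "normalizes K M \<longleftrightarrow> (\<forall>k\<in>K. \<forall>x\<in>M. k \<otimes> x \<otimes> inv k \<in> M)"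

locale abelian_section = group G for G (structure) +
  fixes M L :: "'a set"
  assumes M: "subgroup M G" and L: "subgroup L G" and LM: "L \<subseteq> M"
    and comm: "\<lbrakk>x \<in> M; y \<in> M\<rbrakk> \<Longrightarrow> x \<otimes> y \<otimes> inv x \<otimes> inv y \<in> L"
begin

lemma Mc: "x \<in> M \<Longrightarrow> x \<in> carrier G" by (rule subgroup.mem_carrier[OF M])

lemma Lc: "x \<in> L \<Longrightarrow> x \<in> carrier G" by (rule subgroup.mem_carrier[OF L])

lemma normalizes_M_L: "normalizes M L"
  unfolding normalizes_def
proof (intro ballI)
  fix x z assume xz: "x \<in> M" "z \<in> L"
  have "x \<otimes> z \<otimes> inv x \<otimes> inv z \<otimes> z \<in> L"
    using comm[of x z] xz LM by (intro subgroup.m_closed[OF L, of _ z]) auto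
  then show "x \<otimes> z \<otimes> inv x \<in> L" using Mc[OF xz(1)] Lc[OF xz(2)] by (simp add: m_assoc)
qed

lemma M_group: "group (G\<lparr>carrier := M\<rparr>)" by (rule subgroup_imp_group[OF M])

lemma L_normal: "L \<lhd> G\<lparr>carrier := M\<rparr>"
proof -
  interpret H: group "G\<lparr>carrier := M\<rparr>" by (rule M_group)
  show ?thesis
    unfolding H.normal_inv_iff
    using subgroup_incl[OF L M LM] normalizes_M_L M unfolding normalizes_def by auto
qed

definition Q :: "'a set monoid" where "Q = G\<lparr>carrier := M\<rparr> Mod L"

definition proj :: "'a \<Rightarrow> 'a set" where "proj x = L #> x"

lemma Q_comm_group: "comm_group Q"
proof -
  interpret N: normal L "G\<lparr>carrier := M\<rparr>" by (rule L_normal)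
  interpret Q: group Q unfolding Q_def by (rule N.factorgroup_is_group)
  show ?thesis
  proof (rule Q.group_comm_groupI)
    fix U V assume "U \<in> carrier Q" "V \<in> carrier Q"
    then obtain x y where x: "x \<in> M" "y \<in> M" "U = L #> x" "V = L #> y"
      unfolding Q_def carrier_FactGroup by auto
    have "(x \<otimes> y) \<otimes> inv (y \<otimes> x) \<in> L" using comm[OF x(1,2)] x Mc by (simp add: group_word_simps)
    then have "x \<otimes> y \<in> L #> (y \<otimes> x)" using mem_r_coset_iff[OF L, of "x \<otimes> y" "y \<otimes> x"] x Mc by simp
    then have "L #> (y \<otimes> x) = L #> (x \<otimes> y)" by (rule repr_independence) (use x Mc L in auto)
    then show "U \<otimes>\<^bsub>Q\<^esub> V = V \<otimes>\<^bsub>Q\<^esub> U"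
      using N.rcos_sum[of x y] N.rcos_sum[of y x] x unfolding Q_def by simp
  qed
qed

sublocale Q: comm_group Q by (rule Q_comm_group)

lemma proj_hom: "proj \<in> hom (G\<lparr>carrier := M\<rparr>) Q"
proof -
  interpret N: normal L "G\<lparr>carrier := M\<rparr>" by (rule L_normal)
  show ?thesis using N.r_coset_hom_Mod unfolding Q_def proj_def by simp
qed

lemma proj_closed [simp]: "x \<in> M \<Longrightarrow> proj x \<in> carrier Q"
  using hom_in_carrier[OF proj_hom, of x] by simp

lemma carrier_Q: "carrier Q = proj ` M"
  unfolding Q_def carrier_FactGroup proj_def by auto

lemma proj_mult: "\<lbrakk>x \<in> M; y \<in> M\<rbrakk> \<Longrightarrow> proj (x \<otimes> y) = proj x \<otimes>\<^bsub>Q\<^esub> proj y"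
  using hom_mult[OF proj_hom, of x y] by simp

lemma proj_one: "proj \<one> = \<one>\<^bsub>Q\<^esub>"
  using hom_one[OF proj_hom M_group Q.is_group] by simp

lemma proj_inv: "x \<in> M \<Longrightarrow> proj (inv x) = inv\<^bsub>Q\<^esub> (proj x)"
proof -
  interpret p: group_hom "G\<lparr>carrier := M\<rparr>" Q proj
    using M_group proj_hom by (simp add: group_hom_def group_hom_axioms_def)
  assume "x \<in> M" then show ?thesis using p.hom_inv[of x] M by simp
qed

lemma proj_nat_pow: "x \<in> M \<Longrightarrow> proj (x [^] (e::nat)) = proj x [^]\<^bsub>Q\<^esub> e"
  using hom_nat_pow[OF proj_hom _ M_group Q.is_group, of x e] nat_pow_consistent[of x e M] by simp

lemma proj_eq_iff: "\<lbrakk>x \<in> M; y \<in> M\<rbrakk> \<Longrightarrow> proj x = proj y \<longleftrightarrow> x \<otimes> inv y \<in> L"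
proof -
  assume x: "x \<in> M" "y \<in> M"
  have "proj x = proj y" if "x \<otimes> inv y \<in> L"
  proof -
    have "x \<in> L #> y" using mem_r_coset_iff[OF L, of x y] that x Mc by simp
    then show ?thesis unfolding proj_def by (rule repr_independence[symmetric]) (use x Mc L in auto)
  qed
  moreover have "x \<otimes> inv y \<in> L" if "proj x = proj y"
    using rcos_self[OF Mc[OF x(1)] L] that mem_r_coset_iff[OF L, of x y] x Mc unfolding proj_def by simp
  ultimately show ?thesis by blast
qed

lemma proj_eq_one_iff: "x \<in> M \<Longrightarrow> proj x = \<one>\<^bsub>Q\<^esub> \<longleftrightarrow> x \<in> L"
  using proj_eq_iff[of x \<one>] subgroup.one_closed[OF M] Mc by (simp add: proj_one)

lemma subgroup_vimage:
  assumes "subgroup U Q" shows "subgroup {x \<in> M. proj x \<in> U} G"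
proof (rule subgroupI)
  have "\<one> \<in> {x \<in> M. proj x \<in> U}"
    using subgroup.one_closed[OF M] subgroup.one_closed[OF assms] by (simp add: proj_one)
  then show "{x \<in> M. proj x \<in> U} \<noteq> {}" by auto
qed (use Mc in \<open>auto simp: proj_inv proj_mult subgroup.m_inv_closed[OF M] subgroup.m_inv_closed[OF assms]
      subgroup.m_closed[OF M] subgroup.m_closed[OF assms]\<close>)

lemma power_rank_Q:
  assumes h: "power_rank_on (carrier G) h"
  shows "Q.power_rank_on (carrier Q) (\<lambda>U. h {x \<in> M. proj x \<in> U})"
  unfolding Q.power_rank_on_def
proof (intro allI impI)
  fix U V assume U: "subgroup U Q" and V: "subgroup V Q" and VU: "V \<subseteq> U" "U \<subseteq> carrier Q"
  let ?U = "{x \<in> M. proj x \<in> U}" and ?V = "{x \<in> M. proj x \<in> V}"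
  have "h ?V \<le> h ?U \<and> (h ?V = h ?U \<longrightarrow> powers_in ?U ?V)"
    using h subgroup_vimage[OF U] subgroup_vimage[OF V] VU(1) subgroup.subset[OF subgroup_vimage[OF U]]
    unfolding power_rank_on_def by auto
  moreover have "Q.powers_in U V" if pow: "powers_in ?U ?V"
    unfolding Q.powers_in_def
  proof
    fix u assume u: "u \<in> U"
    then obtain x where x: "x \<in> M" "u = proj x" using VU(2) carrier_Q by auto
    then have "x \<in> ?U" using u by simp
    then obtain e :: nat where "e > 0" "x [^] e \<in> ?V" by (rule powers_inD[OF pow])
    then show "\<exists>e::nat. e > 0 \<and> u [^]\<^bsub>Q\<^esub> e \<in> V" using x proj_nat_pow[OF x(1)] by auto
  qed
  ultimately show "h ?V \<le> h ?U \<and> (h ?V = h ?U \<longrightarrow> Q.powers_in U V)" by blast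
qed

text \<open>Extensional on \<open>carrier Q\<close>, so that elements acting alike on
  \<open>M / L\<close> induce equal functions; only then can actions be counted.\<close>

definition induced :: "('a \<Rightarrow> 'a) \<Rightarrow> 'a set \<Rightarrow> 'a set" where
  "induced f = (\<lambda>U\<in>carrier Q. proj (f (SOME x. x \<in> M \<and> proj x = U)))"

text \<open>Multiplicativity is asked only modulo \<open>L\<close>, since the displacement
  \<open>x \<mapsto> inv x \<otimes> \<psi> x\<close> need not be a homomorphism on \<open>M\<close>
  itself.\<close>

lemma induced_proj:
  assumes fM: "\<And>x. x \<in> M \<Longrightarrow> f x \<in> M"
    and fmult: "\<And>x y. \<lbrakk>x \<in> M; y \<in> M\<rbrakk> \<Longrightarrow> proj (f (x \<otimes> y)) = proj (f x) \<otimes>\<^bsub>Q\<^esub> proj (f y)"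
    and fL: "\<And>x. x \<in> L \<Longrightarrow> f x \<in> L"
  shows "x \<in> M \<Longrightarrow> induced f (proj x) = proj (f x)" and "induced f \<in> hom Q Q"
proof -
  have ip: "induced f (proj x) = proj (f x)" if x: "x \<in> M" for x
  proof -
    define y where "y = (SOME y. y \<in> M \<and> proj y = proj x)"
    have y: "y \<in> M" "proj y = proj x" unfolding y_def using someI[of "\<lambda>y. y \<in> M \<and> proj y = proj x" x] x by auto
    have l: "y \<otimes> inv x \<in> L" using y x proj_eq_iff by simp
    have "proj (f ((y \<otimes> inv x) \<otimes> x)) = proj (f (y \<otimes> inv x)) \<otimes>\<^bsub>Q\<^esub> proj (f x)"
      using l x LM by (intro fmult) auto
    moreover have "proj (f (y \<otimes> inv x)) = \<one>\<^bsub>Q\<^esub>"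
      using fL[OF l] LM proj_eq_one_iff[of "f (y \<otimes> inv x)"] by auto
    moreover have "(y \<otimes> inv x) \<otimes> x = y" using x y Mc by (simp add: m_assoc)
    ultimately have "proj (f y) = proj (f x)" using fM x by simp
    then show ?thesis unfolding induced_def y_def using x by simp
  qed
  show "x \<in> M \<Longrightarrow> induced f (proj x) = proj (f x)" by (rule ip)
  show "induced f \<in> hom Q Q"
  proof (rule homI)
    fix u assume "u \<in> carrier Q"
    then obtain x where x: "x \<in> M" "u = proj x" using carrier_Q by auto
    then show "induced f u \<in> carrier Q" using ip fM by simp
    fix v assume "v \<in> carrier Q"
    then obtain y where y: "y \<in> M" "v = proj y" using carrier_Q by auto
    show "induced f (u \<otimes>\<^bsub>Q\<^esub> v) = induced f u \<otimes>\<^bsub>Q\<^esub> induced f v"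
      using x y fmult[of x y] ip[of "x \<otimes> y"] ip subgroup.m_closed[OF M] by (simp add: proj_mult)
  qed
qed

text \<open>Modulo \<open>L\<close> the displacement is an endomorphism of an abelian group. Its
  kernel is torsion by \<open>ker\<close>, so its image has full rank.\<close>

lemma power_displacement:
  assumes h: "power_rank_on (carrier G) h" and \<psi>: "\<psi> \<in> hom G G"
    and \<psi>M: "\<psi> ` M \<subseteq> M" and \<psi>L: "\<psi> ` L \<subseteq> L"
    and ker: "\<And>a. \<lbrakk>a \<in> M; inv a \<otimes> \<psi> a \<in> L\<rbrakk> \<Longrightarrow> \<exists>e::nat. e > 0 \<and> a [^] e \<in> L"
    and a: "a \<in> M"
  shows "\<exists>e::nat. e > 0 \<and> (\<exists>b\<in>M. proj (a [^] e) = proj (inv b \<otimes> \<psi> b))"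
proof -
  define f where "f x = inv x \<otimes> \<psi> x" for x
  have \<psi>m: "\<psi> x \<in> M" if "x \<in> M" for x using that \<psi>M by auto
  have fM: "f x \<in> M" if "x \<in> M" for x
    unfolding f_def using that \<psi>m by (intro subgroup.m_closed[OF M] subgroup.m_inv_closed[OF M])
  have pf: "proj (f x) = inv\<^bsub>Q\<^esub> (proj x) \<otimes>\<^bsub>Q\<^esub> proj (\<psi> x)" if "x \<in> M" for x
    unfolding f_def using that \<psi>m by (simp add: proj_mult proj_inv subgroup.m_inv_closed[OF M])
  have fmult: "proj (f (x \<otimes> y)) = proj (f x) \<otimes>\<^bsub>Q\<^esub> proj (f y)" if "x \<in> M" "y \<in> M" for x y
    using that \<psi>m Mc subgroup.m_closed[OF M]
    by (simp add: pf hom_mult[OF \<psi>] proj_mult Q.inv_mult Q.m_ac)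
  have fL: "f x \<in> L" if "x \<in> L" for x
    unfolding f_def using that \<psi>L by (intro subgroup.m_closed[OF L] subgroup.m_inv_closed[OF L]) auto
  have ind: "induced f (proj x) = proj (f x)" if "x \<in> M" for x
    using induced_proj(1)[of f x] fM fmult fL that by blast
  have ind_hom: "induced f \<in> hom Q Q" using induced_proj(2)[of f] fM fmult fL by blast
  have "Q.powers_in (carrier Q) (induced f ` carrier Q)"
  proof (rule Q.powers_in_image_torsion_kernel[OF power_rank_Q[OF h] ind_hom])
    fix u assume u: "u \<in> carrier Q" "induced f u = \<one>\<^bsub>Q\<^esub>"
    then obtain x where x: "x \<in> M" "u = proj x" using carrier_Q by auto
    have "f x \<in> L" using u x ind[OF x(1)] proj_eq_one_iff[OF fM] by simp
    then obtain e :: nat where "e > 0" "x [^] e \<in> L" using ker[OF x(1)] unfolding f_def by blast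
    then show "\<exists>e::nat. e > 0 \<and> u [^]\<^bsub>Q\<^esub> e = \<one>\<^bsub>Q\<^esub>"
      using x proj_nat_pow[OF x(1)] proj_eq_one_iff[OF subgroup_nat_pow_closed[OF M x(1)]] by auto
  qed
  then obtain e :: nat where e: "e > 0" "proj a [^]\<^bsub>Q\<^esub> e \<in> induced f ` carrier Q"
    by (rule Q.powers_inD[OF _ proj_closed[OF a]])
  then obtain b where "b \<in> M" "proj a [^]\<^bsub>Q\<^esub> e = proj (f b)" using ind carrier_Q by auto
  then show ?thesis using e(1) proj_nat_pow[OF a] unfolding f_def by auto
qed

end

section \<open>Fixed points modulo a subgroup\<close>

context group
begin

text \<open>The preimage in \<open>K\<close> of the fixed points of \<open>\<psi>\<close> on
  \<open>K / L\<close>; finiteness of these is expressed by covering this set with finitely many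
  cosets of \<open>L\<close>.\<close>

definition fixed_mod :: "'a set \<Rightarrow> ('a \<Rightarrow> 'a) \<Rightarrow> 'a set \<Rightarrow> 'a set" where
  "fixed_mod K \<psi> L = {g \<in> K. inv g \<otimes> \<psi> g \<in> L}"

lemma subgroup_fixed_mod:
  assumes K: "subgroup K G" and L: "subgroup L G" and n: "normalizes K L"
    and \<psi>: "\<psi> \<in> hom G G" and \<psi>K: "\<psi> ` K \<subseteq> K"
  shows "subgroup (fixed_mod K \<psi> L) G"
proof -
  interpret p: group_hom G G \<psi> by unfold_locales (rule \<psi>)
  have Kc: "x \<in> carrier G" if "x \<in> K" for x by (rule subgroup.mem_carrier[OF K that])
  show ?thesis
  proof (rule subgroupI)
    show "fixed_mod K \<psi> L \<subseteq> carrier G" unfolding fixed_mod_def using Kc by auto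
    have "\<one> \<in> fixed_mod K \<psi> L" unfolding fixed_mod_def
      using subgroup.one_closed[OF K] subgroup.one_closed[OF L] by simp
    then show "fixed_mod K \<psi> L \<noteq> {}" by auto
    fix g assume g: "g \<in> fixed_mod K \<psi> L"
    then have gK: "g \<in> K" "inv g \<otimes> \<psi> g \<in> L" unfolding fixed_mod_def by auto
    have "g \<otimes> inv (inv g \<otimes> \<psi> g) \<otimes> inv g \<in> L"
      using n gK subgroup.m_inv_closed[OF L gK(2)] unfolding normalizes_def by simp
    moreover have "g \<otimes> inv (inv g \<otimes> \<psi> g) \<otimes> inv g = inv (inv g) \<otimes> \<psi> (inv g)"
      using Kc[OF gK(1)] by (simp add: group_word_simps)
    ultimately show "inv g \<in> fixed_mod K \<psi> L"
      unfolding fixed_mod_def using subgroup.m_inv_closed[OF K gK(1)] by simp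
    fix k assume k: "k \<in> fixed_mod K \<psi> L"
    then have kK: "k \<in> K" "inv k \<otimes> \<psi> k \<in> L" unfolding fixed_mod_def by auto
    have "inv k \<otimes> (inv g \<otimes> \<psi> g) \<otimes> inv (inv k) \<in> L"
      using n gK subgroup.m_inv_closed[OF K kK(1)] unfolding normalizes_def by blast
    then have "inv k \<otimes> (inv g \<otimes> \<psi> g) \<otimes> inv (inv k) \<otimes> (inv k \<otimes> \<psi> k) \<in> L"
      by (rule subgroup.m_closed[OF L _ kK(2)])
    moreover have "inv k \<otimes> (inv g \<otimes> \<psi> g) \<otimes> inv (inv k) \<otimes> (inv k \<otimes> \<psi> k) = inv (g \<otimes> k) \<otimes> \<psi> (g \<otimes> k)"
      using Kc[OF gK(1)] Kc[OF kK(1)] by (simp add: group_word_simps)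
    ultimately show "g \<otimes> k \<in> fixed_mod K \<psi> L"
      unfolding fixed_mod_def using subgroup.m_closed[OF K gK(1) kK(1)] by simp
  qed
qed

end

text \<open>Passing from \<open>L\<close> to \<open>M\<close> keeps the fixed points finite, since on the abelian section the displacement
  \<open>a \<mapsto> a\<inverse> \<psi>(a)\<close> has finite kernel and therefore an image of finite index.\<close>

lemma (in abelian_section) finite_fixed_mod_step:
  assumes h: "power_rank_on (carrier G) h" and pc: "power_covered_on (carrier G)"
    and K: "subgroup K G" and MK: "M \<subseteq> K" and nM: "normalizes K M" and nL: "normalizes K L"
    and \<psi>: "\<psi> \<in> hom G G" and \<psi>K: "\<psi> ` K \<subseteq> K" and \<psi>M: "\<psi> ` M \<subseteq> M" and \<psi>L: "\<psi> ` L \<subseteq> L"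
    and fin: "finite_cover (fixed_mod K \<psi> L) L"
  shows "finite_cover (fixed_mod K \<psi> M) M"
    and "\<And>a. a \<in> M \<Longrightarrow> \<exists>e::nat. e > 0 \<and> (\<exists>b\<in>M. proj (a [^] e) = proj (inv b \<otimes> \<psi> b))"
proof -
  interpret p: group_hom G G \<psi> by unfold_locales (rule \<psi>)
  have Kc: "x \<in> carrier G" if "x \<in> K" for x by (rule subgroup.mem_carrier[OF K that])
  have \<psi>m: "\<psi> x \<in> M" if "x \<in> M" for x using that \<psi>M by auto
  have \<psi>k: "\<psi> x \<in> K" if "x \<in> K" for x using that \<psi>K by auto
  have subF: "subgroup (fixed_mod K \<psi> L) G" by (rule subgroup_fixed_mod[OF K L nL \<psi> \<psi>K])
  have LF: "powers_in (fixed_mod K \<psi> L) L"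
    by (rule finite_cover_imp_powers_in[OF L subF fin])
  have ker: "\<exists>e::nat. e > 0 \<and> a [^] e \<in> L" if "a \<in> M" "inv a \<otimes> \<psi> a \<in> L" for a
  proof -
    have "a \<in> fixed_mod K \<psi> L" unfolding fixed_mod_def using that MK by auto
    then show ?thesis using LF unfolding powers_in_def by auto
  qed
  have disp: "\<exists>e::nat. e > 0 \<and> (\<exists>b\<in>M. proj (a [^] e) = proj (inv b \<otimes> \<psi> b))" if "a \<in> M" for a
    by (rule power_displacement[OF h \<psi> \<psi>M \<psi>L ker that])
  then show "\<And>a. a \<in> M \<Longrightarrow> \<exists>e::nat. e > 0 \<and> (\<exists>b\<in>M. proj (a [^] e) = proj (inv b \<otimes> \<psi> b))" .
  have dM: "inv b \<otimes> \<psi> b \<in> M" if "b \<in> M" for b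
    using that \<psi>m by (intro subgroup.m_closed[OF M] subgroup.m_inv_closed[OF M])
  have pd: "proj (inv b \<otimes> \<psi> b) = inv\<^bsub>Q\<^esub> (proj b) \<otimes>\<^bsub>Q\<^esub> proj (\<psi> b)" if "b \<in> M" for b
    using that \<psi>m by (simp add: proj_mult proj_inv subgroup.m_inv_closed[OF M])
  define I where "I = {x \<in> M. \<exists>b\<in>M. proj x = proj (inv b \<otimes> \<psi> b)}"
  have I: "subgroup I G"
  proof (rule subgroupI)
    show "I \<subseteq> carrier G" unfolding I_def using Mc by auto
    have "\<one> \<in> I" unfolding I_def using subgroup.one_closed[OF M] by (auto intro!: bexI[of _ \<one>])
    then show "I \<noteq> {}" by auto
    fix x assume "x \<in> I"
    then obtain b where b: "x \<in> M" "b \<in> M" "proj x = proj (inv b \<otimes> \<psi> b)" unfolding I_def by auto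
    have ib: "inv b \<in> M" by (rule subgroup.m_inv_closed[OF M b(2)])
    have "proj (inv x) = proj (inv (inv b) \<otimes> \<psi> (inv b))"
      unfolding pd[OF ib] using b ib \<psi>m Mc by (simp add: proj_inv pd Q.inv_mult)
    then show "inv x \<in> I" unfolding I_def using ib subgroup.m_inv_closed[OF M b(1)] by auto
    fix y assume "y \<in> I"
    then obtain c where c: "y \<in> M" "c \<in> M" "proj y = proj (inv c \<otimes> \<psi> c)" unfolding I_def by auto
    have bc: "b \<otimes> c \<in> M" by (rule subgroup.m_closed[OF M b(2) c(2)])
    have "proj (x \<otimes> y) = proj (inv (b \<otimes> c) \<otimes> \<psi> (b \<otimes> c))"
      unfolding pd[OF bc] using b c \<psi>m Mc by (simp add: proj_mult pd Q.inv_mult Q.m_ac)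
    then show "x \<otimes> y \<in> I" unfolding I_def using bc subgroup.m_closed[OF M b(1) c(1)] by auto
  qed
  have "powers_in M I" unfolding powers_in_def
  proof
    fix a assume a: "a \<in> M"
    then obtain e :: nat and b where "e > 0" "b \<in> M" "proj (a [^] e) = proj (inv b \<otimes> \<psi> b)" using disp by blast
    then show "\<exists>e::nat. e > 0 \<and> a [^] e \<in> I" unfolding I_def using subgroup_nat_pow_closed[OF M a] by auto
  qed
  moreover have IM: "I \<subseteq> M" unfolding I_def by auto
  ultimately have "finite_cover M I"
    using pc M I subgroup.subset[OF M] unfolding power_covered_on_def by blast
  then obtain T where T: "finite T" "T \<subseteq> carrier G" "\<And>x. x \<in> M \<Longrightarrow> \<exists>t\<in>T. x \<otimes> inv t \<in> I"
    by (rule finite_coverE[OF _ subgroup.subset[OF M] I]) blast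
  obtain S where S: "finite S" "S \<subseteq> carrier G" "\<And>x. x \<in> fixed_mod K \<psi> L \<Longrightarrow> \<exists>t\<in>S. x \<otimes> inv t \<in> L"
    by (rule finite_coverE[OF fin subgroup.subset[OF subF] L]) blast
  define v where "v g = inv g \<otimes> \<psi> g" for g
  \<comment> \<open>For each coset of \<open>I\<close> met by a displacement, \<open>c t\<close> is
    one element with such a displacement. Together with the finitely many \<open>s\<close> in
    \<open>S\<close> representing what is fixed modulo \<open>L\<close>, these will represent
    everything fixed modulo \<open>M\<close>.\<close>
  define T' where "T' = {t \<in> T. \<exists>g\<in>fixed_mod K \<psi> M. v g \<otimes> inv t \<in> I}"
  have "\<exists>c. \<forall>t\<in>T'. c t \<in> fixed_mod K \<psi> M \<and> v (c t) \<otimes> inv t \<in> I"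
    by (rule bchoice) (auto simp: T'_def)
  then obtain c where c: "\<forall>t\<in>T'. c t \<in> fixed_mod K \<psi> M \<and> v (c t) \<otimes> inv t \<in> I" by (rule exE)
  have FM: "g \<in> K \<and> v g \<in> M \<and> g \<in> carrier G \<and> v g \<in> carrier G" if "g \<in> fixed_mod K \<psi> M" for g
    using that Kc Mc unfolding fixed_mod_def v_def by auto
  show "finite_cover (fixed_mod K \<psi> M) M"
  proof (rule finite_coverI[of "(\<lambda>(s,t). s \<otimes> c t) ` (S \<times> T')"])
    show "finite ((\<lambda>(s,t). s \<otimes> c t) ` (S \<times> T'))" using S(1) T(1) unfolding T'_def by simp
    show "(\<lambda>(s,t). s \<otimes> c t) ` (S \<times> T') \<subseteq> carrier G" using S(2) c FM by auto
    show "fixed_mod K \<psi> M \<subseteq> carrier G" using FM by auto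
    show "subgroup M G" by (rule M)
    fix k assume k: "k \<in> fixed_mod K \<psi> M"
    then have kM: "k \<in> K" "v k \<in> M" "k \<in> carrier G" "v k \<in> carrier G" using FM by auto
    obtain t where t: "t \<in> T" "v k \<otimes> inv t \<in> I" using T(3)[OF kM(2)] by auto
    then have tT': "t \<in> T'" unfolding T'_def using k by auto
    define g where "g = c t"
    have g: "g \<in> fixed_mod K \<psi> M" "v g \<otimes> inv t \<in> I" using c tT' unfolding g_def by auto
    then have gM: "g \<in> K" "v g \<in> M" "g \<in> carrier G" "v g \<in> carrier G" using FM by auto
    have tc: "t \<in> carrier G" using t T by auto
    have "(v k \<otimes> inv t) \<otimes> inv (v g \<otimes> inv t) \<in> I"
      by (rule subgroup.m_closed[OF I t(2) subgroup.m_inv_closed[OF I g(2)]])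
    moreover have "(v k \<otimes> inv t) \<otimes> inv (v g \<otimes> inv t) = v k \<otimes> inv (v g)"
      using kM gM tc by (simp add: group_word_simps)
    ultimately obtain a where a: "a \<in> M" "proj (v k \<otimes> inv (v g)) = proj (inv a \<otimes> \<psi> a)" unfolding I_def by auto
    have ac: "a \<in> carrier G" "a \<in> K" using a Mc MK by auto
    \<comment> \<open>Right multiplication by \<open>a\<close> moves the displacement of
      \<open>g\<close> to that of \<open>k\<close> modulo \<open>L\<close>. Hence
      \<open>k \<otimes> inv d\<close> is fixed modulo \<open>L\<close> and agrees with some
      \<open>s\<close> up to \<open>L\<close>.\<close>
    define d where "d = g \<otimes> a"
    have dc: "d \<in> carrier G" "d \<in> K" unfolding d_def using gM ac subgroup.m_closed[OF K] by auto
    have vd: "v d = inv a \<otimes> v g \<otimes> \<psi> a" unfolding v_def d_def using gM ac by (simp add: group_word_simps)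
    have "proj (v d) = inv\<^bsub>Q\<^esub> (proj a) \<otimes>\<^bsub>Q\<^esub> proj (v g) \<otimes>\<^bsub>Q\<^esub> proj (\<psi> a)"
      unfolding vd using a gM \<psi>m by (simp add: proj_mult proj_inv subgroup.m_inv_closed[OF M] subgroup.m_closed[OF M])
    also have "\<dots> = proj (v k \<otimes> inv (v g)) \<otimes>\<^bsub>Q\<^esub> proj (v g)"
      unfolding a(2) pd[OF a(1)] using a gM \<psi>m by (simp add: Q.m_ac)
    also have "\<dots> = proj (v k)"
      using kM gM by (simp add: proj_mult proj_inv subgroup.m_inv_closed[OF M] Q.m_assoc)
    finally have "proj (v k) = proj (v d)" by simp
    moreover have vdM: "v d \<in> M" unfolding vd using a gM \<psi>m
      by (intro subgroup.m_closed[OF M] subgroup.m_inv_closed[OF M])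
    ultimately have l: "v k \<otimes> inv (v d) \<in> L" using proj_eq_iff kM by simp
    define w where "w = k \<otimes> inv d"
    have wK: "w \<in> K" unfolding w_def using kM dc by (intro subgroup.m_closed[OF K] subgroup.m_inv_closed[OF K])
    have "d \<otimes> (v k \<otimes> inv (v d)) \<otimes> inv d \<in> L" using nL dc l unfolding normalizes_def by blast
    moreover have "d \<otimes> (v k \<otimes> inv (v d)) \<otimes> inv d = inv w \<otimes> \<psi> w"
      unfolding w_def v_def using kM dc by (simp add: group_word_simps)
    ultimately have "w \<in> fixed_mod K \<psi> L" unfolding fixed_mod_def using wK by simp
    then obtain s where s: "s \<in> S" "w \<otimes> inv s \<in> L" using S(3) by auto
    have sc: "s \<in> carrier G" using s S by auto
    have wc: "w \<in> carrier G" using wK Kc by simp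
    have "w \<otimes> inv s \<in> K" using s(2) LM MK by auto
    then have "inv (w \<otimes> inv s) \<otimes> w \<in> K"
      by (rule subgroup.m_closed[OF K subgroup.m_inv_closed[OF K] wK])
    then have sK: "s \<in> K" using sc wc by (simp add: group_word_simps)
    have "s \<otimes> (g \<otimes> a \<otimes> inv g) \<otimes> inv s \<in> M" using nM sK gM a unfolding normalizes_def by blast
    then have "(w \<otimes> inv s) \<otimes> (s \<otimes> (g \<otimes> a \<otimes> inv g) \<otimes> inv s) \<in> M"
      by (rule subgroup.m_closed[OF M subsetD[OF LM s(2)]])
    moreover have "(w \<otimes> inv s) \<otimes> (s \<otimes> (g \<otimes> a \<otimes> inv g) \<otimes> inv s) = k \<otimes> inv (s \<otimes> g)"
      unfolding w_def d_def using sc gM ac kM by (simp add: group_word_simps)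
    ultimately show "\<exists>z\<in>(\<lambda>(s,t). s \<otimes> c t) ` (S \<times> T'). k \<otimes> inv z \<in> M"
      using s(1) tT' unfolding g_def by force
  qed
qed

section \<open>Lower central series\<close>

context group
begin

definition conjugate :: "'a \<Rightarrow> 'a \<Rightarrow> 'a" where
  "conjugate a x = a \<otimes> x \<otimes> inv a"

lemma conjugate_hom: "a \<in> carrier G \<Longrightarrow> conjugate a \<in> hom G G"
  by (rule homI) (simp_all add: conjugate_def group_word_simps)

lemma conjugate_mult:
  "\<lbrakk>a \<in> carrier G; b \<in> carrier G; x \<in> carrier G\<rbrakk> \<Longrightarrow> conjugate (a \<otimes> b) x = conjugate a (conjugate b x)"
  by (simp add: conjugate_def group_word_simps)

lemma conjugate_inv_cancel:
  assumes "a \<in> carrier G" "x \<in> carrier G"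
  shows "conjugate a (conjugate (inv a) x) = x" "conjugate (inv a) (conjugate a x) = x"
  using assms by (simp_all add: conjugate_def group_word_simps)

lemma normalizes_iff: "normalizes K M \<longleftrightarrow> (\<forall>k\<in>K. \<forall>x\<in>M. conjugate k x \<in> M)"
  unfolding normalizes_def conjugate_def by simp

abbreviation lcs :: "'a set \<Rightarrow> nat \<Rightarrow> 'a set" where
  "lcs N \<equiv> lower_central_series (G\<lparr>carrier := N\<rparr>)"

text \<open>One induction for all three facts: inverses of the restricted group are known to agree
  with those of \<open>G\<close> only on \<open>N\<close>, so the recursion can be moved to
  \<open>G\<close> only once the terms are known to lie in \<open>N\<close>.\<close>

lemma lcs_basic:
  assumes N: "subgroup N G"
  shows "subgroup (lcs N i) G \<and> lcs N i \<subseteq> N \<and>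
    lcs N (Suc i) = generate G (\<Union>x\<in>N. \<Union>y\<in>lcs N i. {x \<otimes> y \<otimes> inv x \<otimes> inv y})"
proof (induction i)
  have gen: "lcs N (Suc i) = generate G (\<Union>x\<in>N. \<Union>y\<in>lcs N i. {x \<otimes> y \<otimes> inv x \<otimes> inv y}) \<and> lcs N (Suc i) \<subseteq> N"
    if sub: "lcs N i \<subseteq> N" for i
  proof -
    let ?S = "\<Union>x\<in>N. \<Union>y\<in>lcs N i. {x \<otimes> y \<otimes> inv x \<otimes> inv y}"
    have S: "?S \<subseteq> N"
      using sub by (auto intro!: subgroup.m_closed[OF N] subgroup.m_inv_closed[OF N])
    have "(\<Union>x\<in>N. \<Union>y\<in>lcs N i. {x \<otimes> y \<otimes> inv\<^bsub>G\<lparr>carrier := N\<rparr>\<^esub> x \<otimes> inv\<^bsub>G\<lparr>carrier := N\<rparr>\<^esub> y}) = ?S"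
    proof (intro SUP_cong refl)
      fix x y assume "x \<in> N" "y \<in> lcs N i"
      then show "{x \<otimes> y \<otimes> inv\<^bsub>G\<lparr>carrier := N\<rparr>\<^esub> x \<otimes> inv\<^bsub>G\<lparr>carrier := N\<rparr>\<^esub> y} = {x \<otimes> y \<otimes> inv x \<otimes> inv y}"
        using m_inv_consistent[OF N, of x] m_inv_consistent[OF N, of y] sub by auto
    qed
    then have "lcs N (Suc i) = generate (G\<lparr>carrier := N\<rparr>) ?S" by simp
    also have "\<dots> = generate G ?S" by (rule generate_consistent[OF S N])
    finally show ?thesis using generate_subgroup_incl[OF S N] by simp
  qed
  case 0
  show ?case using gen[of 0] N by simp
  case (Suc i)
  then have "lcs N (Suc i) \<subseteq> N" using gen[of i] by simp
  moreover have "subgroup (lcs N (Suc i)) G"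
  proof -
    have "(\<Union>x\<in>N. \<Union>y\<in>lcs N i. {x \<otimes> y \<otimes> inv x \<otimes> inv y}) \<subseteq> carrier G"
    proof (intro UN_least)
      fix x y assume "x \<in> N" "y \<in> lcs N i"
      then have "x \<in> carrier G" "y \<in> carrier G" using subgroup.subset[OF N] Suc by auto
      then show "{x \<otimes> y \<otimes> inv x \<otimes> inv y} \<subseteq> carrier G" by simp
    qed
    then show ?thesis using generate_is_subgroup Suc by simp
  qed
  ultimately show ?case using gen[of "Suc i"] by simp
qed

lemma subgroup_lcs: "subgroup N G \<Longrightarrow> subgroup (lcs N i) G"
  and lcs_subset: "subgroup N G \<Longrightarrow> lcs N i \<subseteq> N"
  and lcs_Suc: "subgroup N G \<Longrightarrow> lcs N (Suc i) = generate G (\<Union>x\<in>N. \<Union>y\<in>lcs N i. {x \<otimes> y \<otimes> inv x \<otimes> inv y})"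
  using lcs_basic by blast+

lemma lcs_commutator:
  assumes "subgroup N G" "x \<in> N" "y \<in> lcs N i" shows "x \<otimes> y \<otimes> inv x \<otimes> inv y \<in> lcs N (Suc i)"
  unfolding lcs_Suc[OF assms(1)] by (rule generate.incl) (use assms in blast)

lemma lcs_hom:
  assumes N: "subgroup N G" and f: "f \<in> hom G G" and fN: "f ` N \<subseteq> N"
  shows "f ` lcs N i \<subseteq> lcs N i"
proof (induction i)
  case 0 then show ?case using fN by simp
next
  case (Suc i)
  interpret f: group_hom G G f by unfold_locales (rule f)
  let ?S = "\<Union>x\<in>N. \<Union>y\<in>lcs N i. {x \<otimes> y \<otimes> inv x \<otimes> inv y}"
  have c: "x \<in> carrier G" if "x \<in> N" for x by (rule subgroup.mem_carrier[OF N that])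
  have lN: "y \<in> N" if "y \<in> lcs N i" for y using lcs_subset[OF N] that by auto
  have S: "?S \<subseteq> carrier G" using c lN by auto
  have "f ` ?S \<subseteq> ?S"
  proof (rule image_subsetI)
    fix z assume "z \<in> ?S"
    then obtain x y where xy: "x \<in> N" "y \<in> lcs N i" "z = x \<otimes> y \<otimes> inv x \<otimes> inv y" by auto
    then have "f z = f x \<otimes> f y \<otimes> inv (f x) \<otimes> inv (f y)" using c lN by simp
    moreover have "f x \<in> N" "f y \<in> lcs N i" using xy fN Suc.IH by auto
    ultimately show "f z \<in> ?S" by blast
  qed
  then show ?case unfolding lcs_Suc[OF N] f.generate_img[OF S, symmetric] by (rule mono_generate)
qed

lemma normalizes_lcs:
  assumes N: "subgroup N G" and K: "K \<subseteq> carrier G" and n: "normalizes K N"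
  shows "normalizes K (lcs N i)"
  unfolding normalizes_iff
proof (intro ballI)
  fix k x assume k: "k \<in> K" and x: "x \<in> lcs N i"
  have "conjugate k ` lcs N i \<subseteq> lcs N i"
    by (rule lcs_hom[OF N conjugate_hom]) (use k K n in \<open>auto simp: normalizes_iff\<close>)
  then show "conjugate k x \<in> lcs N i" using x by auto
qed

lemma lcs_decreasing: "subgroup N G \<Longrightarrow> lcs N (Suc i) \<subseteq> lcs N i"
proof -
  assume N: "subgroup N G"
  have nN: "normalizes N N" unfolding normalizes_def
    by (intro ballI subgroup.m_closed[OF N] subgroup.m_inv_closed[OF N])
  have n: "normalizes N (lcs N i)" by (rule normalizes_lcs[OF N subgroup.subset[OF N] nN])
  show ?thesis unfolding lcs_Suc[OF N]
  proof (rule generate_subgroup_incl[OF _ subgroup_lcs[OF N]])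
    show "(\<Union>x\<in>N. \<Union>y\<in>lcs N i. {x \<otimes> y \<otimes> inv x \<otimes> inv y}) \<subseteq> lcs N i"
      using n unfolding normalizes_def
      by (auto intro!: subgroup.m_closed[OF subgroup_lcs[OF N], of "_ \<otimes> _ \<otimes> _"] subgroup.m_inv_closed[OF subgroup_lcs[OF N]])
  qed
qed

lemma lcs_mono:
  assumes N: "subgroup N G" and C: "subgroup C G" and NC: "N \<subseteq> C" shows "lcs N i \<subseteq> lcs C i"
proof (induction i)
  case 0 show ?case using NC by simp
next
  case (Suc i)
  show ?case unfolding lcs_Suc[OF N] lcs_Suc[OF C]
    by (rule mono_generate) (use NC Suc.IH in blast)
qed

lemma nilpotent_subset:
  assumes N: "subgroup N G" and C: "subgroup C G" and NC: "N \<subseteq> C"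
    and nil: "nilpotent_group (G\<lparr>carrier := C\<rparr>)"
  shows "nilpotent_group (G\<lparr>carrier := N\<rparr>)"
proof -
  obtain n where n: "lcs C n = {\<one>}" using nil unfolding nilpotent_group_def by auto
  then have "lcs N n = {\<one>}" using lcs_mono[OF N C NC, of n] subgroup.one_closed[OF subgroup_lcs[OF N, of n]] by auto
  then show ?thesis unfolding nilpotent_group_def by auto
qed

inductive acts_nilpotently :: "'a set \<Rightarrow> 'a set \<Rightarrow> bool" for C where
  trivial: "acts_nilpotently C {\<one>}"
| step: "\<lbrakk>acts_nilpotently C L; subgroup M G; \<And>c x. \<lbrakk>c \<in> C; x \<in> M\<rbrakk> \<Longrightarrow> c \<otimes> x \<otimes> inv c \<otimes> inv x \<in> L\<rbrakk>
    \<Longrightarrow> acts_nilpotently C M"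

lemma acts_nilpotently_subgroup: "acts_nilpotently C M \<Longrightarrow> subgroup M G"
  by (induction rule: acts_nilpotently.induct) (simp_all add: triv_subgroup)

text \<open>A commutator with \<open>C\<close> moves the lower central series of \<open>C\<close>
  one step down the chain, from \<open>lcs C n \<subseteq> M\<close> to
  \<open>lcs C (Suc n) \<subseteq> L\<close>.\<close>

lemma acts_nilpotently_self:
  assumes C: "subgroup C G" and nil: "acts_nilpotently C C"
  shows "nilpotent_group (G\<lparr>carrier := C\<rparr>)"
proof -
  have "\<exists>m. lcs C m \<subseteq> {\<one>}" if "acts_nilpotently C M" "lcs C n \<subseteq> M" for M n
    using that
  proof (induction arbitrary: n rule: acts_nilpotently.induct)
    case trivial then show ?case by auto
  next
    case (step L M)
    have "lcs C (Suc n) \<subseteq> L" unfolding lcs_Suc[OF C]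
      by (rule generate_subgroup_incl[OF _ acts_nilpotently_subgroup[OF step.hyps(1)]])
         (use step in auto)
    then show ?case by (rule step.IH)
  qed
  from this[OF nil, of 0] obtain m where "lcs C m \<subseteq> {\<one>}" by auto
  then have "lcs C m = {\<one>}" using subgroup.one_closed[OF subgroup_lcs[OF C, of m]] by auto
  then show ?thesis unfolding nilpotent_group_def by auto
qed

lemma abelian_sectionI:
  assumes "subgroup M G" "subgroup L G" "L \<subseteq> M" "\<And>x y. \<lbrakk>x \<in> M; y \<in> M\<rbrakk> \<Longrightarrow> x \<otimes> y \<otimes> inv x \<otimes> inv y \<in> L"
  shows "abelian_section G M L"
  using assms by (intro abelian_section.intro abelian_section_axioms.intro is_group) auto

end

context abelian_section
begin

lemma induced_conjugate:
  assumes "a \<in> carrier G" "normalizes {a} M" "normalizes {a} L"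
  shows "x \<in> M \<Longrightarrow> induced (conjugate a) (proj x) = proj (conjugate a x)"
    and "induced (conjugate a) \<in> hom Q Q"
proof -
  have cM: "conjugate a x \<in> M" if "x \<in> M" for x using assms(2) that unfolding normalizes_iff by simp
  have cL: "conjugate a x \<in> L" if "x \<in> L" for x using assms(3) that unfolding normalizes_iff by simp
  have m: "proj (conjugate a (x \<otimes> y)) = proj (conjugate a x) \<otimes>\<^bsub>Q\<^esub> proj (conjugate a y)" if "x \<in> M" "y \<in> M" for x y
    using that cM hom_mult[OF conjugate_hom[OF assms(1)]] Mc by (simp add: proj_mult)
  show "x \<in> M \<Longrightarrow> induced (conjugate a) (proj x) = proj (conjugate a x)"
    using induced_proj(1)[of "conjugate a" x] cM cL m by blast
  show "induced (conjugate a) \<in> hom Q Q"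
    using induced_proj(2)[of "conjugate a"] cM cL m by blast
qed

lemma induced_extensional: "induced f \<in> extensional (carrier Q)"
  unfolding induced_def by simp

lemma finite_carrier_Q:
  assumes "finite_cover M L" shows "finite (carrier Q)"
proof -
  obtain T where T: "finite T" "T \<subseteq> carrier G" "\<And>x. x \<in> M \<Longrightarrow> \<exists>t\<in>T. x \<otimes> inv t \<in> L"
    by (rule finite_coverE[OF assms subgroup.subset[OF M] L]) blast
  have "carrier Q \<subseteq> (\<lambda>t. L #> t) ` T"
  proof (rule subsetI)
    fix u assume "u \<in> carrier Q"
    then obtain x where x: "x \<in> M" "u = proj x" using carrier_Q by auto
    then obtain t where t: "t \<in> T" "x \<otimes> inv t \<in> L" using T(3) by auto
    have tc: "t \<in> carrier G" using t T by auto
    have "x \<in> L #> t" using mem_r_coset_iff[OF L Mc[OF x(1)] tc] t by simp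
    then have "L #> t = L #> x" by (rule repr_independence[OF _ tc L])
    then show "u \<in> (\<lambda>t. L #> t) ` T" using t(1) x(2) unfolding proj_def by auto
  qed
  then show ?thesis using T(1) by (rule finite_subset[OF _ finite_imageI])
qed

end
declare lower_central_series.simps(2) [simp del]

section \<open>Orbits on central factors\<close>

text \<open>The dynamics enter only as finiteness of the fixed points of all positive powers of
  \<open>\<phi>\<close> on \<open>G\<close>, which serves every \<open>\<phi>\<close>-invariant
  \<open>K\<close> at once. By \<open>comm_K\<close> the quotient \<open>K / N\<close> is
  abelian.\<close>

locale expanding_section = group G for G (structure) +
  fixes h :: "'a set \<Rightarrow> nat" and \<phi> :: "'a \<Rightarrow> 'a" and K N :: "'a set"
  assumes rank: "power_rank_on (carrier G) h" and covered: "power_covered_on (carrier G)"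
    and \<phi>: "\<phi> \<in> hom G G" and inj: "inj_on \<phi> (carrier G)"
    and finite_fixed: "k > 0 \<Longrightarrow> finite {x \<in> carrier G. (\<phi> ^^ k) x = x}"
    and K: "subgroup K G" and \<phi>K: "\<phi> ` K \<subseteq> K"
    and N: "subgroup N G" and \<phi>N: "\<phi> ` N \<subseteq> N" and NK: "N \<subseteq> K"
    and comm_K: "\<lbrakk>x \<in> K; y \<in> K\<rbrakk> \<Longrightarrow> x \<otimes> y \<otimes> inv x \<otimes> inv y \<in> N"
    and nilpotent: "nilpotent_group (G\<lparr>carrier := N\<rparr>)"
begin

lemma Kc: "x \<in> K \<Longrightarrow> x \<in> carrier G" by (rule subgroup.mem_carrier[OF K])

lemma section_K_N: "abelian_section G K N"
  by (rule abelian_sectionI[OF K N NK comm_K])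

lemma normalizes_K_N: "normalizes K N"
  by (rule abelian_section.normalizes_M_L[OF section_K_N])

lemma normalizes_K_K: "normalizes K K"
  unfolding normalizes_def by (intro ballI subgroup.m_closed[OF K] subgroup.m_inv_closed[OF K])

lemma normalizes_K_lcs: "normalizes K (lcs N i)"
  by (rule normalizes_lcs[OF N subgroup.subset[OF K] normalizes_K_N])

lemma funpow_hom: "(\<phi> ^^ n) \<in> hom G G" by (rule hom_funpow[OF \<phi>])

lemma funpow_subset: "\<phi> ` M \<subseteq> M \<Longrightarrow> (\<phi> ^^ n) ` M \<subseteq> M"
proof (induction n)
  case (Suc n)
  have "(\<phi> ^^ Suc n) ` M = \<phi> ` (\<phi> ^^ n) ` M" by (simp add: image_comp)
  then show ?case using Suc by blast
qed simp

lemma funpow_mem: "\<lbrakk>\<phi> ` M \<subseteq> M; x \<in> M\<rbrakk> \<Longrightarrow> (\<phi> ^^ n) x \<in> M"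
  using funpow_subset by blast

lemma funpow_inj: "inj_on (\<phi> ^^ n) (carrier G)"
proof (induction n)
  case (Suc n)
  have "inj_on (\<phi> \<circ> \<phi> ^^ n) (carrier G)"
    by (rule comp_inj_on[OF Suc inj_on_subset[OF inj hom_carrier[OF funpow_hom]]])
  then show ?case by (simp only: funpow.simps)
qed simp

lemma funpow_lcs: "\<phi> ` lcs N i \<subseteq> lcs N i"
  by (rule lcs_hom[OF N \<phi> \<phi>N])

lemma powers_in_funpow_image:
  assumes "subgroup M G" "\<phi> ` M \<subseteq> M" shows "powers_in M ((\<phi> ^^ n) ` M)"
  by (rule powers_in_injective_image[OF rank funpow_hom assms(1) funpow_subset[OF assms(2)] funpow_inj])

lemma section_lcs: "abelian_section G (lcs N i) (lcs N (Suc i))"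
  by (rule abelian_sectionI[OF subgroup_lcs[OF N] subgroup_lcs[OF N] lcs_decreasing[OF N]])
     (use lcs_commutator[OF N] lcs_subset[OF N, of i] in auto)

lemma power_displacement_mod_N:
  assumes k: "k > 0" and y: "y \<in> K"
  obtains e :: nat and b where "e > 0" "b \<in> K" "y [^] e \<otimes> inv (inv b \<otimes> (\<phi> ^^ k) b) \<in> N"
proof -
  let ?\<psi> = "\<phi> ^^ k"
  interpret KN: abelian_section G K N by (rule section_K_N)
  obtain m where m: "lcs N m = {\<one>}" using nilpotent unfolding nilpotent_group_def by auto
  have \<psi>c: "?\<psi> x \<in> carrier G" if "x \<in> carrier G" for x by (rule hom_in_carrier[OF funpow_hom that])
  \<comment> \<open>The count runs from the trivial term \<open>lcs N m\<close>, where being fixed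
    modulo the term means being a fixed point, up to \<open>N = lcs N 0\<close>. The section
    \<open>K / N\<close> is then handled by the same lemma, but for its displacements instead of its
    fixed points.\<close>
  have fin: "finite_cover (fixed_mod K ?\<psi> (lcs N (m - j))) (lcs N (m - j))" if "j \<le> m" for j
    using that
  proof (induction j)
    case 0
    have sub: "fixed_mod K ?\<psi> {\<one>} \<subseteq> {x \<in> carrier G. ?\<psi> x = x}"
    proof (rule subsetI)
      fix x assume "x \<in> fixed_mod K ?\<psi> {\<one>}"
      then have x: "x \<in> carrier G" "inv x \<otimes> ?\<psi> x = \<one>" unfolding fixed_mod_def using Kc by auto
      have "?\<psi> x = x \<otimes> (inv x \<otimes> ?\<psi> x)" by (rule mult_inv_cancel[OF x(1) \<psi>c[OF x(1)], symmetric])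
      then have "?\<psi> x = x" unfolding x(2) using x(1) by simp
      then show "x \<in> {x \<in> carrier G. ?\<psi> x = x}" using x(1) by simp
    qed
    have "finite_cover (fixed_mod K ?\<psi> {\<one>}) {\<one>}"
    proof (rule finite_coverI[of "{x \<in> carrier G. ?\<psi> x = x}"])
      fix x assume "x \<in> fixed_mod K ?\<psi> {\<one>}"
      then show "\<exists>t\<in>{x \<in> carrier G. ?\<psi> x = x}. x \<otimes> inv t \<in> {\<one>}"
        using sub by (intro bexI[of _ x]) auto
    qed (use sub finite_fixed[OF k] triv_subgroup in auto)
    then show ?case using m by simp
  next
    case (Suc j)
    define i where "i = m - Suc j"
    have i: "m - j = Suc i" using Suc.prems unfolding i_def by simp
    interpret S: abelian_section G "lcs N i" "lcs N (Suc i)" by (rule section_lcs)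
    show ?case unfolding i_def[symmetric]
      by (rule S.finite_fixed_mod_step(1)[OF rank covered K _ normalizes_K_lcs normalizes_K_lcs funpow_hom
            funpow_subset[OF \<phi>K] funpow_subset[OF funpow_lcs] funpow_subset[OF funpow_lcs]])
         (use Suc lcs_subset[OF N, of i] NK i in auto)
  qed
  have fin0: "finite_cover (fixed_mod K ?\<psi> N) N" using fin[of m] by simp
  obtain e :: nat and b where e: "e > 0" "b \<in> K" "KN.proj (y [^] e) = KN.proj (inv b \<otimes> ?\<psi> b)"
    using KN.finite_fixed_mod_step(2)[OF rank covered K order_refl normalizes_K_K normalizes_K_N funpow_hom
        funpow_subset[OF \<phi>K] funpow_subset[OF \<phi>K] funpow_subset[OF \<phi>N] fin0 y] by (elim exE conjE bexE)
  have "inv b \<otimes> ?\<psi> b \<in> K"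
    using funpow_mem[OF \<phi>K e(2)] by (rule subgroup.m_closed[OF K subgroup.m_inv_closed[OF K e(2)]])
  then have "y [^] e \<otimes> inv (inv b \<otimes> ?\<psi> b) \<in> N"
    using e(3) KN.proj_eq_iff[OF subgroup_nat_pow_closed[OF K y]] by simp
  with e(1,2) show ?thesis by (rule that)
qed

text \<open>Only the acting element runs through its \<open>\<phi>\<close>-orbit; \<open>M\<close>
  and \<open>L\<close> need not be \<open>\<phi>\<close>-invariant.\<close>

definition finite_orbits :: "'a set \<Rightarrow> 'a set \<Rightarrow> bool" where
  "finite_orbits M L \<longleftrightarrow>
     (\<forall>g\<in>K. finite (range (\<lambda>n. abelian_section.induced G M L (conjugate ((\<phi> ^^ n) g)))))"

text \<open>The last condition makes \<open>N\<close> act trivially on \<open>M / L\<close>, so that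
  inside \<open>expanding_section\<close> the action of \<open>K\<close> factors through the abelian
  group \<open>K / N\<close>.\<close>

definition central_factor :: "'a set \<Rightarrow> 'a set \<Rightarrow> bool" where
  "central_factor M L \<longleftrightarrow> subgroup M G \<and> subgroup L G \<and> L \<subseteq> M \<and> M \<subseteq> N \<and> normalizes K M \<and> normalizes K L \<and>
     (\<forall>x\<in>N. \<forall>y\<in>M. x \<otimes> y \<otimes> inv x \<otimes> inv y \<in> L)"

lemma central_factorD:
  assumes "central_factor M L"
  shows "subgroup M G" "subgroup L G" "L \<subseteq> M" "M \<subseteq> N" "normalizes K M" "normalizes K L"
    "\<lbrakk>x \<in> N; y \<in> M\<rbrakk> \<Longrightarrow> x \<otimes> y \<otimes> inv x \<otimes> inv y \<in> L" "abelian_section G M L"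
proof -
  show *: "subgroup M G" "subgroup L G" "L \<subseteq> M" "M \<subseteq> N" "normalizes K M" "normalizes K L"
    "\<lbrakk>x \<in> N; y \<in> M\<rbrakk> \<Longrightarrow> x \<otimes> y \<otimes> inv x \<otimes> inv y \<in> L" for x y
    using assms unfolding central_factor_def by auto
  show "abelian_section G M L"
    by (rule abelian_sectionI[OF *(1-3)]) (use * in blast)
qed

lemma normalizes_singleton: "\<lbrakk>normalizes K M; k \<in> K\<rbrakk> \<Longrightarrow> normalizes {k} M"
  unfolding normalizes_def by auto

lemma induced_conjugate_K:
  assumes "central_factor M L" "k \<in> K"
  shows "x \<in> M \<Longrightarrow> abelian_section.induced G M L (conjugate k) (abelian_section.proj G L x) = abelian_section.proj G L (conjugate k x)"
    and "abelian_section.induced G M L (conjugate k) \<in> hom (abelian_section.Q G M L) (abelian_section.Q G M L)"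
    and "x \<in> M \<Longrightarrow> conjugate k x \<in> M"
proof -
  note c = central_factorD[OF assms(1)]
  interpret abelian_section G M L by (rule c(8))
  show "x \<in> M \<Longrightarrow> induced (conjugate k) (proj x) = proj (conjugate k x)" "induced (conjugate k) \<in> hom Q Q"
    using induced_conjugate[OF Kc[OF assms(2)] normalizes_singleton[OF c(5) assms(2)] normalizes_singleton[OF c(6) assms(2)]]
    by auto
  show "x \<in> M \<Longrightarrow> conjugate k x \<in> M" using c(5) assms(2) unfolding normalizes_iff by auto
qed

lemma finite_orbits_finite:
  assumes c: "central_factor M L" and fin: "finite_cover M L"
  shows "finite_orbits M L"
  unfolding finite_orbits_def
proof
  fix g assume g: "g \<in> K"
  interpret abelian_section G M L by (rule central_factorD(8)[OF c])
  have "range (\<lambda>n. induced (conjugate ((\<phi> ^^ n) g))) \<subseteq> carrier Q \<rightarrow>\<^sub>E carrier Q"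
  proof (rule image_subsetI)
    fix n
    have "induced (conjugate ((\<phi> ^^ n) g)) \<in> hom Q Q"
      by (rule induced_conjugate_K(2)[OF c funpow_mem[OF \<phi>K g]])
    then show "induced (conjugate ((\<phi> ^^ n) g)) \<in> carrier Q \<rightarrow>\<^sub>E carrier Q"
      using induced_extensional unfolding PiE_def hom_def by auto
  qed
  moreover have "finite (carrier Q \<rightarrow>\<^sub>E carrier Q)"
    using finite_carrier_Q[OF fin] by (intro finite_PiE) auto
  ultimately show "finite (range (\<lambda>n. induced (conjugate ((\<phi> ^^ n) g))))" by (rule finite_subset)
qed

lemma conjugate_commute:
  assumes c: "central_factor M L" and k: "k \<in> K" "k' \<in> K" and x: "x \<in> M"
  shows "abelian_section.proj G L (conjugate k (conjugate k' x)) = abelian_section.proj G L (conjugate k' (conjugate k x))"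
proof -
  note d = central_factorD[OF c]
  interpret abelian_section G M L by (rule d(8))
  define y where "y = conjugate k' (conjugate k x)"
  define z where "z = k \<otimes> k' \<otimes> inv k \<otimes> inv k'"
  have kc: "k \<in> carrier G" "k' \<in> carrier G" "x \<in> carrier G" using k x Kc Mc by auto
  have y: "y \<in> M" unfolding y_def by (intro induced_conjugate_K(3)[OF c] k x)
  have z: "z \<in> N" unfolding z_def by (rule comm_K[OF k])
  have "conjugate k (conjugate k' x) = conjugate z y"
    unfolding y_def z_def conjugate_def using kc by (simp add: group_word_simps)
  moreover have "conjugate z y \<otimes> inv y \<in> L" unfolding conjugate_def by (rule d(7)[OF z y])
  moreover have "conjugate z y \<in> M" using induced_conjugate_K(3)[OF c _ y] z NK by auto
  ultimately show ?thesis using proj_eq_iff[OF _ y] unfolding y_def by simp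
qed

text \<open>The polynomials \<open>P\<close> are found for \<open>g\<close> on the whole lower
  central factor, because \<open>\<phi>\<close> preserves that factor but perhaps not
  \<open>M\<close> and \<open>L\<close>. Applying \<open>\<phi> ^^ n\<close> gives relations for
  \<open>(\<phi> ^^ n) g\<close> on the image of \<open>\<phi> ^^ n\<close>. That image contains a
  power of every element of \<open>M\<close>, and \<open>M / L\<close> is torsion-free, so the same
  \<open>P\<close> annihilates every \<open>(\<phi> ^^ n) g\<close> on \<open>M / L\<close>, and
  \<open>finite_algebraic_elements\<close> applies.\<close>

lemma finite_orbits_irreducible:
  assumes c: "central_factor M L" and i: "M \<subseteq> lcs N i" "lcs N (Suc i) \<subseteq> L"
    and tf: "\<And>x e. \<lbrakk>x \<in> M; e > 0; x [^] (e::nat) \<in> L\<rbrakk> \<Longrightarrow> x \<in> L"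
    and irr: "\<And>U. \<lbrakk>subgroup U G; L \<subseteq> U; U \<subseteq> M; normalizes K U\<rbrakk> \<Longrightarrow> U = L \<or> powers_in M U"
    and nt: "M \<noteq> L"
  shows "finite_orbits M L"
  unfolding finite_orbits_def
proof
  fix g assume g: "g \<in> K"
  note d = central_factorD[OF c]
  let ?A = "lcs N i" and ?B = "lcs N (Suc i)"
  have A: "subgroup ?A G" by (rule subgroup_lcs[OF N])
  have AN: "?A \<subseteq> N" by (rule lcs_subset[OF N])
  interpret S: abelian_section G M L by (rule d(8))
  interpret T: abelian_section G ?A ?B by (rule section_lcs)
  have cA: "central_factor ?A ?B"
    unfolding central_factor_def
    by (intro conjI ballI A AN subgroup_lcs[OF N] lcs_decreasing[OF N] normalizes_K_lcs lcs_commutator[OF N])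
  have gn: "(\<phi> ^^ n) g \<in> K" for n by (rule funpow_mem[OF \<phi>K g])
  define r where "r = T.induced (conjugate g)"
  have r: "r \<in> hom T.Q T.Q" unfolding r_def by (rule induced_conjugate_K(2)[OF cA g])
  obtain P where P: "\<And>p. p \<in> set P \<Longrightarrow> p \<noteq> [] \<and> hd p \<noteq> 0"
    and Pt: "\<And>x. x \<in> carrier T.Q \<Longrightarrow> \<exists>e::nat. e > 0 \<and> polys_act T.Q P r x [^]\<^bsub>T.Q\<^esub> e = \<one>\<^bsub>T.Q\<^esub>"
    by (rule T.Q.polys_act_torsion[OF T.power_rank_Q[OF rank] r]) blast
  have kill: "\<exists>e::nat. e > 0 \<and> polys_act G P (conjugate g) x [^] e \<in> ?B \<and> polys_act G P (conjugate g) x \<in> ?A"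
    if x: "x \<in> ?A" for x
  proof -
    have "polys_act G P (conjugate g) x \<in> ?A \<and> T.proj (polys_act G P (conjugate g) x) = polys_act T.Q P r (T.proj x)"
      by (rule polys_act_natural[OF is_group T.Q.is_group A T.proj_hom])
         (use induced_conjugate_K[OF cA g] x in \<open>auto simp: r_def\<close>)
    then have q: "polys_act G P (conjugate g) x \<in> ?A"
      "T.proj (polys_act G P (conjugate g) x) = polys_act T.Q P r (T.proj x)" by auto
    obtain e :: nat where e: "e > 0" "polys_act T.Q P r (T.proj x) [^]\<^bsub>T.Q\<^esub> e = \<one>\<^bsub>T.Q\<^esub>"
      using Pt[OF T.proj_closed[OF x]] by (elim exE conjE)
    then have "T.proj (polys_act G P (conjugate g) x [^] e) = \<one>\<^bsub>T.Q\<^esub>" using T.proj_nat_pow[OF q(1)] q(2) by simp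
    then show ?thesis using e(1) q(1) T.proj_eq_one_iff[OF subgroup_nat_pow_closed[OF A q(1)]] by auto
  qed
  define S where "S = (\<lambda>k. S.induced (conjugate k)) ` K"
  have Qpow: "\<exists>x\<in>M. u = S.proj x" if "u \<in> carrier S.Q" for u using that S.carrier_Q by auto
  have tfQ: "u = \<one>\<^bsub>S.Q\<^esub>" if u: "u \<in> carrier S.Q" "e > 0" "u [^]\<^bsub>S.Q\<^esub> (e::nat) = \<one>\<^bsub>S.Q\<^esub>" for u e
  proof -
    obtain x where x: "x \<in> M" "u = S.proj x" using Qpow[OF u(1)] by auto
    have "x [^] e \<in> L"
      using u(3) S.proj_nat_pow[OF x(1)] S.proj_eq_one_iff[OF subgroup_nat_pow_closed[OF d(1) x(1)]] x(2) by simp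
    then show ?thesis using tf[OF x(1) u(2)] S.proj_eq_one_iff[OF x(1)] x(2) by simp
  qed
  interpret I: irreducible_action S.Q S
  proof (intro irreducible_action.intro S.Q_comm_group irreducible_action_axioms.intro)
    show "s \<in> hom S.Q S.Q" if "s \<in> S" for s using that induced_conjugate_K(2)[OF c] unfolding S_def by auto
    fix s t u assume "s \<in> S" "t \<in> S" "u \<in> carrier S.Q"
    then obtain k k' x where k: "k \<in> K" "k' \<in> K" "s = S.induced (conjugate k)" "t = S.induced (conjugate k')"
      and x: "x \<in> M" "u = S.proj x" unfolding S_def using Qpow by blast
    show "s (t u) = t (s u)"
      unfolding k x using induced_conjugate_K(1,3)[OF c] k x conjugate_commute[OF c k(1,2) x(1)] by simp
  next
    show "x = \<one>\<^bsub>S.Q\<^esub>" if "x \<in> carrier S.Q" "e > 0" "x [^]\<^bsub>S.Q\<^esub> (e::nat) = \<one>\<^bsub>S.Q\<^esub>" for x e using tfQ that .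
  next
    fix U assume U: "subgroup U S.Q" and inv: "\<And>s. s \<in> S \<Longrightarrow> s ` U \<subseteq> U"
    let ?V = "{x \<in> M. S.proj x \<in> U}"
    have one: "\<one>\<^bsub>S.Q\<^esub> \<in> U" by (rule subgroup.one_closed[OF U])
    have LV: "L \<subseteq> ?V"
    proof (rule subsetI)
      fix x assume x: "x \<in> L"
      then have "x \<in> M" using d(3) by auto
      moreover from this have "S.proj x = \<one>\<^bsub>S.Q\<^esub>" using S.proj_eq_one_iff x by simp
      ultimately show "x \<in> ?V" using one by simp
    qed
    have nV: "normalizes K ?V"
      unfolding normalizes_iff
    proof (intro ballI)
      fix k x assume k: "k \<in> K" and x: "x \<in> ?V"
      have "S.induced (conjugate k) (S.proj x) \<in> U" using inv[of "S.induced (conjugate k)"] k x unfolding S_def by auto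
      then show "conjugate k x \<in> ?V" using induced_conjugate_K(1,3)[OF c k] x by simp
    qed
    have "?V = L \<or> powers_in M ?V" by (rule irr[OF S.subgroup_vimage[OF U] LV _ nV]) auto
    then show "U = {\<one>\<^bsub>S.Q\<^esub>} \<or> S.Q.powers_in (carrier S.Q) U"
    proof
      assume V: "?V = L"
      have "u = \<one>\<^bsub>S.Q\<^esub>" if u: "u \<in> U" for u
      proof -
        obtain x where x: "x \<in> M" "u = S.proj x" using Qpow[OF subgroup.mem_carrier[OF U u]] by auto
        then have "x \<in> L" using V u by auto
        then show ?thesis using x S.proj_eq_one_iff by simp
      qed
      then have "U = {\<one>\<^bsub>S.Q\<^esub>}" using one by blast
      then show ?thesis by (rule disjI1)
    next
      assume pw: "powers_in M ?V"
      have "S.Q.powers_in (carrier S.Q) U" unfolding S.Q.powers_in_def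
      proof
        fix u assume u: "u \<in> carrier S.Q"
        obtain x where x: "x \<in> M" "u = S.proj x" using Qpow[OF u] by (elim bexE)
        obtain e :: nat where "e > 0" "x [^] e \<in> ?V" using x(1) by (rule powers_inD[OF pw])
        then show "\<exists>e::nat. e > 0 \<and> u [^]\<^bsub>S.Q\<^esub> e \<in> U" using S.proj_nat_pow[OF x(1)] x(2) by auto
      qed
      then show ?thesis ..
    qed
  next
    obtain x where x: "x \<in> M" "x \<notin> L" using nt d(3) by auto
    then have "S.proj x \<noteq> \<one>\<^bsub>S.Q\<^esub>" using S.proj_eq_one_iff[OF x(1)] by simp
    then show "\<exists>x\<in>carrier S.Q. x \<noteq> \<one>\<^bsub>S.Q\<^esub>" by (rule bexI[OF _ S.proj_closed[OF x(1)]])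
  qed
  have "S.induced (conjugate ((\<phi> ^^ n) g)) \<in> {restrict s (carrier S.Q) | s. s \<in> S \<and> (\<forall>x\<in>carrier S.Q. polys_act S.Q P s x = \<one>\<^bsub>S.Q\<^esub>)}" for n
  proof (intro CollectI exI conjI ballI)
    let ?f = "\<phi> ^^ n" and ?s = "S.induced (conjugate ((\<phi> ^^ n) g))"
    interpret f: group_hom G G ?f by unfold_locales (rule funpow_hom)
    show "?s = restrict ?s (carrier S.Q)" using S.induced_extensional by (simp add: extensional_restrict)
    show sS: "?s \<in> S" unfolding S_def using gn by auto
    fix u assume u: "u \<in> carrier S.Q"
    obtain x where x: "x \<in> M" "u = S.proj x" using Qpow[OF u] by (elim bexE)
    have hs: "polys_act S.Q P ?s \<in> hom S.Q S.Q" by (rule S.Q.polys_act_hom[OF I.S_hom[OF sS]])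
    \<comment> \<open>Only a power of \<open>x\<close> is known to be an image under
      \<open>?f\<close>; torsion-freeness of the quotient removes the exponent \<open>e\<close> at
      the end.\<close>
    obtain e :: nat where e: "e > 0" "x [^] e \<in> ?f ` ?A"
      using subsetD[OF i(1) x(1)] by (rule powers_inD[OF powers_in_funpow_image[OF A funpow_lcs]])
    then obtain y where y: "y \<in> ?A" "x [^] e = ?f y" by auto
    let ?w = "polys_act G P (conjugate g) y"
    obtain e' :: nat where e': "e' > 0" "?w [^] e' \<in> ?B" "?w \<in> ?A" using kill[OF y(1)] by (elim exE conjE)
    have "polys_act G P (conjugate g) y \<in> carrier G \<and> ?f ?w = polys_act G P (conjugate (?f g)) (?f y)"
    proof (rule polys_act_natural[OF is_group is_group subgroup_self])
      show "?f \<in> hom (G\<lparr>carrier := carrier G\<rparr>) G" using funpow_hom by simp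
      show "conjugate g z \<in> carrier G" "?f (conjugate g z) = conjugate (?f g) (?f z)" if "z \<in> carrier G" for z
        using that Kc[OF g] unfolding conjugate_def by simp_all
      show "y \<in> carrier G" by (rule T.Mc[OF y(1)])
    qed
    then have w: "?f ?w = polys_act G P (conjugate (?f g)) (x [^] e)" using y(2) by simp
    have xe: "x [^] e \<in> M" by (rule subgroup_nat_pow_closed[OF d(1) x(1)])
    have z: "?f ?w \<in> M \<and> S.proj (?f ?w) = polys_act S.Q P ?s (S.proj (x [^] e))"
      unfolding w
      by (rule polys_act_natural[OF is_group S.Q.is_group d(1) S.proj_hom])
         (use induced_conjugate_K[OF c gn] xe in auto)
    \<comment> \<open>The exponent \<open>e'\<close> accounts for the torsion left modulo
      \<open>?B\<close>. As \<open>\<phi>\<close> preserves \<open>?B\<close> and \<open>?B\<close>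
      lies in \<open>L\<close>, it is absorbed by \<open>tf\<close>.\<close>
    have "?f ?w [^] e' = ?f (?w [^] e')" using T.Mc[OF e'(3)] by (simp add: f.hom_nat_pow)
    also have "\<dots> \<in> L" using funpow_mem[OF funpow_lcs e'(2)] i(2) by auto
    finally have "?f ?w \<in> L" using tf[OF _ e'(1)] z by blast
    then have "polys_act S.Q P ?s (S.proj (x [^] e)) = \<one>\<^bsub>S.Q\<^esub>" using z S.proj_eq_one_iff by auto
    then have "polys_act S.Q P ?s u [^]\<^bsub>S.Q\<^esub> e = \<one>\<^bsub>S.Q\<^esub>"
      using hom_nat_pow[OF hs u S.Q.is_group S.Q.is_group, of e] S.proj_nat_pow[OF x(1)] x(2) by simp
    then show "polys_act S.Q P ?s u = \<one>\<^bsub>S.Q\<^esub>" by (rule tfQ[OF hom_in_carrier[OF hs u] e(1)])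
  qed
  then have "range (\<lambda>n. S.induced (conjugate ((\<phi> ^^ n) g)))
      \<subseteq> {restrict s (carrier S.Q) | s. s \<in> S \<and> (\<forall>x\<in>carrier S.Q. polys_act S.Q P s x = \<one>\<^bsub>S.Q\<^esub>)}"
    by (rule image_subsetI)
  moreover have "finite {restrict s (carrier S.Q) | s. s \<in> S \<and> (\<forall>x\<in>carrier S.Q. polys_act S.Q P s x = \<one>\<^bsub>S.Q\<^esub>)}"
    by (rule I.finite_algebraic_elements[OF P])
  ultimately show "finite (range (\<lambda>n. S.induced (conjugate ((\<phi> ^^ n) g))))" by (rule finite_subset)
qed

end

section \<open>Filtrations by sections with finite orbits, and the nilpotent subgroup\<close>

context expanding_section
begin

inductive filtered :: "'a set \<Rightarrow> bool" where
  filtered_trivial: "filtered {\<one>}"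
| filtered_step: "\<lbrakk>filtered L; central_factor M L; finite_orbits M L\<rbrakk> \<Longrightarrow> filtered M"

text \<open>\<open>V\<close> is the preimage of the torsion subgroup of the abelian group
  \<open>M / L\<close>, also called the isolator of \<open>L\<close> in \<open>M\<close>.\<close>

lemma roots_subgroup:
  assumes c: "central_factor M L"
  defines "V \<equiv> {x \<in> M. \<exists>e::nat. e > 0 \<and> x [^] e \<in> L}"
  shows "subgroup V G" "normalizes K V"
proof -
  note d = central_factorD[OF c]
  interpret abelian_section G M L by (rule d(8))
  show "subgroup V G"
  proof (rule subgroupI)
    show "V \<subseteq> carrier G" unfolding V_def using Mc by auto
    have "\<one> \<in> V" unfolding V_def using subgroup.one_closed[OF M] subgroup.one_closed[OF L]
      by (auto intro!: exI[of _ "1::nat"])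
    then show "V \<noteq> {}" by auto
    fix x assume "x \<in> V"
    then obtain e :: nat where x: "x \<in> M" "e > 0" "x [^] e \<in> L" unfolding V_def by auto
    have "(inv x) [^] e \<in> L"
      using subgroup.m_inv_closed[OF L x(3)] Mc[OF x(1)] by (simp add: nat_pow_inv)
    then show "inv x \<in> V" unfolding V_def using x subgroup.m_inv_closed[OF M] by auto
    fix y assume "y \<in> V"
    then obtain f :: nat where y: "y \<in> M" "f > 0" "y [^] f \<in> L" unfolding V_def by auto
    have xy: "x \<otimes> y \<in> M" by (rule subgroup.m_closed[OF M x(1) y(1)])
    have "x [^] (e * f) \<in> L" "y [^] (e * f) \<in> L"
      using subgroup_nat_pow_closed[OF L x(3), of f] subgroup_nat_pow_closed[OF L y(3), of e] x y Mc
      by (simp_all add: nat_pow_pow mult.commute)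
    then have one: "proj x [^]\<^bsub>Q\<^esub> (e * f) = \<one>\<^bsub>Q\<^esub>" "proj y [^]\<^bsub>Q\<^esub> (e * f) = \<one>\<^bsub>Q\<^esub>"
      using proj_eq_one_iff[OF subgroup_nat_pow_closed[OF M]] proj_nat_pow x(1) y(1) by auto
    have "proj ((x \<otimes> y) [^] (e * f)) = (proj x \<otimes>\<^bsub>Q\<^esub> proj y) [^]\<^bsub>Q\<^esub> (e * f)"
      using proj_nat_pow[OF xy] proj_mult[OF x(1) y(1)] by simp
    also have "\<dots> = \<one>\<^bsub>Q\<^esub>"
      using one x(1) y(1) by (simp add: Q.nat_pow_distrib)
    finally have "(x \<otimes> y) [^] (e * f) \<in> L"
      using proj_eq_one_iff[OF subgroup_nat_pow_closed[OF M xy]] by simp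
    then show "x \<otimes> y \<in> V" unfolding V_def using xy x(2) y(2) by (auto intro!: exI[of _ "e * f"])
  qed
  show "normalizes K V"
    unfolding normalizes_iff
  proof (intro ballI)
    fix k x assume k: "k \<in> K" and "x \<in> V"
    then obtain e :: nat where x: "x \<in> M" "e > 0" "x [^] e \<in> L" unfolding V_def by auto
    have "conjugate k x [^] e = conjugate k (x [^] e)"
      using hom_nat_pow[OF conjugate_hom[OF Kc[OF k]] Mc[OF x(1)] is_group is_group] by simp
    also have "\<dots> \<in> L" using d(6) k x(3) unfolding normalizes_iff by auto
    finally show "conjugate k x \<in> V" unfolding V_def using x d(5) k unfolding normalizes_iff by auto
  qed
qed

text \<open>Induction on the rank of \<open>M\<close>. If \<open>M\<close> is finite modulo the
  lower term, one finite section suffices. Otherwise let \<open>L\<close> have the largest rank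
  among the \<open>K\<close>-invariant subgroups of infinite index above that term, and let
  \<open>V\<close> be its isolator. Then \<open>M / V\<close> is torsion-free. An invariant
  \<open>U\<close> of infinite index containing \<open>V\<close> has the rank of \<open>L\<close>,
  hence has powers in \<open>L\<close> and lies in \<open>V\<close>; so \<open>M / V\<close> is
  irreducible, while \<open>V\<close> has smaller rank than \<open>M\<close>.\<close>

lemma filtered_between_lcs:
  assumes base: "filtered (lcs N (Suc i))"
    and M: "subgroup M G" "lcs N (Suc i) \<subseteq> M" "M \<subseteq> lcs N i" "normalizes K M"
  shows "filtered M"
  using M
proof (induction "h M" arbitrary: M rule: less_induct)
  case less
  let ?B = "lcs N (Suc i)"
  have cf: "central_factor M U" if "subgroup U G" "?B \<subseteq> U" "U \<subseteq> M" "normalizes K U" for U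
    unfolding central_factor_def
    using that less.prems lcs_subset[OF N, of i] lcs_commutator[OF N, of _ _ i] by blast
  have B: "subgroup ?B G" by (rule subgroup_lcs[OF N])
  have cB: "central_factor M ?B" by (rule cf[OF B order_refl less.prems(2) normalizes_K_lcs])
  show ?case
  proof (cases "powers_in M ?B")
    case True
    then have "finite_cover M ?B"
      using covered less.prems B subgroup.subset[OF less.prems(1)] unfolding power_covered_on_def by blast
    then show ?thesis by (rule filtered_step[OF base cB finite_orbits_finite[OF cB]])
  next
    case False
    define F where "F U \<longleftrightarrow> subgroup U G \<and> ?B \<subseteq> U \<and> U \<subseteq> M \<and> normalizes K U \<and> \<not> powers_in M U" for U
    have FB: "F ?B" unfolding F_def using B less.prems normalizes_K_lcs False by simp
    have rk: "h U \<le> h V \<and> (h U = h V \<longrightarrow> powers_in V U)" if "subgroup U G" "subgroup V G" "U \<subseteq> V" for U V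
      using rank that subgroup.subset[OF that(2)] unfolding power_rank_on_def by simp
    define p where "p n \<longleftrightarrow> (\<exists>U. F U \<and> h U = n)" for n
    have p0: "p (h ?B)" unfolding p_def using FB by auto
    have pb: "\<And>n. p n \<Longrightarrow> n \<le> h M" unfolding p_def F_def using rk less.prems(1) by auto
    have "p (Greatest p)" by (rule GreatestI_nat[of p, OF p0 pb])
    then obtain L where L: "F L" "h L = Greatest p" unfolding p_def by auto
    have max: "h U \<le> h L" if "F U" for U
      unfolding L(2) using pb that by (intro Greatest_le_nat[of p _ "h M"]) (auto simp: p_def)
    have L': "subgroup L G" "?B \<subseteq> L" "L \<subseteq> M" "normalizes K L" "\<not> powers_in M L" using L(1) unfolding F_def by auto
    have cL: "central_factor M L" by (rule cf[OF L'(1-4)])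
    define V where "V = {x \<in> M. \<exists>e::nat. e > 0 \<and> x [^] e \<in> L}"
    have V: "subgroup V G" "normalizes K V" unfolding V_def using roots_subgroup[OF cL] by auto
    have Mc: "x \<in> carrier G" if "x \<in> M" for x by (rule subgroup.mem_carrier[OF less.prems(1) that])
    have LV: "L \<subseteq> V" unfolding V_def using L'(3) Mc by (auto intro!: exI[of _ "1::nat"])
    have VM: "V \<subseteq> M" unfolding V_def by auto
    have VL: "powers_in V L" unfolding V_def powers_in_def by auto
    have nV: "\<not> powers_in M V"
    proof
      assume "powers_in M V"
      then have "powers_in M L" using VL subgroup.subset[OF less.prems(1)] by (rule powers_in_trans)
      then show False using L'(5) by simp
    qed
    have BV: "?B \<subseteq> V" using L'(2) LV by simp
    have cV: "central_factor M V" by (rule cf[OF V(1) BV VM V(2)])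
    have "h V < h M" using rk[OF V(1) less.prems(1) VM] nV by (cases "h V = h M") auto
    then have filteredV: "filtered V"
      by (rule less.hyps[OF _ V(1) BV _ V(2)]) (use VM less.prems(3) in auto)
    have "finite_orbits M V"
    proof (rule finite_orbits_irreducible[OF cV less.prems(3) BV])
      fix x and e :: nat assume x: "x \<in> M" "e > 0" "x [^] e \<in> V"
      then obtain f :: nat where "f > 0" "(x [^] e) [^] f \<in> L" unfolding V_def by auto
      then show "x \<in> V" unfolding V_def using x Mc by (auto simp: nat_pow_pow intro!: exI[of _ "e * f"])
    next
      fix U assume U: "subgroup U G" "V \<subseteq> U" "U \<subseteq> M" "normalizes K U"
      show "U = V \<or> powers_in M U"
      proof (rule ccontr)
        assume no: "\<not> (U = V \<or> powers_in M U)"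
        then have "F U" unfolding F_def using U BV by auto
        then have "h U \<le> h L" by (rule max)
        moreover have "h L \<le> h U \<and> (h L = h U \<longrightarrow> powers_in U L)" by (rule rk[OF L'(1) U(1)]) (use LV U(2) in auto)
        ultimately have "powers_in U L" by simp
        then have "U \<subseteq> V" unfolding V_def powers_in_def using U(3) by auto
        then show False using no U(2) by auto
      qed
    next
      show "M \<noteq> V"
      proof
        assume "M = V"
        then have "powers_in M V" unfolding powers_in_def using Mc by (auto intro!: exI[of _ "1::nat"])
        then show False using nV by simp
      qed
    qed
    then show ?thesis by (rule filtered_step[OF filteredV cV])
  qed
qed

lemma filtered_N: "filtered N"
proof -
  obtain m where m: "lcs N m = {\<one>}" using nilpotent unfolding nilpotent_group_def by auto
  have "filtered (lcs N (m - j))" if "j \<le> m" for j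
    using that
  proof (induction j)
    case 0 then show ?case using m filtered_trivial by simp
  next
    case (Suc j)
    define i where "i = m - Suc j"
    have i: "m - j = Suc i" using Suc.prems unfolding i_def by simp
    have "filtered (lcs N (Suc i))" using Suc i by simp
    then show ?case unfolding i_def[symmetric]
      by (rule filtered_between_lcs[OF _ subgroup_lcs[OF N] lcs_decreasing[OF N] order_refl normalizes_K_lcs])
  qed
  from this[of m] show ?thesis by simp
qed

text \<open>The chain is flattened to a finite set of sections, to which the pigeonhole principle
  applies. What survives of its order is the implication to \<open>acts_nilpotently\<close>, stated
  for every \<open>C\<close> because \<open>C\<close> is defined from the sections only
  afterwards.\<close>

lemma filtered_sections:
  assumes "filtered M"
  shows "\<exists>Fs. finite Fs \<and> (\<forall>(A, B)\<in>Fs. central_factor A B \<and> finite_orbits A B) \<and>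
    (\<forall>C. (\<forall>c\<in>C. \<forall>(A, B)\<in>Fs. \<forall>x\<in>A. c \<otimes> x \<otimes> inv c \<otimes> inv x \<in> B) \<longrightarrow> acts_nilpotently C M)"
  using assms
proof (induction rule: filtered.induct)
  case filtered_trivial
  show ?case by (intro exI[of _ "{}"]) (auto intro: acts_nilpotently.trivial)
next
  case (filtered_step L M)
  then obtain Fs where Fs: "finite Fs" "\<forall>(A, B)\<in>Fs. central_factor A B \<and> finite_orbits A B"
    "\<forall>C. (\<forall>c\<in>C. \<forall>(A, B)\<in>Fs. \<forall>x\<in>A. c \<otimes> x \<otimes> inv c \<otimes> inv x \<in> B) \<longrightarrow> acts_nilpotently C L"
    by (elim exE conjE)
  show ?case
  proof (intro exI[of _ "insert (M, L) Fs"] conjI allI impI)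
    fix C assume C: "\<forall>c\<in>C. \<forall>(A, B)\<in>insert (M, L) Fs. \<forall>x\<in>A. c \<otimes> x \<otimes> inv c \<otimes> inv x \<in> B"
    then have "acts_nilpotently C L" using Fs(3) by auto
    then show "acts_nilpotently C M"
      by (rule acts_nilpotently.step[OF _ central_factorD(1)[OF filtered_step.hyps(2)]]) (use C in auto)
  qed (use Fs filtered_step.hyps in auto)
qed

text \<open>\<open>C\<close> is the kernel of the action of \<open>K\<close> on all sections. The pigeonhole principle, applied to finitely many
  generators of a subgroup of finite index, yields exponents \<open>n\<close> and \<open>n + k\<close> whose iterates act alike, so \<open>C\<close>
  contains the images under \<open>\<phi>\<^sup>n\<close> of powers of the displacements \<open>g\<inverse> \<phi>\<^sup>k(g)\<close>.\<close>

lemma nilpotent_power_subgroup: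
  obtains C where "subgroup C G" "C \<subseteq> K" "nilpotent_group (G\<lparr>carrier := C\<rparr>)" "powers_in K C"
proof -
  obtain Fs where Fs: "finite Fs" "\<And>A B. (A, B) \<in> Fs \<Longrightarrow> central_factor A B" "\<And>A B. (A, B) \<in> Fs \<Longrightarrow> finite_orbits A B"
    "\<And>C. \<forall>c\<in>C. \<forall>(A, B)\<in>Fs. \<forall>x\<in>A. c \<otimes> x \<otimes> inv c \<otimes> inv x \<in> B \<Longrightarrow> acts_nilpotently C N"
    using filtered_sections[OF filtered_N] by blast
  obtain Y where Y: "finite Y" "Y \<subseteq> K" "powers_in K (generate G Y)"
    by (rule powers_in_generate_finite[OF rank K])
  define ac where "ac s g = abelian_section.induced G (fst s) (snd s) (conjugate g)" for s :: "'a set \<times> 'a set" and g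
  \<comment> \<open>The table of the actions of \<open>(\<phi> ^^ n) g\<close> over all sections and
    all generators \<open>g\<close>. Finite orbits leave only finitely many tables, so two of them
    coincide.\<close>
  define E where "E n = (\<lambda>(s, g)\<in>Fs \<times> Y. ac s ((\<phi> ^^ n) g))" for n
  have "range E \<subseteq> (\<Pi>\<^sub>E (s, g)\<in>Fs \<times> Y. range (\<lambda>n. ac s ((\<phi> ^^ n) g)))"
    unfolding E_def by (intro image_subsetI) (auto simp: PiE_def extensional_def split: prod.splits)
  moreover have "finite (\<Pi>\<^sub>E (s, g)\<in>Fs \<times> Y. range (\<lambda>n. ac s ((\<phi> ^^ n) g)))"
  proof (rule finite_PiE)
    show "finite (Fs \<times> Y)" using Fs(1) Y(1) by simp
    fix q assume "q \<in> Fs \<times> Y"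
    then obtain A B g where q: "q = ((A, B), g)" "(A, B) \<in> Fs" "g \<in> Y" by (cases q) auto
    have "g \<in> K" using q Y by auto
    then have "finite (range (\<lambda>n. ac (A, B) ((\<phi> ^^ n) g)))"
      using Fs(3)[OF q(2)] unfolding finite_orbits_def ac_def by simp
    then show "finite (case q of (s, g) \<Rightarrow> range (\<lambda>n. ac s ((\<phi> ^^ n) g)))" unfolding q by simp
  qed
  ultimately have "finite (range E)" by (rule finite_subset)
  then have "\<not> inj E" using finite_imageD[of E UNIV] infinite_UNIV_nat by auto
  then obtain a b where "a \<noteq> b" "E a = E b" unfolding inj_on_def by auto
  then obtain n n' where n: "n < n'" "E n = E n'" by (metis linorder_neqE_nat)
  have same: "ac (A, B) ((\<phi> ^^ n) g) = ac (A, B) ((\<phi> ^^ n') g)" if "(A, B) \<in> Fs" "g \<in> Y" for A B g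
    using fun_cong[OF n(2), of "((A, B), g)"] that unfolding E_def by simp
  define C where "C = {c \<in> K. \<forall>(A, B)\<in>Fs. \<forall>x\<in>A. c \<otimes> x \<otimes> inv c \<otimes> inv x \<in> B}"
  have C_iff: "c \<in> C \<longleftrightarrow> c \<in> K \<and> (\<forall>A B. (A, B) \<in> Fs \<longrightarrow> (\<forall>x\<in>A. abelian_section.proj G B (conjugate c x) = abelian_section.proj G B x))" for c
  proof -
    have eq: "c \<otimes> x \<otimes> inv c \<otimes> inv x \<in> B \<longleftrightarrow> abelian_section.proj G B (conjugate c x) = abelian_section.proj G B x"
      if "c \<in> K" "(A, B) \<in> Fs" "x \<in> A" for A B x
    proof -
      note cf = Fs(2)[OF that(2)]
      interpret abelian_section G A B by (rule central_factorD(8)[OF cf])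
      show ?thesis using proj_eq_iff[OF induced_conjugate_K(3)[OF cf that(1,3)] that(3)] unfolding conjugate_def by simp
    qed
    have "c \<in> C \<longleftrightarrow> c \<in> K \<and> (\<forall>A B. (A, B) \<in> Fs \<longrightarrow> (\<forall>x\<in>A. c \<otimes> x \<otimes> inv c \<otimes> inv x \<in> B))"
      unfolding C_def by auto
    also have "\<dots> \<longleftrightarrow> c \<in> K \<and> (\<forall>A B. (A, B) \<in> Fs \<longrightarrow> (\<forall>x\<in>A. abelian_section.proj G B (conjugate c x) = abelian_section.proj G B x))"
      by (intro conj_cong refl all_cong1 imp_cong ball_cong) (rule eq)
    finally show ?thesis .
  qed
  have Cacts: "abelian_section.proj G B (conjugate c x) = abelian_section.proj G B x" if "c \<in> C" "(A, B) \<in> Fs" "x \<in> A" for c A B x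
    using that C_iff[of c] by simp
  have CK: "C \<subseteq> K" unfolding C_def by auto
  have NC: "N \<subseteq> C"
    unfolding C_def using NK central_factorD(7)[OF Fs(2)] by auto
  have C: "subgroup C G"
  proof (rule subgroupI)
    show "C \<subseteq> carrier G" using CK Kc by auto
    show "C \<noteq> {}" using NC subgroup.one_closed[OF N] by auto
    fix c assume c: "c \<in> C"
    then have cK: "c \<in> K" "c \<in> carrier G" using CK Kc by auto
    have icK: "inv c \<in> K" by (rule subgroup.m_inv_closed[OF K cK(1)])
    show "inv c \<in> C"
      unfolding C_iff
    proof (intro conjI allI impI ballI icK)
      fix A B x assume AB: "(A, B) \<in> Fs" and x: "x \<in> A"
      note cf = Fs(2)[OF AB]
      have xA: "conjugate (inv c) x \<in> A" by (rule induced_conjugate_K(3)[OF cf icK x])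
      have "x \<in> carrier G" by (rule subgroup.mem_carrier[OF central_factorD(1)[OF cf] x])
      then have "conjugate c (conjugate (inv c) x) = x" by (rule conjugate_inv_cancel(1)[OF cK(2)])
      then show "abelian_section.proj G B (conjugate (inv c) x) = abelian_section.proj G B x"
        using Cacts[OF c AB xA] by simp
    qed
    fix d assume d: "d \<in> C"
    then have dK: "d \<in> K" "d \<in> carrier G" using CK Kc by auto
    show "c \<otimes> d \<in> C"
      unfolding C_iff
    proof (intro conjI allI impI ballI subgroup.m_closed[OF K cK(1) dK(1)])
      fix A B x assume AB: "(A, B) \<in> Fs" and x: "x \<in> A"
      note cf = Fs(2)[OF AB]
      have xA: "conjugate d x \<in> A" by (rule induced_conjugate_K(3)[OF cf dK(1) x])
      have "x \<in> carrier G" by (rule subgroup.mem_carrier[OF central_factorD(1)[OF cf] x])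
      then show "abelian_section.proj G B (conjugate (c \<otimes> d) x) = abelian_section.proj G B x"
        using Cacts[OF c AB xA] Cacts[OF d AB x] conjugate_mult[OF cK(2) dK(2)] by simp
    qed
  qed
  have commC: "x \<otimes> y \<otimes> inv x \<otimes> inv y \<in> C" if "x \<in> K" "y \<in> K" for x y
    using comm_K[OF that] NC by auto
  interpret KC: abelian_section G K C by (rule abelian_sectionI[OF K C CK commC])
  define f where "f = \<phi> ^^ n"
  define f' where "f' = \<phi> ^^ n'"
  have f: "f \<in> hom G G" "f' \<in> hom G G" unfolding f_def f'_def by (rule funpow_hom)+
  interpret f: group_hom G G f by unfold_locales (rule f)
  interpret f': group_hom G G f' by unfold_locales (rule f)
  have fK: "f g \<in> K" "f' g \<in> K" if "g \<in> K" for g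
    unfolding f_def f'_def using funpow_mem[OF \<phi>K that] by auto
  \<comment> \<open>\<open>f\<close> and \<open>f'\<close> agree modulo \<open>C\<close> on the
    generators in \<open>Y\<close>; since \<open>D\<close> is a subgroup, agreement spreads to some
    power of every element of \<open>K\<close>.\<close>
  define D where "D = {g \<in> K. KC.proj (f g) = KC.proj (f' g)}"
  have D: "subgroup D G"
  proof (rule subgroupI)
    show "D \<subseteq> carrier G" unfolding D_def using Kc by auto
    have "\<one> \<in> D" unfolding D_def using subgroup.one_closed[OF K] by simp
    then show "D \<noteq> {}" by auto
  qed (auto simp: D_def Kc fK KC.proj_inv KC.proj_mult subgroup.m_inv_closed[OF K] subgroup.m_closed[OF K])
  have YD: "Y \<subseteq> D"
  proof (rule subsetI)
    fix g assume g: "g \<in> Y"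
    then have gK: "g \<in> K" using Y by auto
    define z where "z = inv (f g) \<otimes> f' g"
    have K': "f g \<in> K" "f' g \<in> K" "inv (f g) \<in> K" using fK[OF gK] subgroup.m_inv_closed[OF K] by auto
    then have zK: "z \<in> K" unfolding z_def by (intro subgroup.m_closed[OF K])
    have "z \<in> C"
      unfolding C_iff
    proof (intro conjI allI impI ballI zK)
      fix A B x assume AB: "(A, B) \<in> Fs" and x: "x \<in> A"
      note cf = Fs(2)[OF AB]
      interpret AB: abelian_section G A B by (rule central_factorD(8)[OF cf])
      have fx: "conjugate (f g) x \<in> A" "conjugate (f' g) x \<in> A"
        using induced_conjugate_K(3)[OF cf _ x] K' by auto
      have "AB.proj (conjugate (f g) x) = AB.proj (conjugate (f' g) x)"
        using same[OF AB g] induced_conjugate_K(1)[OF cf K'(1) x] induced_conjugate_K(1)[OF cf K'(2) x]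
        unfolding ac_def f_def f'_def by simp
      then have "AB.proj (conjugate (inv (f g)) (conjugate (f' g) x)) = AB.proj (conjugate (inv (f g)) (conjugate (f g) x))"
        using induced_conjugate_K(1)[OF cf K'(3) fx(1)] induced_conjugate_K(1)[OF cf K'(3) fx(2)] by simp
      moreover have "conjugate (inv (f g)) (conjugate (f g) x) = x"
        by (rule conjugate_inv_cancel(2)[OF Kc[OF K'(1)] AB.Mc[OF x]])
      moreover have "conjugate z x = conjugate (inv (f g)) (conjugate (f' g) x)"
        unfolding z_def by (rule conjugate_mult[OF Kc[OF K'(3)] Kc[OF K'(2)] AB.Mc[OF x]])
      ultimately show "AB.proj (conjugate z x) = AB.proj x" by simp
    qed
    then have "\<one>\<^bsub>KC.Q\<^esub> = inv\<^bsub>KC.Q\<^esub> (KC.proj (f g)) \<otimes>\<^bsub>KC.Q\<^esub> KC.proj (f' g)"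
      using KC.proj_eq_one_iff[OF zK] K' unfolding z_def by (simp add: KC.proj_mult KC.proj_inv)
    then have "KC.proj (f g) \<otimes>\<^bsub>KC.Q\<^esub> \<one>\<^bsub>KC.Q\<^esub> = KC.proj (f' g)"
      using K' by (simp add: KC.Q.mult_inv_cancel)
    then show "g \<in> D" unfolding D_def using gK K' by simp
  qed
  have KD: "powers_in K D"
    by (rule powers_in_mono[OF Y(3) order_refl generate_subgroup_incl[OF YD D]])
  have f'_eq: "f' x = f ((\<phi> ^^ (n' - n)) x)" for x
    unfolding f_def f'_def using n(1) by (simp flip: funpow_add[THEN fun_cong, unfolded comp_def])
  \<comment> \<open>The image under \<open>f\<close> of a displacement of \<open>b\<close> is
    \<open>inv (f b) \<otimes> f' b\<close>, and its \<open>d\<close>-th power is trivial modulo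
    \<open>C\<close> as soon as \<open>b [^] d\<close> lies in \<open>D\<close>.\<close>
  have image: "\<exists>e::nat. e > 0 \<and> f y [^] e \<in> C" if y: "y \<in> K" for y
  proof -
    obtain e :: nat and b where e: "e > 0" "b \<in> K" "y [^] e \<otimes> inv (inv b \<otimes> (\<phi> ^^ (n' - n)) b) \<in> N"
      by (rule power_displacement_mod_N[OF _ y, of "n' - n"]) (use n in auto)
    let ?b = "(\<phi> ^^ (n' - n)) b"
    have bK: "?b \<in> K" "inv b \<in> K" using funpow_mem[OF \<phi>K e(2)] subgroup.m_inv_closed[OF K e(2)] by auto
    obtain d :: nat where d: "d > 0" "b [^] d \<in> D" using e(2) by (rule powers_inD[OF KD])
    have cl: "y \<in> carrier G" "b \<in> carrier G" "?b \<in> carrier G" using y e bK Kc by auto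
    have "f (y [^] e \<otimes> inv (inv b \<otimes> ?b)) \<in> N" unfolding f_def by (rule funpow_mem[OF \<phi>N e(3)])
    then have "f y [^] e \<otimes> inv (inv (f b) \<otimes> f' b) \<in> C" using NC cl by (auto simp: f'_eq f.hom_nat_pow)
    then have "KC.proj (f y [^] e) = KC.proj (inv (f b) \<otimes> f' b)"
      using KC.proj_eq_iff fK[OF y] fK[OF e(2)] subgroup_nat_pow_closed[OF K]
      by (simp add: subgroup.m_closed[OF K] subgroup.m_inv_closed[OF K])
    then have 1: "KC.proj (f y [^] e) = inv\<^bsub>KC.Q\<^esub> (KC.proj (f b)) \<otimes>\<^bsub>KC.Q\<^esub> KC.proj (f' b)"
      using fK[OF e(2)] by (simp add: KC.proj_mult KC.proj_inv subgroup.m_inv_closed[OF K])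
    have 2: "KC.proj (f b) [^]\<^bsub>KC.Q\<^esub> d = KC.proj (f' b) [^]\<^bsub>KC.Q\<^esub> d"
      using d(2) fK[OF e(2)] cl(2) unfolding D_def by (simp add: f.hom_nat_pow f'.hom_nat_pow KC.proj_nat_pow)
    have ye: "f y [^] e \<in> K" by (rule subgroup_nat_pow_closed[OF K fK(1)[OF y]])
    have "KC.proj ((f y [^] e) [^] d) = \<one>\<^bsub>KC.Q\<^esub>"
      unfolding KC.proj_nat_pow[OF ye] 1
      using 2 fK[OF e(2)] by (simp add: KC.Q.nat_pow_distrib KC.Q.nat_pow_inv)
    then have "(f y [^] e) [^] d \<in> C" using KC.proj_eq_one_iff[OF subgroup_nat_pow_closed[OF K ye]] by simp
    then show ?thesis using e(1) d(1) Kc[OF fK(1)[OF y]] by (intro exI[of _ "e * d"]) (simp add: nat_pow_pow)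
  qed
  \<comment> \<open>So far only the image of \<open>K\<close> under \<open>f\<close> is reached, but
    this image contains a power of every element of \<open>K\<close>.\<close>
  have "powers_in (f ` K) C" unfolding powers_in_def using image by auto
  then have "powers_in K C"
    using powers_in_funpow_image[OF K \<phi>K, of n] subgroup.subset[OF K] unfolding f_def
    by (intro powers_in_trans[of K "(\<phi> ^^ n) ` K" C])
  moreover have "nilpotent_group (G\<lparr>carrier := C\<rparr>)"
  proof (rule acts_nilpotently_self[OF C])
    have "acts_nilpotently C N" by (rule Fs(4)) (auto simp: C_def)
    \<comment> \<open>One more step on top of the chain for \<open>N\<close>: commutators of
      \<open>C\<close> lie in \<open>N\<close> because \<open>K / N\<close> is abelian.\<close>
    then show "acts_nilpotently C C"
      by (rule acts_nilpotently.step[OF _ C]) (use comm_K CK in auto)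
  qed
  ultimately show ?thesis using C CK by (intro that)
qed

end

section \<open>Induction along the derived series\<close>

context group
begin

text \<open>A verbal subgroup, so endomorphisms preserving \<open>K\<close> preserve it. It replaces
  a subgroup of finite index for which nothing is known about \<open>\<phi>\<close>: for a uniform
  exponent \<open>e\<close> it lies inside that subgroup and still contains powers of all
  elements.\<close>

definition power_subgroup :: "'a set \<Rightarrow> nat \<Rightarrow> 'a set" where
  "power_subgroup K e = generate G ((\<lambda>x. x [^] e) ` K)"

lemma power_subgroup:
  assumes K: "subgroup K G"
  shows "subgroup (power_subgroup K e) G" "x \<in> K \<Longrightarrow> x [^] e \<in> power_subgroup K e"
    "e > 0 \<Longrightarrow> powers_in K (power_subgroup K e)"
    "\<lbrakk>subgroup C G; \<And>x. x \<in> K \<Longrightarrow> x [^] e \<in> C\<rbrakk> \<Longrightarrow> power_subgroup K e \<subseteq> C"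
    "power_subgroup K e \<subseteq> K"
proof -
  have S: "(\<lambda>x. x [^] e) ` K \<subseteq> carrier G" using subgroup.mem_carrier[OF K] by auto
  show "subgroup (power_subgroup K e) G" unfolding power_subgroup_def by (rule generate_is_subgroup[OF S])
  show pw: "x [^] e \<in> power_subgroup K e" if "x \<in> K" for x
    unfolding power_subgroup_def by (rule generate.incl) (use that in auto)
  show "powers_in K (power_subgroup K e)" if "e > 0" unfolding powers_in_def using pw that by auto
  show min: "power_subgroup K e \<subseteq> C" if "subgroup C G" "\<And>x. x \<in> K \<Longrightarrow> x [^] e \<in> C" for C
    unfolding power_subgroup_def by (rule generate_subgroup_incl[OF _ that(1)]) (use that(2) in auto)
  show "power_subgroup K e \<subseteq> K" by (rule min[OF K subgroup_nat_pow_closed[OF K]])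
qed

lemma power_subgroup_hom:
  assumes K: "subgroup K G" and f: "f \<in> hom G G" and fK: "f ` K \<subseteq> K"
  shows "f ` power_subgroup K e \<subseteq> power_subgroup K e"
proof -
  interpret f: group_hom G G f by unfold_locales (rule f)
  have S: "(\<lambda>x. x [^] e) ` K \<subseteq> carrier G" using subgroup.mem_carrier[OF K] by auto
  have "f ` (\<lambda>x. x [^] e) ` K \<subseteq> (\<lambda>x. x [^] e) ` K"
    using fK subgroup.mem_carrier[OF K] by (auto simp: f.hom_nat_pow)
  then show ?thesis unfolding power_subgroup_def f.generate_img[OF S, symmetric] by (rule mono_generate)
qed

lemma derived_hom:
  assumes K: "subgroup K G" and f: "f \<in> hom G G" and fK: "f ` K \<subseteq> K"
  shows "f ` derived G K \<subseteq> derived G K"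
proof -
  interpret f: group_hom G G f by unfold_locales (rule f)
  let ?S = "derived_set G K"
  have Kc: "x \<in> carrier G" if "x \<in> K" for x by (rule subgroup.mem_carrier[OF K that])
  have S: "?S \<subseteq> carrier G" using Kc by auto
  have "f ` ?S \<subseteq> ?S"
  proof (rule image_subsetI)
    fix z assume "z \<in> ?S"
    then obtain x y where xy: "x \<in> K" "y \<in> K" "z = x \<otimes> y \<otimes> inv x \<otimes> inv y" by auto
    then have "f z = f x \<otimes> f y \<otimes> inv (f x) \<otimes> inv (f y)" using Kc by simp
    moreover have "f x \<in> K" "f y \<in> K" using xy fK by auto
    ultimately show "f z \<in> ?S" by blast
  qed
  then show ?thesis unfolding derived_def f.generate_img[OF S, symmetric] by (rule mono_generate)
qed

lemma normalizes_if_hom_invariant: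
  assumes K: "K \<subseteq> carrier G" and n: "normalizes K M"
    and inv: "\<And>f. \<lbrakk>f \<in> hom G G; f ` M \<subseteq> M\<rbrakk> \<Longrightarrow> f ` L \<subseteq> L"
  shows "normalizes K L"
  unfolding normalizes_iff
proof (intro ballI)
  fix k x assume k: "k \<in> K" and x: "x \<in> L"
  have "conjugate k ` L \<subseteq> L"
    by (rule inv[OF conjugate_hom]) (use k K n in \<open>auto simp: normalizes_iff\<close>)
  then show "conjugate k x \<in> L" using x by auto
qed

text \<open>Powers of \<open>g\<close> move \<open>x\<close> through finitely many cosets of
  \<open>N\<close>, so some \<open>g [^] (j - i)\<close> with \<open>j - i \<le> m\<close> fixes the
  coset of \<open>x\<close>. The exponent \<open>fact m\<close> then works for all \<open>g\<close>
  and \<open>x\<close> together.\<close>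

lemma power_centralizes_mod:
  assumes K: "subgroup K G" and M: "subgroup M G" and N: "subgroup N G"
    and nM: "normalizes K M" and nN: "normalizes K N" and cov: "finite_cover M N"
  obtains e :: nat where "e > 0" "\<And>g x. \<lbrakk>g \<in> K; x \<in> M\<rbrakk> \<Longrightarrow> conjugate (g [^] e) x \<otimes> inv x \<in> N"
proof -
  obtain m where m: "\<forall>f::nat \<Rightarrow> 'a. (\<forall>i. f i \<in> M \<inter> carrier G) \<longrightarrow>
      (\<exists>i j. i < j \<and> j \<le> m \<and> f j \<otimes> inv (f i) \<in> N)"
    using finite_cover_pigeonhole[OF N cov] by (rule exE)
  have Kc: "x \<in> carrier G" if "x \<in> K" for x by (rule subgroup.mem_carrier[OF K that])
  have Mc: "x \<in> carrier G" if "x \<in> M" for x by (rule subgroup.mem_carrier[OF M that])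
  have "conjugate (g [^] (fact m :: nat)) x \<otimes> inv x \<in> N" if g: "g \<in> K" and x: "x \<in> M" for g x
  proof -
    have gi: "g [^] i \<in> K" for i :: nat by (rule subgroup_nat_pow_closed[OF K g])
    have gM: "conjugate (g [^] i) x \<in> M" for i :: nat using nM gi x unfolding normalizes_iff by auto
    have all: "\<forall>i::nat. conjugate (g [^] i) x \<in> M \<inter> carrier G" using gM Mc[OF gM] by simp
    obtain i j where ij: "i < j" "j \<le> m" "conjugate (g [^] j) x \<otimes> inv (conjugate (g [^] i) x) \<in> N"
      using mp[OF spec[OF m, of "\<lambda>i. conjugate (g [^] i) x"] all] by (elim exE conjE)
    define c where "c = g [^] (j - i)"
    have c: "c \<in> K" "c \<in> carrier G" unfolding c_def using gi[of "j - i"] Kc[OF gi[of "j - i"]] by auto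
    have gj: "g [^] j = g [^] i \<otimes> c" unfolding c_def using ij(1) Kc[OF g] by (simp add: nat_pow_mult)
    have "conjugate (inv (g [^] i)) (conjugate (g [^] j) x \<otimes> inv (conjugate (g [^] i) x)) \<in> N"
      using nN subgroup.m_inv_closed[OF K gi] ij(3) unfolding normalizes_iff by blast
    moreover have "conjugate (inv (g [^] i)) (conjugate (g [^] j) x \<otimes> inv (conjugate (g [^] i) x)) = conjugate c x \<otimes> inv x"
      unfolding gj conjugate_def using c(2) Kc[OF gi[of i]] Mc[OF x] by (simp add: group_word_simps)
    ultimately have base: "conjugate c x \<otimes> inv x \<in> N" by simp
    have step: "conjugate (c [^] k) x \<otimes> inv x \<in> N" for k :: nat
    proof (induction k)
      case 0 then show ?case using Mc[OF x] subgroup.one_closed[OF N] by (simp add: conjugate_def)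
    next
      case (Suc k)
      have ck: "c [^] k \<in> K" "c [^] k \<in> carrier G" using subgroup_nat_pow_closed[OF K c(1)] c(2) by auto
      have "conjugate (c [^] k) (conjugate c x \<otimes> inv x) \<in> N" using nN ck base unfolding normalizes_iff by blast
      then have "conjugate (c [^] k) (conjugate c x \<otimes> inv x) \<otimes> (conjugate (c [^] k) x \<otimes> inv x) \<in> N"
        by (rule subgroup.m_closed[OF N _ Suc.IH])
      moreover have "conjugate (c [^] k) (conjugate c x \<otimes> inv x) \<otimes> (conjugate (c [^] k) x \<otimes> inv x) = conjugate (c [^] Suc k) x \<otimes> inv x"
        unfolding conjugate_def using c ck Mc[OF x] by (simp add: group_word_simps)
      ultimately show ?case by simp
    qed
    have "(j - i) dvd fact m" using ij by (intro dvd_fact) auto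
    then obtain k where "fact m = (j - i) * k" by (rule dvdE)
    then have "g [^] (fact m :: nat) = c [^] k" unfolding c_def using Kc[OF g] by (simp add: nat_pow_pow)
    then show ?thesis using step by simp
  qed
  then show ?thesis by (intro that[of "fact m"]) auto
qed

text \<open>As \<open>x\<close> acts trivially on \<open>M\<close> modulo \<open>N\<close>, the
  cocycle identity \<open>c (Suc n) = conjugate x (c n) \<otimes> c 1\<close> makes the commutator
  of \<open>x [^] n\<close> with \<open>y\<close> congruent to the \<open>n\<close>-th power of that
  of \<open>x\<close> with \<open>y\<close>. For \<open>n = e\<close> this power lies in
  \<open>N\<close>.\<close>

lemma commutator_power_mod:
  assumes K: "subgroup K G" and M: "subgroup M G" and N: "subgroup N G" and nN: "normalizes K N"
    and comm: "\<And>x y. \<lbrakk>x \<in> K; y \<in> K\<rbrakk> \<Longrightarrow> x \<otimes> y \<otimes> inv x \<otimes> inv y \<in> M" and MK: "M \<subseteq> K"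
    and x: "x \<in> K" and cx: "\<And>z. z \<in> M \<Longrightarrow> conjugate x z \<otimes> inv z \<in> N" and y: "y \<in> K"
    and e: "\<And>z. z \<in> M \<Longrightarrow> z [^] (e::nat) \<in> N"
  shows "x [^] e \<otimes> y \<otimes> inv (x [^] e) \<otimes> inv y \<in> N"
proof -
  define c where "c n = x [^] n \<otimes> y \<otimes> inv (x [^] n) \<otimes> inv y" for n :: nat
  have Kc: "x \<in> carrier G" if "x \<in> K" for x by (rule subgroup.mem_carrier[OF K that])
  have xn: "x [^] n \<in> K" for n :: nat by (rule subgroup_nat_pow_closed[OF K x])
  have cM: "c n \<in> M" for n unfolding c_def by (rule comm[OF xn y])
  have cc: "c n \<in> carrier G" for n using cM MK Kc by auto
  have xy: "x \<in> carrier G" "y \<in> carrier G" using x y Kc by auto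
  have cSuc: "c (Suc n) = conjugate x (c n) \<otimes> c 1" for n
  proof -
    have p: "x [^] Suc n = x \<otimes> x [^] n" using nat_pow_Suc2[OF xy(1)] by simp
    show ?thesis unfolding c_def p conjugate_def using xy by (simp add: group_word_simps)
  qed
  have "c n \<otimes> inv (c 1 [^] n) \<in> N" for n
  proof (induction n)
    case 0 show ?case unfolding c_def using xy subgroup.one_closed[OF N] by simp
  next
    case (Suc n)
    have "(conjugate x (c n) \<otimes> inv (c n)) \<otimes> (c n \<otimes> inv (c 1 [^] n)) \<in> N"
      by (rule subgroup.m_closed[OF N cx[OF cM] Suc.IH])
    moreover have "(conjugate x (c n) \<otimes> inv (c n)) \<otimes> (c n \<otimes> inv (c 1 [^] n)) = c (Suc n) \<otimes> inv (c 1 [^] Suc n)"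
      unfolding cSuc using xy cc hom_in_carrier[OF conjugate_hom[OF xy(1)] cc[of n]] by (simp add: group_word_simps)
    ultimately show ?case by simp
  qed
  from this[of e] have "c e \<otimes> inv (c 1 [^] e) \<otimes> c 1 [^] e \<in> N" by (rule subgroup.m_closed[OF N _ e[OF cM]])
  moreover have "c e \<otimes> inv (c 1 [^] e) \<otimes> c 1 [^] e = c e" using cc by (simp add: m_assoc)
  ultimately have "c e \<in> N" by simp
  then show ?thesis unfolding c_def .
qed

text \<open>This is the preimage of the centre of \<open>K / N\<close>. Being a subgroup, it
  contains whatever is generated by powers that lie in it.\<close>

lemma centralizer_mod_subgroup:
  assumes K: "subgroup K G" and N: "subgroup N G" and nN: "normalizes K N"
  shows "subgroup {g \<in> K. \<forall>k\<in>K. g \<otimes> k \<otimes> inv g \<otimes> inv k \<in> N} G" (is "subgroup ?Z G")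
proof (rule subgroupI)
  have Kc: "x \<in> carrier G" if "x \<in> K" for x by (rule subgroup.mem_carrier[OF K that])
  show "?Z \<subseteq> carrier G" using Kc by auto
  have "\<one> \<in> ?Z" using subgroup.one_closed[OF K] subgroup.one_closed[OF N] Kc by simp
  then show "?Z \<noteq> {}" by auto
  fix g assume g: "g \<in> ?Z"
  then have gK: "g \<in> K" "inv g \<in> K" "g \<in> carrier G" using subgroup.m_inv_closed[OF K] Kc by auto
  have "inv g \<otimes> k \<otimes> inv (inv g) \<otimes> inv k \<in> N" if k: "k \<in> K" for k
  proof -
    have "inv (g \<otimes> k \<otimes> inv g \<otimes> inv k) \<in> N" using g k by (intro subgroup.m_inv_closed[OF N]) auto
    then have "inv g \<otimes> inv (g \<otimes> k \<otimes> inv g \<otimes> inv k) \<otimes> inv (inv g) \<in> N"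
      using nN gK unfolding normalizes_def by blast
    then show ?thesis using gK Kc[OF k] by (simp add: group_word_simps)
  qed
  then show "inv g \<in> ?Z" using gK by auto
  fix l assume l: "l \<in> ?Z"
  then have lK: "l \<in> K" "l \<in> carrier G" using Kc by auto
  have "(g \<otimes> l) \<otimes> k \<otimes> inv (g \<otimes> l) \<otimes> inv k \<in> N" if k: "k \<in> K" for k
  proof -
    have "g \<otimes> (l \<otimes> k \<otimes> inv l \<otimes> inv k) \<otimes> inv g \<in> N"
      using nN gK l k unfolding normalizes_def by auto
    then have "g \<otimes> (l \<otimes> k \<otimes> inv l \<otimes> inv k) \<otimes> inv g \<otimes> (g \<otimes> k \<otimes> inv g \<otimes> inv k) \<in> N"
      by (rule subgroup.m_closed[OF N]) (use g k in auto)
    then show ?thesis using gK lK Kc[OF k] by (simp add: group_word_simps)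
  qed
  then show "g \<otimes> l \<in> ?Z" using subgroup.m_closed[OF K gK(1) lK(1)] by auto
qed

text \<open>The subgroup \<open>C'\<close> given by the induction hypothesis in the derived subgroup
  \<open>M\<close> need be neither \<open>\<phi>\<close>-invariant nor normalized by
  \<open>K\<close>. The subgroup \<open>N\<close> of \<open>e\<close>-th powers of \<open>M\<close>
  cures both, but \<open>K / N\<close> is then only finite-by-abelian. In such a quotient suitable
  powers are central, so the subgroup \<open>J\<close> generated by these powers is abelian modulo
  \<open>N\<close>, and \<open>expanding_section\<close> applies to \<open>J\<close> and
  \<open>N \<inter> J\<close>.\<close>

lemma solvable_imp_nilpotent_power_subgroup:
  assumes rank: "power_rank_on (carrier G) h" and covered: "power_covered_on (carrier G)"
    and \<phi>: "\<phi> \<in> hom G G" and inj: "inj_on \<phi> (carrier G)"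
    and fixed: "\<And>k. k > 0 \<Longrightarrow> finite {x \<in> carrier G. (\<phi> ^^ k) x = x}"
    and K: "subgroup K G" and \<phi>K: "\<phi> ` K \<subseteq> K" and solv: "(derived G ^^ d) K \<subseteq> {\<one>}"
  shows "\<exists>C. subgroup C G \<and> C \<subseteq> K \<and> nilpotent_group (G\<lparr>carrier := C\<rparr>) \<and> powers_in K C"
  using K \<phi>K solv
proof (induction d arbitrary: K)
  case 0
  then have "K = {\<one>}" using subgroup.one_closed by fastforce
  then have "nilpotent_group (G\<lparr>carrier := K\<rparr>)" unfolding nilpotent_group_def by (intro exI[of _ 0]) simp
  moreover have "powers_in K K"
    unfolding powers_in_def using subgroup.mem_carrier[OF 0(1)] by (auto intro!: exI[of _ "1::nat"])
  ultimately show ?case using 0(1) by (intro exI[of _ K] conjI order_refl)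
next
  case (Suc d)
  note K = Suc.prems(1)
  have Kc: "K \<subseteq> carrier G" by (rule subgroup.subset[OF K])
  have nK: "normalizes K K"
    unfolding normalizes_def by (intro ballI subgroup.m_closed[OF K] subgroup.m_inv_closed[OF K])
  define M where "M = derived G K"
  have M: "subgroup M G" unfolding M_def by (rule derived_is_subgroup[OF Kc])
  have MK: "M \<subseteq> K" unfolding M_def by (rule derived_incl[OF order_refl K])
  have comm: "x \<otimes> y \<otimes> inv x \<otimes> inv y \<in> M" if "x \<in> K" "y \<in> K" for x y
    unfolding M_def derived_def by (rule generate.incl) (use that in blast)
  have \<phi>M: "\<phi> ` M \<subseteq> M" unfolding M_def by (rule derived_hom[OF K \<phi> Suc.prems(2)])
  have nM: "normalizes K M"
    by (rule normalizes_if_hom_invariant[OF Kc nK]) (unfold M_def, rule derived_hom[OF K])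
  have "(derived G ^^ d) M \<subseteq> {\<one>}" using Suc.prems(3) unfolding M_def by (simp add: funpow_swap1)
  from Suc.IH[OF M \<phi>M this] obtain C' where C': "subgroup C' G" "C' \<subseteq> M"
    "nilpotent_group (G\<lparr>carrier := C'\<rparr>)" "powers_in M C'" by (elim exE conjE)
  have "finite_cover M C'" using covered M C' subgroup.subset[OF M] unfolding power_covered_on_def by blast
  then obtain e :: nat where e: "e > 0" "\<And>x. x \<in> M \<Longrightarrow> x [^] e \<in> C'"
    by (rule finite_cover_uniform_exponent[OF C'(1) M]) blast
  define N where "N = power_subgroup M e"
  have N: "subgroup N G" unfolding N_def by (rule power_subgroup(1)[OF M])
  have NC': "N \<subseteq> C'" unfolding N_def by (rule power_subgroup(4)[OF M C'(1) e(2)])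
  have NM: "N \<subseteq> M" using NC' C'(2) by simp
  have \<phi>N: "\<phi> ` N \<subseteq> N" unfolding N_def by (rule power_subgroup_hom[OF M \<phi> \<phi>M])
  have nN: "normalizes K N"
    by (rule normalizes_if_hom_invariant[OF Kc nM]) (unfold N_def, rule power_subgroup_hom[OF M])
  have "finite_cover M N"
    using covered M N NM subgroup.subset[OF M] power_subgroup(3)[OF M e(1)]
    unfolding power_covered_on_def N_def by blast
  then obtain f :: nat where f: "f > 0" "\<And>g x. \<lbrakk>g \<in> K; x \<in> M\<rbrakk> \<Longrightarrow> conjugate (g [^] f) x \<otimes> inv x \<in> N"
    by (rule power_centralizes_mod[OF K M N nM nN]) blast
  \<comment> \<open>The factor \<open>f\<close> makes \<open>g [^] f\<close> centralize
    \<open>M\<close> modulo \<open>N\<close>; the factor \<open>e\<close> then kills the remaining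
    commutator, as \<open>N\<close> contains the \<open>e\<close>-th powers of
    \<open>M\<close>.\<close>
  have central: "g [^] (f * e) \<otimes> k \<otimes> inv (g [^] (f * e)) \<otimes> inv k \<in> N" if g: "g \<in> K" and k: "k \<in> K" for g k
  proof -
    have "(g [^] f) [^] e \<otimes> k \<otimes> inv ((g [^] f) [^] e) \<otimes> inv k \<in> N"
      by (rule commutator_power_mod[OF K M N nN comm MK subgroup_nat_pow_closed[OF K g] f(2)[OF g] k])
         (auto simp: N_def power_subgroup(2)[OF M])
    then show ?thesis using g Kc by (auto simp: nat_pow_pow)
  qed
  define J where "J = power_subgroup K (f * e)"
  have J: "subgroup J G" unfolding J_def by (rule power_subgroup(1)[OF K])
  have JK: "J \<subseteq> K" unfolding J_def by (rule power_subgroup(5)[OF K])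
  have \<phi>J: "\<phi> ` J \<subseteq> J" unfolding J_def by (rule power_subgroup_hom[OF K \<phi> Suc.prems(2)])
  have KJ: "powers_in K J" unfolding J_def by (rule power_subgroup(3)[OF K]) (use e f in simp)
  have "J \<subseteq> {g \<in> K. \<forall>k\<in>K. g \<otimes> k \<otimes> inv g \<otimes> inv k \<in> N}"
    unfolding J_def
    by (rule power_subgroup(4)[OF K centralizer_mod_subgroup[OF K N nN]])
       (use central subgroup_nat_pow_closed[OF K] in auto)
  then have commJ: "x \<otimes> y \<otimes> inv x \<otimes> inv y \<in> N \<inter> J" if "x \<in> J" "y \<in> J" for x y
    using that JK by (auto intro!: subgroup.m_closed[OF J] subgroup.m_inv_closed[OF J])
  interpret E: expanding_section G h \<phi> J "N \<inter> J"
  proof (intro expanding_section.intro expanding_section_axioms.intro is_group rank covered \<phi> inj fixed J \<phi>J commJ)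
    show NJ: "subgroup (N \<inter> J) G" by (rule subgroups_Inter_pair[OF N J])
    show "\<phi> ` (N \<inter> J) \<subseteq> N \<inter> J" using \<phi>N \<phi>J by auto
    show "nilpotent_group (G\<lparr>carrier := N \<inter> J\<rparr>)"
      by (rule nilpotent_subset[OF NJ C'(1) _ C'(3)]) (use NC' in auto)
  qed auto
  obtain C where C: "subgroup C G" "C \<subseteq> J" "nilpotent_group (G\<lparr>carrier := C\<rparr>)" "powers_in J C"
    by (rule E.nilpotent_power_subgroup)
  have "powers_in K C" by (rule powers_in_trans[OF KJ C(4) Kc])
  then show ?case using C JK by (intro exI[of _ C]) auto
qed

end

theorem theorem3p10:
  fixes \<Gamma> :: "('a, 'b) monoid_scheme"
  assumes "group \<Gamma>"
    and "virtually_polycyclic \<Gamma>"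
    and "strongly_scale_invariant \<Gamma>"
  shows "virtually_nilpotent \<Gamma>"
proof -
  interpret group \<Gamma> by (rule assms(1))
  obtain P where P: "subgroup P \<Gamma>" "finite (rcosets\<^bsub>\<Gamma>\<^esub> P)" "polycyclic_group (\<Gamma>\<lparr>carrier := P\<rparr>)"
    using assms(2) unfolding virtually_polycyclic_def finite_index_subgroup_def by auto
  obtain \<phi> where \<phi>: "\<phi> \<in> hom \<Gamma> \<Gamma>" "inj_on \<phi> (carrier \<Gamma>)"
    and fin: "finite (\<Inter>n\<in>{0<..}. (\<phi> ^^ n) ` carrier \<Gamma>)"
    using assms(3) unfolding strongly_scale_invariant_def strongly_scale_invariant_mon_def mon_def by auto
  have P_cover: "finite_cover (carrier \<Gamma>) P" using P(2) finite_cover_carrier_iff[OF P(1)] by simp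
  obtain h0 where "power_rank_on P h0" using polycyclic_power_covered(2)[OF P(1,3)] by (rule exE)
  note pc = virtually_power_covered[OF P(1) P_cover polycyclic_power_covered(1)[OF P(1,3)] this]
  \<comment> \<open>A fixed point \<open>x\<close> of \<open>\<phi> ^^ k\<close> is an
    \<open>n\<close>-fold image for every \<open>n\<close>, namely of
    \<open>(\<phi> ^^ (k * n - n)) x\<close>. So all fixed points lie in the intersection that is
    finite by hypothesis.\<close>
  have fixed: "finite {x \<in> carrier \<Gamma>. (\<phi> ^^ k) x = x}" if k: "k > 0" for k
  proof (rule finite_subset[OF _ fin])
    show "{x \<in> carrier \<Gamma>. (\<phi> ^^ k) x = x} \<subseteq> (\<Inter>n\<in>{0<..}. (\<phi> ^^ n) ` carrier \<Gamma>)"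
    proof (intro subsetI INT_I)
      fix x n assume x: "x \<in> {x \<in> carrier \<Gamma>. (\<phi> ^^ k) x = x}" and "n \<in> {0::nat<..}"
      have pow: "(\<phi> ^^ (k * j)) x = x" for j
        using x by (induction j) (simp_all add: funpow_add)
      have "n \<le> k * n" using k by simp
      then have "(\<phi> ^^ n) ((\<phi> ^^ (k * n - n)) x) = x" using pow[of n] by (simp flip: funpow_add[THEN fun_cong, unfolded comp_def])
      moreover have "(\<phi> ^^ (k * n - n)) x \<in> carrier \<Gamma>" using x by (intro hom_in_carrier[OF hom_funpow[OF \<phi>(1)]]) auto
      ultimately show "x \<in> (\<phi> ^^ n) ` carrier \<Gamma>" by (metis imageI)
    qed
  qed
  obtain e :: nat where e: "e > 0" "\<And>x. x \<in> carrier \<Gamma> \<Longrightarrow> x [^]\<^bsub>\<Gamma>\<^esub> e \<in> P"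
    by (rule finite_cover_uniform_exponent[OF P(1) subgroup_self P_cover]) blast
  \<comment> \<open>\<open>P\<close> need not be \<open>\<phi>\<close>-invariant; the subgroup
    generated by \<open>e\<close>-th powers is, and it inherits solvability from
    \<open>P\<close>.\<close>
  let ?K = "power_subgroup (carrier \<Gamma>) e"
  obtain d where d: "(derived \<Gamma> ^^ d) P \<subseteq> {\<one>\<^bsub>\<Gamma>\<^esub>}" by (rule polycyclic_solvable[OF P(1,3)])
  have "?K \<subseteq> P" by (rule power_subgroup(4)[OF subgroup_self P(1) e(2)])
  then have "(derived \<Gamma> ^^ d) ?K \<subseteq> {\<one>\<^bsub>\<Gamma>\<^esub>}" using mono_exp_of_derived d by blast
  then obtain C where C: "subgroup C \<Gamma>" "nilpotent_group (\<Gamma>\<lparr>carrier := C\<rparr>)" "powers_in ?K C"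
    using solvable_imp_nilpotent_power_subgroup[OF pc(2,1) \<phi> fixed power_subgroup(1)[OF subgroup_self]
        power_subgroup_hom[OF subgroup_self \<phi>(1) hom_carrier[OF \<phi>(1)]]] by blast
  have "powers_in (carrier \<Gamma>) C"
    by (rule powers_in_trans[OF power_subgroup(3)[OF subgroup_self e(1)] C(3) order_refl])
  then have "finite_cover (carrier \<Gamma>) C"
    using pc(1) C(1) subgroup_self subgroup.subset[OF C(1)] unfolding power_covered_on_def by blast
  then have "finite (rcosets\<^bsub>\<Gamma>\<^esub> C)" using finite_cover_carrier_iff[OF C(1)] by simp
  then show ?thesis
    unfolding virtually_nilpotent_def finite_index_subgroup_def using C by blast
qed

end
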